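(* Let $\mathcal{H}$ be a complex separable Hilbert space with bounded linear operators $\mathcal{L}(\mathcal{H})$, let $\Omega\subseteq\mathbb{C}$ be open and connected, and let $\hat f:\Omega\to\mathcal{L}(\mathcal{H})$ be an analytic operator-valued function such that, for every $\lambda\in\Omega$, both $\hat f(\lambda)$ and $\frac{d}{d\lambda}\hat f(\lambda)$ are of trace class. Put $d(\lambda)=\det(I+\hat f(\lambda))$ for $\lambda\in\Omega$, and let $\hat D(\lambda)$ be the analytic operator-valued function on $\Omega$ with $[I+\hat f(\lambda)]^{-1}=\hat D(\lambda)/d(\lambda)$ wherever $I+\hat f(\lambda)$ is invertible. Let $\lambda_0\in\Omega$ be such that $d(\lambda_0)\neq0$. For the complex parameter $\xi$, the operator-valued functions $\xi\hat f(\lambda_0)$ and $\frac{d}{d\xi}(\xi\hat f(\lambda_0))=\hat f(\lambda_0)$ are analytic in $\xi$ and of trace class. Put $$d(\xi,\lambda_0)=\det\bigl(I+\xi\hat f(\lambda_0)\bigr),\qquad \xi\in\mathbb{C},$$ and let $\hat D(\xi,\lambda_0)$ be the operator-valued function, analytic for all $\xi\in\mathbb{C}$ (including the zeros of $d(\cdot,\lambda_0)$), with $$[I+\xi\hat f(\lambda_0)]^{-1}=\hat D(\xi,\lambda_0)/d(\xi,\lambda_0)$$ wherever $I+\xi\hat f(\lambda_0)$ is invertible. Then $$\frac{d}{d\xi}d(\xi,\lambda_0)=\mathrm{Tr}\bigl[\hat f(\lambda_0)\,\hat D(\xi,\lambda_0)\bigr]\qquad(\xi\in\mathbb{C}),$$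 $$\frac{d}{d\xi}\hat D(\xi,\lambda_0)=\frac{\hat D(\xi,\lambda_0)}{d(\xi,\lambda_0)}\Bigl[\frac{d}{d\xi}d(\xi,\lambda_0)\,I-\hat f(\lambda_0)\,\hat D(\xi,\lambda_0)\Bigr]\qquad(d(\xi,\lambda_0)\neq0),$$ with initial values $$d(0,\lambda_0)=1,\qquad \hat D(0,\lambda_0)=I,$$ and at $\xi=1$ $$d(1,\lambda_0)=d(\lambda_0),\qquad \hat D(1,\lambda_0)=\hat D(\lambda_0).$$ Thus integrating these equations from $\xi=0$ to $\xi=1$ gives the initial values $d(\lambda_0)$, $\hat D(\lambda_0)$ at $\lambda=\lambda_0$ for the imbedding equations in $\lambda$, $$\frac{d}{d\lambda}d(\lambda)=\mathrm{Tr}\Bigl[\frac{d\hat f}{d\lambda}(\lambda)\hat D(\lambda)\Bigr],\qquad \frac{d}{d\lambda}\hat D(\lambda)=\frac{\hat D(\lambda)}{d(\lambda)}\Bigl[\frac{d}{d\lambda}d(\lambda)\,I-\frac{d\hat f}{d\lambda}(\lambda)\hat D(\lambda)\Bigr].$$ In the special case $\hat f(\lambda_0)=0$ one has directly $d(\lambda_0)=1$ and $\hat D(\lambda_0)=I$.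
   Context: A bounded operator $\hat A$ on $\mathcal{H}$ is of trace class if $\mathrm{Tr}|\hat A|<\infty$. Analyticity of operator-valued functions means analyticity as functions with values in $\mathcal{L}(\mathcal{H})$. For a trace class operator $\hat A$, the (Fredholm) determinant is $$\det(I+\hat A)=\sum_{k=0}^{\infty}\mathrm{Tr}\bigl[\wedge^k(\hat A)\bigr],$$ where $\wedge^k(\hat A)$ is the operator induced by $\hat A$ on the $k$-th exterior power of $\mathcal{H}$ and $\mathrm{Tr}[\wedge^0(\hat A)]=1$. The functions $\hat D(\lambda)$ and $\hat D(\xi,\lambda_0)$ are the products of the determinant with the inverse operator, continued analytically across the isolated points where the inverse fails to exist.
   Formalization: The imbedding equation d'(λ)=Tr[f'(λ)D(λ)] is stated only at those λ where f has derivative f'(λ) also in trace norm; with only pointwise trace class values of f and f' it can fail. All other claims are unchanged. *)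

theory Defs
  imports "HOL-Complex_Analysis.Complex_Analysis"
begin

section \<open>Complex normed spaces and complex Hilbert spaces\<close>

class complex_normed_vector = real_normed_vector +
  fixes scaleC :: "complex \<Rightarrow> 'a \<Rightarrow> 'a" (infixr \<open>*\<^sub>C\<close> 75)
  assumes scaleC_add_right: "a *\<^sub>C (x + y) = a *\<^sub>C x + a *\<^sub>C y"
    and scaleC_add_left: "(a + b) *\<^sub>C x = a *\<^sub>C x + b *\<^sub>C x"
    and scaleC_scaleC: "a *\<^sub>C b *\<^sub>C x = (a * b) *\<^sub>C x"
    and scaleR_scaleC: "r *\<^sub>R x = complex_of_real r *\<^sub>C x"
    and norm_scaleC: "norm (a *\<^sub>C x) = norm a * norm x"

text \<open>The inner product is conjugate-linear in the first and linear in the second argument.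
  Its real part is the library's real inner product, which fixes norm, topology and definiteness.\<close>

class complex_hilbert_space = complex_normed_vector + real_inner + complete_space +
  fixes cinner :: "'a \<Rightarrow> 'a \<Rightarrow> complex"
  assumes cinner_commute: "cinner x y = cnj (cinner y x)"
    and cinner_add_right: "cinner x (y + z) = cinner x y + cinner x z"
    and cinner_scaleC_right: "cinner x (c *\<^sub>C y) = c * cinner x y"
    and inner_eq_Re_cinner: "inner x y = Re (cinner x y)"

instantiation complex :: complex_hilbert_space
begin

definition scaleC_complex :: "complex \<Rightarrow> complex \<Rightarrow> complex"
  where "scaleC_complex a x = a * x"

definition cinner_complex :: "complex \<Rightarrow> complex \<Rightarrow> complex"
  where "cinner_complex x y = cnj x * y"

instance
  by standard
    (simp_all add: scaleC_complex_def cinner_complex_def algebra_simps norm_mult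
      scaleR_conv_of_real inner_complex_def)

end

lemma bounded_linear_scaleC_right:
  "bounded_linear (\<lambda>x::'a::complex_normed_vector. c *\<^sub>C x)"
  by (rule bounded_linear_intro[where K = "norm c"])
    (simp_all add: scaleC_add_right scaleR_scaleC scaleC_scaleC norm_scaleC mult.commute)

instantiation blinfun :: (real_normed_vector, complex_normed_vector) complex_normed_vector
begin

lift_definition scaleC_blinfun :: "complex \<Rightarrow> ('a \<Rightarrow>\<^sub>L 'b) \<Rightarrow> ('a \<Rightarrow>\<^sub>L 'b)"
  is "\<lambda>c T x. c *\<^sub>C T x"
  by (rule bounded_linear_compose[OF bounded_linear_scaleC_right])

instance
proof
  fix a b :: complex and S T :: "'a \<Rightarrow>\<^sub>L 'b" and r :: real
  show "a *\<^sub>C (S + T) = a *\<^sub>C S + a *\<^sub>C T"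
    by transfer (simp add: scaleC_add_right)
  show "(a + b) *\<^sub>C S = a *\<^sub>C S + b *\<^sub>C S"
    by transfer (simp add: scaleC_add_left)
  show "a *\<^sub>C b *\<^sub>C S = (a * b) *\<^sub>C S"
    by transfer (simp add: scaleC_scaleC)
  show "r *\<^sub>R S = complex_of_real r *\<^sub>C S"
    by transfer (simp add: scaleR_scaleC)
  have le: "norm (c *\<^sub>C R) \<le> norm c * norm R" for c and R :: "'a \<Rightarrow>\<^sub>L 'b"
  proof (rule norm_blinfun_bound)
    fix x :: 'a
    have "norm (blinfun_apply (c *\<^sub>C R) x) = norm c * norm (blinfun_apply R x)"
      by transfer (simp add: norm_scaleC)
    also have "\<dots> \<le> norm c * (norm R * norm x)"
      by (intro mult_left_mono norm_blinfun) simp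
    finally show "norm (blinfun_apply (c *\<^sub>C R) x) \<le> norm c * norm R * norm x"
      by (simp add: mult.assoc)
  qed simp
  show "norm (a *\<^sub>C S) = norm a * norm S"
  proof (cases "a = 0")
    case True
    then show ?thesis using le[of a S] by simp
  next
    case False
    have one: "inverse a *\<^sub>C a *\<^sub>C S = S"
    proof (rule blinfun_eqI)
      fix x :: 'a
      have "blinfun_apply (inverse a *\<^sub>C a *\<^sub>C S) x = complex_of_real 1 *\<^sub>C blinfun_apply S x"
        using False by (simp add: scaleC_blinfun.rep_eq scaleC_scaleC)
      also have "\<dots> = blinfun_apply S x"
        by (simp only: scaleR_scaleC[symmetric] scaleR_one)
      finally show "blinfun_apply (inverse a *\<^sub>C a *\<^sub>C S) x = blinfun_apply S x" .
    qed
    have "norm S \<le> norm (inverse a) * norm (a *\<^sub>C S)"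
      using le[of "inverse a" "a *\<^sub>C S"] one by simp
    then have "norm a * norm S \<le> norm (a *\<^sub>C S)"
      using False by (simp add: norm_divide field_simps)
    then show ?thesis using le[of a S] by simp
  qed
qed

end


section \<open>Bounded complex-linear operators and operator-valued functions\<close>

text \<open>The library type of bounded linear maps consists of the real-linear ones;
  $\mathcal{L}(\mathcal{H})$ is its closed subspace of complex-linear maps.\<close>

definition bounded_ops :: "('a::complex_hilbert_space \<Rightarrow>\<^sub>L 'a) set"
  where "bounded_ops =
    {T. \<forall>c x. blinfun_apply T (c *\<^sub>C x) = c *\<^sub>C blinfun_apply T x}"

definition op_adjoint ::
    "('a::complex_hilbert_space \<Rightarrow>\<^sub>L 'a) \<Rightarrow> ('a \<Rightarrow>\<^sub>L 'a)"
  where "op_adjoint A =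
    (THE B. B \<in> bounded_ops \<and>
      (\<forall>x y. cinner (blinfun_apply B x) y = cinner x (blinfun_apply A y)))"

definition is_op_inverse ::
    "('a::complex_hilbert_space \<Rightarrow>\<^sub>L 'a) \<Rightarrow> ('a \<Rightarrow>\<^sub>L 'a) \<Rightarrow> bool"
  where "is_op_inverse T R \<longleftrightarrow>
    R \<in> bounded_ops \<and> R o\<^sub>L T = id_blinfun \<and> T o\<^sub>L R = id_blinfun"

definition op_invertible :: "('a::complex_hilbert_space \<Rightarrow>\<^sub>L 'a) \<Rightarrow> bool"
  where "op_invertible T \<longleftrightarrow> (\<exists>R. is_op_inverse T R)"

definition op_inverse ::
    "('a::complex_hilbert_space \<Rightarrow>\<^sub>L 'a) \<Rightarrow> ('a \<Rightarrow>\<^sub>L 'a)"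
  where "op_inverse T = (THE R. is_op_inverse T R)"

text \<open>Complex derivative with respect to the operator norm.\<close>

definition has_op_derivative ::
    "(complex \<Rightarrow> 'a::complex_hilbert_space \<Rightarrow>\<^sub>L 'a) \<Rightarrow> ('a \<Rightarrow>\<^sub>L 'a) \<Rightarrow> complex \<Rightarrow> bool"
  where "has_op_derivative F F' z \<longleftrightarrow> (F has_derivative (\<lambda>h. h *\<^sub>C F')) (at z)"

definition op_analytic_on ::
    "(complex \<Rightarrow> 'a::complex_hilbert_space \<Rightarrow>\<^sub>L 'a) \<Rightarrow> complex set \<Rightarrow> bool"
  where "op_analytic_on F S \<longleftrightarrow>
    (\<forall>z\<in>S. \<exists>\<epsilon>>0. \<forall>w\<in>ball z \<epsilon>. F w \<in> bounded_ops \<and> (\<exists>F'. has_op_derivative F F' w))"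


section \<open>Traces and trace class operators\<close>

text \<open>Hilbert bases and traces are set up for a space \<open>V\<close> with inner product \<open>ip\<close>, because they
  are needed both for the Hilbert space itself and for its exterior powers, whose degree cannot be
  a parameter of a type. Completeness of the orthonormal system is expressed by Parseval's
  identity.\<close>

definition hilbert_basis :: "'v set \<Rightarrow> ('v \<Rightarrow> 'v \<Rightarrow> complex) \<Rightarrow> 'v set \<Rightarrow> bool"
  where "hilbert_basis V ip B \<longleftrightarrow>
    B \<subseteq> V \<and>
    (\<forall>x\<in>B. \<forall>y\<in>B. ip x y = (if x = y then 1 else 0)) \<and>
    (\<forall>x\<in>V. ((\<lambda>b. (cmod (ip b x))\<^sup>2) has_sum Re (ip x x)) B)"

definition some_hilbert_basis :: "'v set \<Rightarrow> ('v \<Rightarrow> 'v \<Rightarrow> complex) \<Rightarrow> 'v set"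
  where "some_hilbert_basis V ip = (SOME B. hilbert_basis V ip B)"

definition trace_on :: "'v set \<Rightarrow> ('v \<Rightarrow> 'v \<Rightarrow> complex) \<Rightarrow> ('v \<Rightarrow> 'v) \<Rightarrow> complex"
  where "trace_on V ip T = (\<Sum>\<^sub>\<infinity>b\<in>some_hilbert_basis V ip. ip b (T b))"

abbreviation hbasis :: "'a::complex_hilbert_space set"
  where "hbasis \<equiv> some_hilbert_basis UNIV cinner"

definition op_trace :: "('a::complex_hilbert_space \<Rightarrow>\<^sub>L 'a) \<Rightarrow> complex"
  where "op_trace A = trace_on UNIV cinner (blinfun_apply A)"

definition op_positive :: "('a::complex_hilbert_space \<Rightarrow>\<^sub>L 'a) \<Rightarrow> bool"
  where "op_positive P \<longleftrightarrow>
    P \<in> bounded_ops \<and>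
    (\<forall>x. cinner x (blinfun_apply P x) \<in> \<real> \<and> 0 \<le> Re (cinner x (blinfun_apply P x)))"

definition op_abs :: "('a::complex_hilbert_space \<Rightarrow>\<^sub>L 'a) \<Rightarrow> ('a \<Rightarrow>\<^sub>L 'a)"
  where "op_abs A = (THE P. op_positive P \<and> P o\<^sub>L P = op_adjoint A o\<^sub>L A)"

text \<open>The terms summed in $\mathrm{Tr}|A|$ are nonnegative, so that finiteness of the trace is
  summability.\<close>

definition trace_class :: "('a::complex_hilbert_space \<Rightarrow>\<^sub>L 'a) \<Rightarrow> bool"
  where "trace_class A \<longleftrightarrow>
    A \<in> bounded_ops \<and> (\<lambda>e. cinner e (blinfun_apply (op_abs A) e)) summable_on hbasis"

definition trace_norm :: "('a::complex_hilbert_space \<Rightarrow>\<^sub>L 'a) \<Rightarrow> real"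
  where "trace_norm A = Re (op_trace (op_abs A))"


section \<open>Exterior powers and the Fredholm determinant\<close>

text \<open>The $k$-th exterior power of the Hilbert space $\mathcal{H}$ is realised as the space of
  bounded alternating conjugate-multilinear Hilbert--Schmidt forms on $\mathcal{H}^k$, where
  $x_1 \wedge \dots \wedge x_k$ is the form
  $(y_1, \dots, y_k) \mapsto \det(\langle y_i, x_j\rangle)$, see \<open>wedge\<close>; conjugate-linearity in
  the $y_i$ makes this depend linearly on the $x_j$. The tuples are lists of length $k$, and forms
  vanish on lists of any other length. The factor $1/k!$ in the inner product gives
  $\langle x_1 \wedge \dots \wedge x_k, y_1 \wedge \dots \wedge y_k\rangle =
  \det(\langle x_i, y_j\rangle)$.\<close>

definition wedge :: "'a::complex_hilbert_space list \<Rightarrow> 'a list \<Rightarrow> complex"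
  where "wedge xs ys =
    (if length ys = length xs then
       (\<Sum>p | p permutes {..<length xs}.
          of_int (sign p) * (\<Prod>i<length xs. cinner (ys ! i) (xs ! p i)))
     else 0)"

definition basis_tuples :: "nat \<Rightarrow> 'a::complex_hilbert_space list set"
  where "basis_tuples k = {bs. length bs = k \<and> set bs \<subseteq> hbasis}"

definition ext_power :: "nat \<Rightarrow> ('a::complex_hilbert_space list \<Rightarrow> complex) set"
  where "ext_power k =
    {\<phi>. (\<forall>ys. length ys \<noteq> k \<longrightarrow> \<phi> ys = 0) \<and>
        (\<forall>ys i x y. length ys = k \<and> i < k \<longrightarrow>
          \<phi> (ys[i := x + y]) = \<phi> (ys[i := x]) + \<phi> (ys[i := y])) \<and>
        (\<forall>ys i c x. length ys = k \<and> i < k \<longrightarrow>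
          \<phi> (ys[i := c *\<^sub>C x]) = cnj c * \<phi> (ys[i := x])) \<and>
        (\<forall>ys. length ys = k \<and> \<not> distinct ys \<longrightarrow> \<phi> ys = 0) \<and>
        (\<exists>C. \<forall>ys. length ys = k \<longrightarrow> cmod (\<phi> ys) \<le> C * prod_list (map norm ys)) \<and>
        (\<lambda>bs. (cmod (\<phi> bs))\<^sup>2) summable_on basis_tuples k}"

definition ext_inner ::
    "nat \<Rightarrow> ('a::complex_hilbert_space list \<Rightarrow> complex) \<Rightarrow> ('a list \<Rightarrow> complex) \<Rightarrow> complex"
  where "ext_inner k \<phi> \<psi> =
    (\<Sum>\<^sub>\<infinity>bs\<in>basis_tuples k. cnj (\<phi> bs) * \<psi> bs) / fact k"

text \<open>The operator induced by \<open>A\<close> is $x_1 \wedge \dots \wedge x_k \mapsto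
  A x_1 \wedge \dots \wedge A x_k$. On forms it is the pullback along the adjoint, as the lemma
  below shows; the formula is the same in every degree.\<close>

definition ext_op ::
    "('a::complex_hilbert_space \<Rightarrow>\<^sub>L 'a) \<Rightarrow> ('a list \<Rightarrow> complex) \<Rightarrow> ('a list \<Rightarrow> complex)"
  where "ext_op A \<phi> = (\<lambda>ys. \<phi> (map (blinfun_apply (op_adjoint A)) ys))"

lemma ext_op_wedge:
  assumes "\<And>x y. cinner (blinfun_apply (op_adjoint A) x) y = cinner x (blinfun_apply A y)"
  shows "ext_op A (wedge xs) = wedge (map (blinfun_apply A) xs)"
proof
  fix ys
  have lt: "p i < length xs" if "p permutes {..<length xs}" "i < length xs" for p i
    using permutes_in_image[OF that(1), of i] that(2) by simp
  show "ext_op A (wedge xs) ys = wedge (map (blinfun_apply A) xs) ys"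
    by (auto simp: ext_op_def wedge_def assms lt intro!: sum.cong prod.cong)
qed

definition ext_trace :: "nat \<Rightarrow> ('a::complex_hilbert_space \<Rightarrow>\<^sub>L 'a) \<Rightarrow> complex"
  where "ext_trace k A = trace_on (ext_power k) (ext_inner k) (ext_op A)"

text \<open>\<open>fredholm_det A\<close> is $\det(I + A)$.\<close>

definition fredholm_det :: "('a::complex_hilbert_space \<Rightarrow>\<^sub>L 'a) \<Rightarrow> complex"
  where "fredholm_det A = (\<Sum>k. ext_trace k A)"

end

theory Submission
  imports Defs "HOL-Combinatorics.Multiset_Permutations"
begin

text \<open>A trace class operator \<open>A\<close> is written as \<open>A x = \<Sum>\<langle>g n, x\<rangle> h n\<close> with
  \<open>norm (g n) = norm (h n)\<close> and \<open>\<Sum> (norm (g n))\<^sup>2\<close> equal to the trace norm. Expanding in the exterior power shows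
  that \<open>k!\<close> times the trace of the \<open>k\<close>-th exterior power of \<open>A\<close> is the sum of \<open>det \<langle>g n\<^sub>i, h n\<^sub>j\<rangle>\<close> over
  all \<open>k\<close>-tuples, Fredholm's series. Expanding bordered determinants along the last row gives
  operators \<open>D\<^sub>k\<close> with \<open>D\<^sub>k\<^sub>+\<^sub>1 = d\<^sub>k\<^sub>+\<^sub>1 I - A D\<^sub>k\<close> and \<open>(k + 1) d\<^sub>k\<^sub>+\<^sub>1 = Tr (A D\<^sub>k)\<close>; Hadamard's
  inequality makes both series converge. Their sums satisfy \<open>(I + A) D = D (I + A) = d I\<close>, and replacing
  \<open>A\<close> by \<open>\<xi> A\<close> turns the recursion for \<open>d\<^sub>k\<close> into the differential equation for \<open>d\<close>. The one for \<open>D\<close>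
  comes from differentiating \<open>(I + \<xi> A) D = d I\<close>. A trace-norm perturbation estimate for
  Fredholm's series gives the derivative along an analytic family.\<close>


section \<open>Hilbert space preliminaries\<close>

text \<open>Analyticity of a family refers to the operator norm, in which the trace is not
  continuous. Hence the determinant of an analytic family is not differentiated through Fredholm's
  series alone: its holomorphy is extracted from the given analytic \<open>D\<close>, by the
  identity theorem for matrix elements of \<open>(I + f) D\<close>, and its derivative in \<lambda>
  is identified with a trace where the difference quotients of \<open>f\<close> converge in trace
  norm. The parameter \<xi> is harmless, because the difference quotient of \<open>\<xi> A\<close>
  is exactly \<open>A\<close>. Where \<open>I + f\<close> is not invertible, the hypotheses give
  only analyticity of \<open>D\<close>. The series for the adjugate converges there as well, and
  continuity across an isolated zero of the determinant identifies the two. Hadamard's inequality is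
  indispensable: bounding a determinant by k! products would cancel the denominator k! and leave a
  geometric series, convergent for small operators only. It is proved inside the exterior power,
  where a Gram determinant is a squared norm; the balance \<open>norm (g n) = norm (h n)\<close>
  then extends it to the mixed determinants without loss.\<close>

interpretation cvec: vector_space "scaleC :: complex \<Rightarrow> 'a \<Rightarrow> 'a::complex_normed_vector"
proof unfold_locales
  show "1 *\<^sub>C x = x" for x :: 'a
    using scaleR_scaleC[of 1 x] by simp
qed (simp_all add: scaleC_add_right scaleC_add_left scaleC_scaleC)

lemma scaleC_scaleR: "r *\<^sub>R c *\<^sub>C x = c *\<^sub>C r *\<^sub>R (x::'a::complex_normed_vector)"
  by (simp add: scaleR_scaleC scaleC_scaleC mult.commute)

lemma bounded_bilinear_scaleC:
  "bounded_bilinear (scaleC :: complex \<Rightarrow> 'a \<Rightarrow> 'a::complex_normed_vector)"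
proof
  fix r :: real and a :: complex and b :: 'a
  show "(r *\<^sub>R a) *\<^sub>C b = r *\<^sub>R a *\<^sub>C b"
    by (simp add: scaleR_scaleC[where 'a='a] scaleC_scaleC scaleR_conv_of_real)
  show "a *\<^sub>C r *\<^sub>R b = r *\<^sub>R a *\<^sub>C b"
    by (simp add: scaleC_scaleR)
  show "\<exists>K. \<forall>a b. norm (a *\<^sub>C (b::'a)) \<le> norm a * norm b * K"
    by (rule exI[of _ 1]) (simp add: norm_scaleC)
qed (simp_all add: scaleC_add_right scaleC_add_left)

instance complex_hilbert_space \<subseteq> banach ..

lemma cinner_add_left: "cinner (x + y) z = cinner x z + cinner y (z::'a::complex_hilbert_space)"
  by (metis cinner_commute cinner_add_right complex_cnj_add)

lemma cinner_scaleC_left: "cinner (c *\<^sub>C x) y = cnj c * cinner x (y::'a::complex_hilbert_space)"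
  by (metis cinner_commute cinner_scaleC_right complex_cnj_mult)

lemma cinner_scaleR_left: "cinner (r *\<^sub>R x) y = r *\<^sub>R cinner x (y::'a::complex_hilbert_space)"
  by (simp add: scaleR_scaleC[where 'a='a] cinner_scaleC_left scaleR_conv_of_real)

lemma cinner_scaleR_right: "cinner x (r *\<^sub>R y) = r *\<^sub>R cinner x (y::'a::complex_hilbert_space)"
  by (simp add: scaleR_scaleC[where 'a='a] cinner_scaleC_right scaleR_conv_of_real)

lemma cinner_self: "cinner x x = complex_of_real ((norm x)\<^sup>2)" for x :: "'a::complex_hilbert_space"
proof -
  have "Im (cinner x x) = 0"
    using arg_cong[OF cinner_commute[of x x], of Im] by simp
  moreover have "Re (cinner x x) = (norm x)\<^sup>2"
    by (metis inner_eq_Re_cinner power2_norm_eq_inner)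
  ultimately show ?thesis
    by (simp add: complex_eq_iff)
qed

text \<open>The Cauchy-Schwarz inequality at hand concerns the real part. Multiplying
  \<open>y\<close> by the phase \<open>c\<close> makes the complex inner product real and
  nonnegative without changing any norm.\<close>

lemma norm_cinner_le: "cmod (cinner x y) \<le> norm x * norm (y::'a::complex_hilbert_space)"
proof (cases "cinner x y = 0")
  case False
  define c where "c = cnj (cinner x y) / cmod (cinner x y)"
  have "cmod c = 1"
    using False by (simp add: c_def norm_divide)
  have "c * cinner x y = cmod (cinner x y)"
    using False complex_norm_square[of "cinner x y"]
    by (simp add: c_def field_simps power2_eq_square)
  then have "cinner x (c *\<^sub>C y) = cmod (cinner x y)"
    by (simp add: cinner_scaleC_right)
  then have "cmod (cinner x y) = inner x (c *\<^sub>C y)"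
    by (simp add: inner_eq_Re_cinner)
  also have "\<dots> \<le> norm x * norm (c *\<^sub>C y)"
    by (rule norm_cauchy_schwarz)
  finally show ?thesis
    by (simp add: norm_scaleC \<open>cmod c = 1\<close>)
qed simp

lemma bounded_bilinear_cinner:
  "bounded_bilinear (cinner :: 'a \<Rightarrow> 'a \<Rightarrow> complex)" for dummy :: "'a::complex_hilbert_space"
proof
  show "\<exists>K. \<forall>a b. cmod (cinner a (b::'a)) \<le> norm a * norm b * K"
    by (rule exI[of _ 1]) (simp add: norm_cinner_le)
qed (simp_all add: cinner_add_left cinner_add_right cinner_scaleR_left cinner_scaleR_right)

interpretation cinner: bounded_bilinear "cinner :: 'a \<Rightarrow> 'a \<Rightarrow> complex"
  for dummy :: "'a::complex_hilbert_space itself"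
  by (rule bounded_bilinear_cinner)

interpretation scaleC: bounded_bilinear "scaleC :: complex \<Rightarrow> 'a \<Rightarrow> 'a"
  for dummy :: "'a::complex_normed_vector itself"
  by (rule bounded_bilinear_scaleC)

lemma cinner_eqI:
  fixes x y :: "'a::complex_hilbert_space"
  assumes "\<And>z. cinner z x = cinner z y"
  shows "x = y"
proof -
  have "cinner (x - y) (x - y) = 0"
    using assms by (simp add: cinner.diff_right)
  then show ?thesis
    by (simp add: cinner_self)
qed

lemma norm_diff_sq:
  fixes x y :: "'a::complex_hilbert_space"
  shows "(norm (x - y))\<^sup>2 = (norm x)\<^sup>2 - 2 * Re (cinner x y) + (norm y)\<^sup>2"
  by (simp add: power2_norm_eq_inner inner_diff_left inner_diff_right inner_commute
      flip: inner_eq_Re_cinner)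

lemma has_sum_cinner_right:
  "(f has_sum s) A \<Longrightarrow> ((\<lambda>i. cinner x (f i)) has_sum cinner x s) A"
  by (rule has_sum_bounded_linear[OF cinner.bounded_linear_right])

lemma has_sum_cinner_left:
  "(f has_sum s) A \<Longrightarrow> ((\<lambda>i. cinner (f i) x) has_sum cinner s x) A"
  by (rule has_sum_bounded_linear[OF cinner.bounded_linear_left])


subsection \<open>Hilbert bases\<close>

definition orthonormal :: "'a::complex_hilbert_space set \<Rightarrow> bool"
  where "orthonormal B \<longleftrightarrow> (\<forall>x\<in>B. \<forall>y\<in>B. cinner x y = (if x = y then 1 else 0))"

lemma cinner_orthonormal_sum:
  assumes "orthonormal B" "finite F" "F \<subseteq> B" "b \<in> B"
  shows "cinner b (\<Sum>e\<in>F. c e *\<^sub>C e) = (if b \<in> F then c b else 0)"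
proof -
  have "cinner b (\<Sum>e\<in>F. c e *\<^sub>C e) = (\<Sum>e\<in>F. if e = b then c b else 0)"
    unfolding cinner.sum_right
    by (rule sum.cong) (use assms in \<open>auto simp: cinner_scaleC_right orthonormal_def subset_iff\<close>)
  also have "\<dots> = (if b \<in> F then c b else 0)"
    using assms(2) by (simp add: sum.delta)
  finally show ?thesis .
qed

lemma norm_orthonormal_sum:
  assumes "orthonormal B" "finite F" "F \<subseteq> B"
  shows "(norm (\<Sum>e\<in>F. c e *\<^sub>C e))\<^sup>2 = (\<Sum>e\<in>F. (cmod (c e))\<^sup>2)"
proof -
  have "complex_of_real ((norm (\<Sum>e\<in>F. c e *\<^sub>C e))\<^sup>2)
      = cinner (\<Sum>e\<in>F. c e *\<^sub>C e) (\<Sum>e\<in>F. c e *\<^sub>C e)"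
    by (simp add: cinner_self)
  also have "\<dots> = (\<Sum>b\<in>F. cnj (c b) * cinner b (\<Sum>e\<in>F. c e *\<^sub>C e))"
    by (subst cinner.sum_left) (simp add: cinner_scaleC_left)
  also have "\<dots> = (\<Sum>b\<in>F. complex_of_real ((cmod (c b))\<^sup>2))"
    by (rule sum.cong)
      (use assms in \<open>auto simp: cinner_orthonormal_sum[OF assms] complex_norm_square mult.commute
          simp del: of_real_power\<close>)
  finally show ?thesis
    by (simp only: of_real_sum[symmetric] of_real_eq_iff)
qed

lemma norm_diff_orthonormal_sum:
  assumes "orthonormal B" "finite F" "F \<subseteq> B"
  shows "(norm (x - (\<Sum>e\<in>F. cinner e x *\<^sub>C e)))\<^sup>2 = (norm x)\<^sup>2 - (\<Sum>e\<in>F. (cmod (cinner e x))\<^sup>2)"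
proof -
  have "cinner x (\<Sum>e\<in>F. cinner e x *\<^sub>C e) = (\<Sum>e\<in>F. complex_of_real ((cmod (cinner e x))\<^sup>2))"
    unfolding cinner.sum_right
    by (rule sum.cong) (auto simp: cinner_scaleC_right complex_norm_square simp del: of_real_power
        simp flip: cinner_commute)
  then have "Re (cinner x (\<Sum>e\<in>F. cinner e x *\<^sub>C e)) = (\<Sum>e\<in>F. (cmod (cinner e x))\<^sup>2)"
    by simp
  then show ?thesis
    by (simp add: norm_diff_sq norm_orthonormal_sum[OF assms])
qed

lemma bessel_finite:
  assumes "orthonormal B" "finite F" "F \<subseteq> B"
  shows "(\<Sum>e\<in>F. (cmod (cinner e x))\<^sup>2) \<le> (norm x)\<^sup>2"
  using norm_diff_orthonormal_sum[OF assms, of x] zero_le_power2[of "norm (x - (\<Sum>e\<in>F. cinner e x *\<^sub>C e))"]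
  by linarith

text \<open>Riesz-Fischer for a possibly uncountable system: by Pythagoras the tails of the vector
  sum are controlled by the tails of the sum of squares, so the net of finite partial sums is
  Cauchy.\<close>

lemma orthonormal_summable:
  assumes B: "orthonormal B" and c: "(\<lambda>b. (cmod (c b))\<^sup>2) summable_on B"
  shows "(\<lambda>b. c b *\<^sub>C b) summable_on B"
proof -
  from c obtain L where lim: "(sum (\<lambda>b. (cmod (c b))\<^sup>2) \<longlongrightarrow> L) (finite_subsets_at_top B)"
    unfolding has_sum_def summable_on_def by blast
  have "\<exists>P. eventually P (finite_subsets_at_top B) \<and>
              (\<forall>F F'. P F \<and> P F' \<longrightarrow> dist (\<Sum>b\<in>F. c b *\<^sub>C b) (\<Sum>b\<in>F'. c b *\<^sub>C b) < e)" if "e > 0" for e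
  proof -
    \<comment> \<open>Two partial sums of squares within \<open>d\<close> of the limit differ by
      less than \<open>2 * d = (e / 2)\<^sup>2\<close>; the remaining factor 2 is spent in the
      triangle inequality through \<open>F0\<close>.\<close>
    define d where "d = e\<^sup>2 / 8"
    have "d > 0"
      using that by (simp add: d_def)
    have "eventually (\<lambda>F. dist (\<Sum>b\<in>F. (cmod (c b))\<^sup>2) L < d) (finite_subsets_at_top B)"
      using lim \<open>d > 0\<close> by (simp add: tendsto_iff)
    then obtain F0 where F0: "finite F0" "F0 \<subseteq> B"
      and F0': "\<And>F. finite F \<Longrightarrow> F0 \<subseteq> F \<Longrightarrow> F \<subseteq> B \<Longrightarrow> dist (\<Sum>b\<in>F. (cmod (c b))\<^sup>2) L < d"
      unfolding eventually_finite_subsets_at_top by auto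
    have near: "norm ((\<Sum>b\<in>F. c b *\<^sub>C b) - (\<Sum>b\<in>F0. c b *\<^sub>C b)) < e / 2"
      if F: "finite F" "F0 \<subseteq> F" "F \<subseteq> B" for F
    proof -
      have "(\<Sum>b\<in>F. c b *\<^sub>C b) - (\<Sum>b\<in>F0. c b *\<^sub>C b) = (\<Sum>b\<in>F - F0. c b *\<^sub>C b)"
        using F by (simp add: sum_diff)
      then have "(norm ((\<Sum>b\<in>F. c b *\<^sub>C b) - (\<Sum>b\<in>F0. c b *\<^sub>C b)))\<^sup>2 = (\<Sum>b\<in>F - F0. (cmod (c b))\<^sup>2)"
        using norm_orthonormal_sum[OF B, of "F - F0" c] F by auto
      also have "\<dots> = (\<Sum>b\<in>F. (cmod (c b))\<^sup>2) - (\<Sum>b\<in>F0. (cmod (c b))\<^sup>2)"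
        using F by (simp add: sum_diff)
      also have "\<dots> < 2 * d"
        using F0'[OF F] F0'[OF F0(1) order.refl F0(2)] by (simp add: dist_real_def)
      also have "\<dots> = (e / 2)\<^sup>2"
        by (simp add: d_def power2_eq_square)
      finally show ?thesis
        by (rule power2_less_imp_less) (use \<open>e > 0\<close> in simp)
    qed
    have "eventually (\<lambda>F. finite F \<and> F0 \<subseteq> F \<and> F \<subseteq> B) (finite_subsets_at_top B)"
      unfolding eventually_finite_subsets_at_top using F0 by (intro exI[of _ F0]) simp
    moreover have "dist (\<Sum>b\<in>F. c b *\<^sub>C b) (\<Sum>b\<in>F'. c b *\<^sub>C b) < e"
      if "finite F \<and> F0 \<subseteq> F \<and> F \<subseteq> B" "finite F' \<and> F0 \<subseteq> F' \<and> F' \<subseteq> B" for F F'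
      using near[of F] near[of F'] that
        dist_triangle2[of "\<Sum>b\<in>F. c b *\<^sub>C b" "\<Sum>b\<in>F'. c b *\<^sub>C b" "\<Sum>b\<in>F0. c b *\<^sub>C b"]
      by (auto simp: dist_norm)
    ultimately show ?thesis
      by (intro exI[of _ "\<lambda>F. finite F \<and> F0 \<subseteq> F \<and> F \<subseteq> B"]) simp
  qed
  then have "cauchy_filter (filtermap (sum (\<lambda>b. c b *\<^sub>C b)) (finite_subsets_at_top B))"
    by (simp add: cauchy_filter_metric_filtermap)
  moreover have "complete (UNIV::'a set)"
    by (meson Cauchy_convergent UNIV_I complete_def convergent_def)
  ultimately obtain L' where "(sum (\<lambda>b. c b *\<^sub>C b) \<longlongrightarrow> L') (finite_subsets_at_top B)"
    using complete_uniform[where S=UNIV] by (force simp add: filterlim_def)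
  then show ?thesis
    using summable_on_def has_sum_def by blast
qed

lemma bessel_summable:
  assumes "orthonormal B"
  shows "(\<lambda>e. (cmod (cinner e x))\<^sup>2) summable_on B"
  by (rule nonneg_bdd_above_summable_on)
    (auto intro!: bdd_aboveI2[where M="(norm x)\<^sup>2"] bessel_finite assms)

text \<open>Take a maximal orthonormal set. What the expansion of \<open>x\<close> misses is
  orthogonal to the set, so if it were nonzero its normalisation would enlarge the set. The lemma
  gives the choice in \<open>some_hilbert_basis\<close> its meaning.\<close>

lemma hilbert_basis_exists: "\<exists>B::'a::complex_hilbert_space set. hilbert_basis UNIV cinner B"
proof -
  have "\<exists>B\<in>{B::'a set. orthonormal B}. \<forall>X\<in>{B. orthonormal B}. B \<subseteq> X \<longrightarrow> X = B"
  proof (rule subset_Zorn_nonempty)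
    show "{B::'a set. orthonormal B} \<noteq> {}"
      by (auto simp: orthonormal_def intro: exI[of _ "{}"])
    fix C :: "'a set set"
    assume "C \<noteq> {}" and C: "subset.chain {B. orthonormal B} C"
    have "cinner x y = (if x = y then 1 else 0)" if xy: "x \<in> \<Union>C" "y \<in> \<Union>C" for x y
    proof -
      obtain X Y where "x \<in> X" "y \<in> Y" "X \<in> C" "Y \<in> C"
        using xy by blast
      moreover then have "X \<subseteq> Y \<or> Y \<subseteq> X"
        using C unfolding subset.chain_def by blast
      ultimately obtain Z where "Z \<in> C" "x \<in> Z" "y \<in> Z"
        by blast
      then show ?thesis
        using C unfolding subset.chain_def orthonormal_def by blast
    qed
    then show "\<Union>C \<in> {B. orthonormal B}"
      unfolding orthonormal_def by blast
  qed
  then obtain B :: "'a set" where B: "orthonormal B" and max: "\<And>X. orthonormal X \<Longrightarrow> B \<subseteq> X \<Longrightarrow> X = B"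
    by auto
  have "((\<lambda>b. (cmod (cinner b x))\<^sup>2) has_sum Re (cinner x x)) B" for x
  proof -
    obtain s where s: "((\<lambda>b. cinner b x *\<^sub>C b) has_sum s) B"
      using orthonormal_summable[OF B bessel_summable[OF B, of x]] by (auto simp: summable_on_def)
    have "cinner b s = cinner b x" if "b \<in> B" for b
    proof -
      have "((\<lambda>e. cinner b (cinner e x *\<^sub>C e)) has_sum cinner b s) B"
        by (rule has_sum_cinner_right[OF s])
      moreover have "((\<lambda>e. cinner b (cinner e x *\<^sub>C e)) has_sum cinner b x) B"
        by (rule has_sum_finite_neutralI[of "{b}"])
          (use that B in \<open>auto simp: cinner_scaleC_right orthonormal_def\<close>)
      ultimately show ?thesis
        by (rule has_sum_unique)
    qed
    then have perp: "cinner b (x - s) = 0" if "b \<in> B" for b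
      using that by (simp add: cinner.diff_right)
    have "x - s = 0"
    proof (rule ccontr)
      assume nz: "x - s \<noteq> 0"
      define u where "u = (1 / norm (x - s)) *\<^sub>R (x - s)"
      have u1: "cinner u u = 1"
        using nz by (simp add: cinner_self u_def)
      have u2: "cinner b u = 0" "cinner u b = 0" if "b \<in> B" for b
        using perp[OF that] cinner_commute[of u b] by (simp_all add: u_def cinner_scaleR_right)
      have "u \<notin> B"
        using u1 u2 by force
      moreover have "orthonormal (insert u B)"
        using B u1 u2 \<open>u \<notin> B\<close> by (auto simp: orthonormal_def)
      ultimately show False
        using max[of "insert u B"] by blast
    qed
    then have "((\<lambda>b. cinner x (cinner b x *\<^sub>C b)) has_sum cinner x x) B"
      using has_sum_cinner_right[OF s] by simp
    moreover have "cinner x (cinner b x *\<^sub>C b) = complex_of_real ((cmod (cinner b x))\<^sup>2)" for b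
      by (simp add: cinner_scaleC_right complex_norm_square del: of_real_power flip: cinner_commute)
    ultimately show ?thesis
      using has_sum_Re by force
  qed
  moreover have "\<forall>x\<in>B. \<forall>y\<in>B. cinner x y = (if x = y then 1 else 0)"
    using B by (simp only: orthonormal_def)
  ultimately have "hilbert_basis UNIV cinner B"
    unfolding hilbert_basis_def by blast
  then show ?thesis ..
qed

lemma hilbert_basis_hbasis: "hilbert_basis UNIV cinner hbasis"
  unfolding some_hilbert_basis_def using hilbert_basis_exists by (rule someI_ex)

lemma orthonormal_hbasis: "orthonormal hbasis"
  using hilbert_basis_hbasis unfolding hilbert_basis_def orthonormal_def by blast

lemma cinner_hbasis: "b \<in> hbasis \<Longrightarrow> e \<in> hbasis \<Longrightarrow> cinner b e = (if b = e then 1 else 0)"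
  using orthonormal_hbasis unfolding orthonormal_def by blast

lemma norm_hbasis: "b \<in> hbasis \<Longrightarrow> norm b = 1"
  using cinner_hbasis[of b b] cinner_self[of b]
  by (simp flip: of_real_power) (metis norm_ge_zero of_real_eq_1_iff power_one real_sqrt_abs real_sqrt_one abs_of_nonneg)

lemma parseval: "((\<lambda>b. (cmod (cinner b x))\<^sup>2) has_sum (norm x)\<^sup>2) hbasis"
  using hilbert_basis_hbasis unfolding hilbert_basis_def by (auto simp: cinner_self)

text \<open>\<open>hilbert_basis\<close> demands Parseval's identity only. Convergence of the
  expansion follows because the squared norm of a remainder is the part still missing from the
  Parseval sum.\<close>

lemma hbasis_expansion: "((\<lambda>b. cinner b x *\<^sub>C b) has_sum x) hbasis"
proof -
  have "((\<lambda>F. (norm x)\<^sup>2 - (\<Sum>e\<in>F. (cmod (cinner e x))\<^sup>2)) \<longlongrightarrow> (norm x)\<^sup>2 - (norm x)\<^sup>2)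
      (finite_subsets_at_top hbasis)"
    using parseval[of x] unfolding has_sum_def by (intro tendsto_intros)
  moreover have "\<forall>\<^sub>F F in finite_subsets_at_top hbasis. (norm x)\<^sup>2 - (\<Sum>e\<in>F. (cmod (cinner e x))\<^sup>2)
        = (norm ((\<Sum>b\<in>F. cinner b x *\<^sub>C b) - x))\<^sup>2"
    by (intro eventually_finite_subsets_at_top_weakI)
      (simp add: norm_minus_commute[of _ x] norm_diff_orthonormal_sum[OF orthonormal_hbasis])
  ultimately have "((\<lambda>F. (norm ((\<Sum>b\<in>F. cinner b x *\<^sub>C b) - x))\<^sup>2) \<longlongrightarrow> 0) (finite_subsets_at_top hbasis)"
    using tendsto_cong by fastforce
  then have "((\<lambda>F. sqrt ((norm ((\<Sum>b\<in>F. cinner b x *\<^sub>C b) - x))\<^sup>2)) \<longlongrightarrow> sqrt 0) (finite_subsets_at_top hbasis)"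
    by (rule tendsto_real_sqrt)
  then have "((\<lambda>F. norm ((\<Sum>b\<in>F. cinner b x *\<^sub>C b) - x)) \<longlongrightarrow> 0) (finite_subsets_at_top hbasis)"
    by simp
  then show ?thesis
    unfolding has_sum_def tendsto_iff by (simp add: dist_norm)
qed

lemma parseval_cinner: "((\<lambda>b. cinner x b * cinner b y) has_sum cinner x y) hbasis"
  using has_sum_cinner_right[OF hbasis_expansion, of x y]
  by (simp add: cinner_scaleC_right mult.commute)

lemma cmod_cinner_commute: "cmod (cinner x y) = cmod (cinner y (x::'a::complex_hilbert_space))"
  by (metis cinner_commute complex_mod_cnj)


section \<open>Bounded operators\<close>

lemma bounded_opsD: "T \<in> bounded_ops \<Longrightarrow> blinfun_apply T (c *\<^sub>C x) = c *\<^sub>C blinfun_apply T x"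
  by (simp add: bounded_ops_def)

lemma bounded_ops_0 [simp]: "0 \<in> bounded_ops"
  by (simp add: bounded_ops_def)

lemma bounded_ops_id [simp]: "id_blinfun \<in> bounded_ops"
  by (simp add: bounded_ops_def)

lemma bounded_ops_add [intro]: "S \<in> bounded_ops \<Longrightarrow> T \<in> bounded_ops \<Longrightarrow> S + T \<in> bounded_ops"
  by (simp add: bounded_ops_def blinfun.add_left scaleC_add_right)

lemma bounded_ops_diff [intro]: "S \<in> bounded_ops \<Longrightarrow> T \<in> bounded_ops \<Longrightarrow> S - T \<in> bounded_ops"
  by (simp add: bounded_ops_def blinfun.diff_left scaleC.diff_right)

lemma bounded_ops_scaleC [intro]: "T \<in> bounded_ops \<Longrightarrow> c *\<^sub>C T \<in> bounded_ops"
  by (simp add: bounded_ops_def scaleC_blinfun.rep_eq scaleC_scaleC mult.commute)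

lemma bounded_ops_scaleR [intro]: "T \<in> bounded_ops \<Longrightarrow> c *\<^sub>R T \<in> bounded_ops"
  by (simp add: scaleR_scaleC bounded_ops_scaleC)

lemma bounded_ops_compose [intro]: "S \<in> bounded_ops \<Longrightarrow> T \<in> bounded_ops \<Longrightarrow> S o\<^sub>L T \<in> bounded_ops"
  by (simp add: bounded_ops_def)

lemma bounded_ops_lim:
  assumes "(F \<longlongrightarrow> L) net" "net \<noteq> bot" "\<And>n. F n \<in> bounded_ops"
  shows "L \<in> bounded_ops"
  unfolding bounded_ops_def
proof (clarify)
  fix c x
  have 1: "((\<lambda>n. blinfun_apply (F n) (c *\<^sub>C x)) \<longlongrightarrow> blinfun_apply L (c *\<^sub>C x)) net"
    by (intro tendsto_intros assms)
  have "((\<lambda>n. c *\<^sub>C blinfun_apply (F n) x) \<longlongrightarrow> c *\<^sub>C blinfun_apply L x) net"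
    by (intro scaleC.tendsto tendsto_intros assms)
  then have 2: "((\<lambda>n. blinfun_apply (F n) (c *\<^sub>C x)) \<longlongrightarrow> c *\<^sub>C blinfun_apply L x) net"
    using assms(3) by (simp add: bounded_opsD)
  show "blinfun_apply L (c *\<^sub>C x) = c *\<^sub>C blinfun_apply L x"
    by (rule tendsto_unique[OF assms(2) 1 2])
qed

lemma bounded_ops_suminf:
  assumes "summable F" "\<And>n. F n \<in> bounded_ops"
  shows "suminf F \<in> bounded_ops"
proof (rule bounded_ops_lim[of "\<lambda>n. \<Sum>k<n. F k"])
  show "(\<lambda>n. \<Sum>k<n. F k) \<longlonglongrightarrow> suminf F"
    using assms(1) by (rule summable_LIMSEQ)
  show "(\<Sum>k<n. F k) \<in> bounded_ops" for n
    by (induction n) (auto simp: assms(2))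
qed simp

lemma has_sum_scaleC_right: "(f has_sum s) A \<Longrightarrow> ((\<lambda>i. c *\<^sub>C f i) has_sum c *\<^sub>C s) A"
  by (rule has_sum_bounded_linear[OF scaleC.bounded_linear_right])

lemma has_sum_apply:
  "(f has_sum s) A \<Longrightarrow> ((\<lambda>i. blinfun_apply T (f i)) has_sum blinfun_apply T s) A"
  by (rule has_sum_bounded_linear[OF blinfun.bounded_linear_right])

lemma has_sum_finite_sum:
  fixes f :: "'i \<Rightarrow> 'j \<Rightarrow> 'b::topological_comm_monoid_add"
  assumes "\<And>i. i \<in> F \<Longrightarrow> (f i has_sum s i) A"
  shows "((\<lambda>n. \<Sum>i\<in>F. f i n) has_sum (\<Sum>i\<in>F. s i)) A"
  using assms
proof (induction F rule: infinite_finite_induct)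
  case (insert i F)
  have "((\<lambda>n. f i n + (\<Sum>i\<in>F. f i n)) has_sum (s i + (\<Sum>i\<in>F. s i))) A"
    by (rule has_sum_add) (use insert in auto)
  then show ?case
    using insert by simp
qed simp_all


subsection \<open>Adjoints\<close>

text \<open>Testing \<open>A\<close> against the vector \<open>v\<close> whose coefficients are the
  ones to be estimated gives \<open>(norm v)\<^sup>2 \<le> norm A * norm v * norm x\<close>. This is
  Bessel's inequality for the adjoint before the adjoint exists.\<close>

lemma adjoint_bessel:
  assumes "finite F" "F \<subseteq> hbasis" and A: "A \<in> bounded_ops"
  shows "(\<Sum>b\<in>F. (cmod (cinner (blinfun_apply A b) x))\<^sup>2) \<le> (norm A * norm x)\<^sup>2"
proof -
  define v where "v = (\<Sum>b\<in>F. cinner (blinfun_apply A b) x *\<^sub>C b)"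
  have v: "(norm v)\<^sup>2 = (\<Sum>b\<in>F. (cmod (cinner (blinfun_apply A b) x))\<^sup>2)"
    unfolding v_def by (rule norm_orthonormal_sum[OF orthonormal_hbasis assms(1,2)])
  have "cinner (blinfun_apply A v) x = (\<Sum>b\<in>F. complex_of_real ((cmod (cinner (blinfun_apply A b) x))\<^sup>2))"
    unfolding v_def blinfun.sum_right cinner.sum_left bounded_opsD[OF A] cinner_scaleC_left
    by (intro sum.cong refl) (simp add: complex_norm_square mult.commute del: of_real_power)
  then have "cinner (blinfun_apply A v) x = complex_of_real ((norm v)\<^sup>2)"
    by (simp add: v del: of_real_power)
  then have "(norm v)\<^sup>2 = cmod (cinner (blinfun_apply A v) x)"
    by (simp only: norm_of_real) simp
  also have "\<dots> \<le> norm A * norm v * norm x"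
    using norm_cinner_le[of "blinfun_apply A v" x] norm_blinfun[of A v]
    by (meson mult_right_mono norm_ge_zero order_trans)
  finally have "norm v \<le> norm A * norm x"
    by (cases "v = 0") (simp_all add: power2_eq_square mult.assoc mult.left_commute)
  then show ?thesis
    unfolding v[symmetric] by (simp add: power_mono)
qed

text \<open>The coefficients that \<open>B x\<close> must have in the basis are known in advance,
  namely those of \<open>adjoint_bessel\<close>; that bound makes their series converge, so no
  representation theorem for functionals is invoked.\<close>

lemma adjoint_exists:
  assumes A: "A \<in> bounded_ops"
  shows "\<exists>B\<in>bounded_ops. \<forall>x y. cinner (blinfun_apply B x) y = cinner x (blinfun_apply A y)"
proof -
  define B where "B x = (\<Sum>\<^sub>\<infinity>b\<in>hbasis. cinner (blinfun_apply A b) x *\<^sub>C b)" for x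
  have B: "((\<lambda>b. cinner (blinfun_apply A b) x *\<^sub>C b) has_sum B x) hbasis" for x
    unfolding B_def
  proof (intro has_sum_infsum orthonormal_summable orthonormal_hbasis nonneg_bdd_above_summable_on)
    show "bdd_above (sum (\<lambda>b. (cmod (cinner (blinfun_apply A b) x))\<^sup>2) ` {F. F \<subseteq> hbasis \<and> finite F})"
      by (rule bdd_aboveI2[where M = "(norm A * norm x)\<^sup>2"]) (auto intro: adjoint_bessel A)
  qed auto
  have Bb: "cinner (B x) b = cinner x (blinfun_apply A b)" if "b \<in> hbasis" for x b
  proof -
    have "((\<lambda>e. cinner b (cinner (blinfun_apply A e) x *\<^sub>C e)) has_sum cinner b (B x)) hbasis"
      by (rule has_sum_cinner_right[OF B])
    moreover have "((\<lambda>e. cinner b (cinner (blinfun_apply A e) x *\<^sub>C e)) has_sum cinner (blinfun_apply A b) x) hbasis"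
      by (rule has_sum_finite_neutralI[of "{b}"])
        (use that in \<open>auto simp: cinner_scaleC_right cinner_hbasis\<close>)
    ultimately have "cinner b (B x) = cinner (blinfun_apply A b) x"
      by (rule has_sum_unique)
    then show ?thesis
      by (metis cinner_commute)
  qed
  have adj: "cinner (B x) y = cinner x (blinfun_apply A y)" for x y
  proof -
    have "((\<lambda>b. cinner (B x) b * cinner b y) has_sum cinner (B x) y) hbasis"
      by (rule parseval_cinner)
    moreover have "((\<lambda>b. cinner x (blinfun_apply A (cinner b y *\<^sub>C b))) has_sum cinner x (blinfun_apply A y)) hbasis"
      by (intro has_sum_cinner_right has_sum_apply hbasis_expansion)
    then have "((\<lambda>b. cinner (B x) b * cinner b y) has_sum cinner x (blinfun_apply A y)) hbasis"
      by (subst has_sum_cong[where g="\<lambda>b. cinner x (blinfun_apply A (cinner b y *\<^sub>C b))"])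
        (simp_all add: Bb bounded_opsD[OF A] cinner_scaleC_right)
    ultimately show ?thesis
      by (rule has_sum_unique)
  qed
  have adj': "cinner y (B x) = cinner (blinfun_apply A y) x" for x y
    using adj by (metis cinner_commute)
  have bl: "bounded_linear B"
  proof (rule bounded_linear_intro[where K = "norm A"])
    show "B (x + y) = B x + B y" for x y
      by (rule cinner_eqI) (simp add: adj' cinner_add_right)
    show "B (r *\<^sub>R x) = r *\<^sub>R B x" for r x
      by (rule cinner_eqI) (simp add: adj' cinner_scaleR_right)
    show "norm (B x) \<le> norm x * norm A" for x
    proof -
      have "complex_of_real ((norm (B x))\<^sup>2) = cinner x (blinfun_apply A (B x))"
        unfolding cinner_self[symmetric] by (rule adj)
      then have "(norm (B x))\<^sup>2 = cmod (cinner x (blinfun_apply A (B x)))"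
        by (metis abs_of_nonneg norm_of_real zero_le_power2)
      also have "\<dots> \<le> norm x * (norm A * norm (B x))"
        using norm_cinner_le norm_blinfun by (meson mult_left_mono norm_ge_zero order_trans)
      finally show ?thesis
        by (cases "B x = 0") (simp_all add: power2_eq_square flip: mult.assoc)
    qed
  qed
  then have ap: "blinfun_apply (Blinfun B) = B"
    by (rule bounded_linear_Blinfun_apply)
  have "Blinfun B \<in> bounded_ops"
    unfolding bounded_ops_def mem_Collect_eq ap
  proof (intro allI)
    show "B (c *\<^sub>C x) = c *\<^sub>C B x" for c x
      by (rule cinner_eqI) (simp add: adj' cinner_scaleC_right)
  qed
  then show ?thesis
    by (intro bexI[of _ "Blinfun B"]) (simp_all add: ap adj)
qed

lemma op_adjoint_eqI:
  assumes "B \<in> bounded_ops" "\<And>x y. cinner (blinfun_apply B x) y = cinner x (blinfun_apply A y)"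
  shows "op_adjoint A = B"
  unfolding op_adjoint_def
proof (rule the_equality)
  fix C assume C: "C \<in> bounded_ops \<and> (\<forall>x y. cinner (blinfun_apply C x) y = cinner x (blinfun_apply A y))"
  show "C = B"
  proof (rule blinfun_eqI, rule cinner_eqI)
    fix x z
    have "cinner (blinfun_apply C x) z = cinner x (blinfun_apply A z)"
      using C by blast
    also have "\<dots> = cinner (blinfun_apply B x) z"
      by (rule assms(2)[symmetric])
    finally have "cinner (blinfun_apply C x) z = cinner (blinfun_apply B x) z" .
    then show "cinner z (blinfun_apply C x) = cinner z (blinfun_apply B x)"
      using cinner_commute[of z "blinfun_apply C x"] cinner_commute[of z "blinfun_apply B x"] by simp
  qed
qed (use assms in simp)

lemma
  assumes "A \<in> bounded_ops"
  shows op_adjoint_bounded_ops: "op_adjoint A \<in> bounded_ops"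
    and cinner_adjoint_left: "cinner (blinfun_apply (op_adjoint A) x) y = cinner x (blinfun_apply A y)"
    and cinner_adjoint_right: "cinner x (blinfun_apply (op_adjoint A) y) = cinner (blinfun_apply A x) y"
proof -
  obtain B where B: "B \<in> bounded_ops" "\<And>x y. cinner (blinfun_apply B x) y = cinner x (blinfun_apply A y)"
    using adjoint_exists[OF assms] by blast
  then have "op_adjoint A = B"
    by (rule op_adjoint_eqI)
  then show "op_adjoint A \<in> bounded_ops"
    "cinner (blinfun_apply (op_adjoint A) x) y = cinner x (blinfun_apply A y)"
    "cinner x (blinfun_apply (op_adjoint A) y) = cinner (blinfun_apply A x) y"
    using B by (auto, metis cinner_commute)
qed

lemma op_adjoint_scaleC:
  assumes "A \<in> bounded_ops"
  shows "op_adjoint (c *\<^sub>C A) = cnj c *\<^sub>C op_adjoint A"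
  by (rule op_adjoint_eqI)
    (auto simp: op_adjoint_bounded_ops assms scaleC_blinfun.rep_eq cinner_scaleC_left
      cinner_scaleC_right cinner_adjoint_left)

lemma norm_op_adjoint_apply:
  assumes "A \<in> bounded_ops"
  shows "norm (blinfun_apply (op_adjoint A) x) \<le> norm A * norm x"
proof -
  let ?B = "blinfun_apply (op_adjoint A)"
  have "complex_of_real ((norm (?B x))\<^sup>2) = cinner x (blinfun_apply A (?B x))"
    unfolding cinner_self[symmetric] by (rule cinner_adjoint_left[OF assms])
  then have "(norm (?B x))\<^sup>2 = cmod (cinner x (blinfun_apply A (?B x)))"
    by (metis abs_of_nonneg norm_of_real zero_le_power2)
  also have "\<dots> \<le> norm x * (norm A * norm (?B x))"
    using norm_cinner_le norm_blinfun by (meson mult_left_mono norm_ge_zero order_trans)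
  finally show ?thesis
    by (cases "?B x = 0") (simp_all add: power2_eq_square mult.commute flip: mult.assoc)
qed


subsection \<open>Positive operators and their square roots\<close>

lemma op_positive_bounded_ops: "op_positive P \<Longrightarrow> P \<in> bounded_ops"
  by (simp add: op_positive_def)

lemma op_positive_Re: "op_positive P \<Longrightarrow> 0 \<le> Re (cinner x (blinfun_apply P x))"
  by (simp add: op_positive_def)

text \<open>Polarization: the form \<open>h\<close> measures the failure of symmetry and vanishes on
  the diagonal because the quadratic form is real. Its values at \<open>x + y\<close> and
  \<open>x + \<i> y\<close> then force it to vanish everywhere.\<close>

lemma op_positive_symmetric:
  assumes "op_positive P"
  shows "cinner (blinfun_apply P x) y = cinner x (blinfun_apply P y)"
proof -
  have P: "P \<in> bounded_ops"
    using assms by (rule op_positive_bounded_ops)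
  define h where "h u v = cinner u (blinfun_apply P v) - cinner (blinfun_apply P u) v" for u v
  have h0: "h u u = 0" for u
  proof -
    have "cinner u (blinfun_apply P u) \<in> \<real>"
      using assms by (simp add: op_positive_def)
    then have "cinner (blinfun_apply P u) u = cinner u (blinfun_apply P u)"
      using cinner_commute[of "blinfun_apply P u" u] by (simp add: Reals_cnj_iff)
    then show ?thesis
      by (simp add: h_def)
  qed
  have "h x y + h y x = h (x + y) (x + y) - h x x - h y y"
    by (simp add: h_def blinfun.add_right cinner_add_left cinner_add_right)
  then have 1: "h x y + h y x = 0"
    by (simp add: h0)
  have "\<i> * h x y - \<i> * h y x = h (x + \<i> *\<^sub>C y) (x + \<i> *\<^sub>C y) - h x x - h y y"
    by (simp add: h_def blinfun.add_right cinner_add_left cinner_add_right bounded_opsD[OF P]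
        cinner_scaleC_left cinner_scaleC_right algebra_simps)
  then have "\<i> * (h x y - h y x) = 0"
    by (simp add: h0 right_diff_distrib)
  then have "h x y = h y x"
    by simp
  then have "h x y = 0"
    using 1 by simp
  then show ?thesis
    by (simp add: h_def)
qed

lemma op_positiveI:
  assumes "P \<in> bounded_ops" "\<And>x y. cinner (blinfun_apply P x) y = cinner x (blinfun_apply P y)"
    "\<And>x. 0 \<le> Re (cinner x (blinfun_apply P x))"
  shows "op_positive P"
proof -
  have "cnj (cinner x (blinfun_apply P x)) = cinner x (blinfun_apply P x)" for x
    using cinner_commute[of "blinfun_apply P x" x] assms(2)[of x x] by simp
  then show ?thesis
    unfolding op_positive_def using assms(1,3) by (simp add: Reals_cnj_iff)
qed

text \<open>Positivity is applied to the vector \<open>x - (1/c) P x\<close>. This stands for the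
  operator inequality between the square of \<open>P\<close> and \<open>c P\<close>, obtained
  without a square root.\<close>

lemma op_positive_norm_sq_le:
  assumes P: "op_positive P" and c: "norm P \<le> c"
  shows "(norm (blinfun_apply P x))\<^sup>2 \<le> c * Re (cinner x (blinfun_apply P x))"
proof (cases "c = 0")
  case True
  then show ?thesis using c by simp
next
  case False
  then have "c > 0" using c norm_ge_zero[of P] by linarith
  let ?y = "blinfun_apply P x"
  have "0 \<le> Re (cinner (x - (1/c) *\<^sub>R ?y) (blinfun_apply P (x - (1/c) *\<^sub>R ?y)))"
    by (rule op_positive_Re[OF P])
  also have "\<dots> = Re (cinner x ?y) - 2 / c * (norm ?y)\<^sup>2 + (1/c)\<^sup>2 * Re (cinner ?y (blinfun_apply P ?y))"
  proof -
    have "cinner x (blinfun_apply P ?y) = complex_of_real ((norm ?y)\<^sup>2)"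
      by (metis op_positive_symmetric[OF P] cinner_self)
    then show ?thesis
      by (simp add: cinner.diff_left cinner.diff_right blinfun.diff_right blinfun.scaleR_right
        cinner_scaleR_left cinner_scaleR_right cinner_self power2_eq_square algebra_simps
        flip: of_real_mult)
  qed
  also have "\<dots> \<le> Re (cinner x ?y) - 2 / c * (norm ?y)\<^sup>2 + (1/c)\<^sup>2 * (c * (norm ?y)\<^sup>2)"
  proof -
    have "Re (cinner ?y (blinfun_apply P ?y)) \<le> cmod (cinner ?y (blinfun_apply P ?y))"
      by (rule complex_Re_le_cmod)
    also have "\<dots> \<le> norm ?y * (norm P * norm ?y)"
      using norm_cinner_le norm_blinfun by (meson mult_left_mono norm_ge_zero order_trans)
    also have "\<dots> \<le> norm ?y * (c * norm ?y)"
      by (intro mult_left_mono mult_right_mono c) auto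
    finally have "Re (cinner ?y (blinfun_apply P ?y)) \<le> c * (norm ?y)\<^sup>2"
      by (simp add: power2_eq_square algebra_simps)
    then show ?thesis
      by (intro add_left_mono mult_left_mono) auto
  qed
  also have "\<dots> = Re (cinner x ?y) - (norm ?y)\<^sup>2 / c"
    using \<open>c > 0\<close> by (simp add: field_simps power2_eq_square)
  finally show ?thesis
    using \<open>c > 0\<close> by (simp add: field_simps)
qed

lemma norm_id_minus_positive:
  assumes P: "op_positive P" and "norm P \<le> 1"
  shows "norm (id_blinfun - P) \<le> 1"
proof (rule norm_blinfun_bound)
  fix x
  have "(norm (x - blinfun_apply P x))\<^sup>2 \<le> (norm x)\<^sup>2"
    using op_positive_norm_sq_le[OF assms, of x] op_positive_Re[OF P, of x] by (simp add: norm_diff_sq)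
  then show "norm (blinfun_apply (id_blinfun - P) x) \<le> 1 * norm x"
    by (simp add: blinfun.diff_left)
qed simp

lemma op_positive_scaleR:
  assumes "op_positive P" "0 \<le> r"
  shows "op_positive (r *\<^sub>R P)"
  using assms
  by (intro op_positiveI)
    (auto simp: op_positive_bounded_ops blinfun.scaleR_left cinner_scaleR_left cinner_scaleR_right
      op_positive_symmetric op_positive_Re)

text \<open>For a positive contraction \<open>T\<close> and \<open>X = I - T\<close>, the iteration \<open>Y \<mapsto> (X + Y\<^sup>2) / 2\<close> from \<open>0\<close> converges to
  \<open>I - S\<close> with \<open>S\<^sup>2 = T\<close>. All \<open>Y\<close> are polynomials in \<open>X\<close> with nonnegative coefficients, so the
  increments are dominated by those of the same iteration for \<open>X = 1\<close>, whose values \<open>y\<close> increase to \<open>1\<close>.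
  The differences \<open>y I - Y\<close> are divisible by \<open>T\<close>; \<open>sqrt_iter_quot\<close> is the quotient.\<close>

fun sqrt_iter :: "('a::real_normed_vector \<Rightarrow>\<^sub>L 'a) \<Rightarrow> nat \<Rightarrow> ('a \<Rightarrow>\<^sub>L 'a)"
  where "sqrt_iter X 0 = 0"
  | "sqrt_iter X (Suc n) = (1/2) *\<^sub>R (X + (sqrt_iter X n o\<^sub>L sqrt_iter X n))"

fun sqrt_iter_scalar :: "nat \<Rightarrow> real"
  where "sqrt_iter_scalar 0 = 0"
  | "sqrt_iter_scalar (Suc n) = (1 + (sqrt_iter_scalar n)\<^sup>2) / 2"

fun sqrt_iter_quot :: "('a::real_normed_vector \<Rightarrow>\<^sub>L 'a) \<Rightarrow> nat \<Rightarrow> ('a \<Rightarrow>\<^sub>L 'a)"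
  where "sqrt_iter_quot X 0 = 0"
  | "sqrt_iter_quot X (Suc n) = (1/2) *\<^sub>R (id_blinfun +
      (sqrt_iter_quot X n o\<^sub>L (sqrt_iter_scalar n *\<^sub>R id_blinfun + sqrt_iter X n)))"

lemma sqrt_iter_scalar_bounds: "0 \<le> sqrt_iter_scalar n \<and> sqrt_iter_scalar n \<le> 1"
  by (induction n) (auto simp: power_le_one)

lemma sqrt_iter_scalar_mono: "sqrt_iter_scalar n \<le> sqrt_iter_scalar (Suc n)"
proof -
  have "0 \<le> (1 - sqrt_iter_scalar n)\<^sup>2"
    by simp
  then show ?thesis
    by (simp add: power2_eq_square algebra_simps)
qed

lemma sqrt_iter_scalar_tendsto: "sqrt_iter_scalar \<longlonglongrightarrow> 1"
proof -
  have "incseq sqrt_iter_scalar"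
    by (rule incseq_SucI) (rule sqrt_iter_scalar_mono)
  then obtain L where L: "sqrt_iter_scalar \<longlonglongrightarrow> L"
    using incseq_convergent[of sqrt_iter_scalar 1] sqrt_iter_scalar_bounds by metis
  have "(\<lambda>n. (1 + (sqrt_iter_scalar n)\<^sup>2) / 2) \<longlonglongrightarrow> (1 + L\<^sup>2) / 2"
    by (intro tendsto_intros L) simp
  then have "(\<lambda>n. sqrt_iter_scalar (Suc n)) \<longlonglongrightarrow> (1 + L\<^sup>2) / 2"
    by simp
  then have "L = (1 + L\<^sup>2) / 2"
    using LIMSEQ_Suc[OF L] LIMSEQ_unique by blast
  then have "(L - 1)\<^sup>2 = 0"
    by (simp add: power2_eq_square algebra_simps)
  then show ?thesis
    using L by simp
qed

context
  fixes T X :: "'a::complex_hilbert_space \<Rightarrow>\<^sub>L 'a"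
  assumes T: "op_positive T" and T1: "norm T \<le> 1"
    and X: "X = id_blinfun - T"
begin

lemma sqrt_iter_commute: "Z o\<^sub>L T = T o\<^sub>L Z \<Longrightarrow> Z o\<^sub>L sqrt_iter X n = sqrt_iter X n o\<^sub>L Z"
proof (induction n)
  case (Suc n)
  have "blinfun_apply Z (blinfun_apply T v) = blinfun_apply T (blinfun_apply Z v)"
    "blinfun_apply Z (blinfun_apply (sqrt_iter X n) v) = blinfun_apply (sqrt_iter X n) (blinfun_apply Z v)" for v
    using Suc.prems Suc.IH[OF Suc.prems] by (metis blinfun_apply_blinfun_compose)+
  then show ?case
    by (intro blinfun_eqI) (simp add: X blinfun.bilinear_simps)
qed simp

lemma sqrt_iter_bounded_ops: "sqrt_iter X n \<in> bounded_ops"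
  by (induction n)
    (auto simp: X op_positive_bounded_ops[OF T]
      intro!: bounded_ops_scaleR bounded_ops_add bounded_ops_diff bounded_ops_compose)

lemma sqrt_iter_quot_bounded_ops: "sqrt_iter_quot X n \<in> bounded_ops"
  by (induction n) (auto intro!: bounded_ops_scaleR bounded_ops_add bounded_ops_compose sqrt_iter_bounded_ops)

lemma sqrt_iter_symmetric:
  "cinner (blinfun_apply (sqrt_iter X n) x) y = cinner x (blinfun_apply (sqrt_iter X n) y)"
  by (induction n arbitrary: x y)
    (auto simp: X blinfun.bilinear_simps cinner.add_left cinner.add_right cinner.diff_left cinner.diff_right
      cinner_scaleR_left cinner_scaleR_right op_positive_symmetric[OF T])

lemma norm_sqrt_iter: "norm (sqrt_iter X n) \<le> sqrt_iter_scalar n"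
proof (induction n)
  case (Suc n)
  have "norm (sqrt_iter X (Suc n)) \<le> (norm X + norm (sqrt_iter X n) * norm (sqrt_iter X n)) / 2"
    using norm_triangle_ineq[of X "sqrt_iter X n o\<^sub>L sqrt_iter X n"]
      norm_blinfun_compose[of "sqrt_iter X n" "sqrt_iter X n"] by simp
  also have "\<dots> \<le> (1 + sqrt_iter_scalar n * sqrt_iter_scalar n) / 2"
    using Suc norm_id_minus_positive[OF T T1]
    by (intro divide_right_mono add_mono mult_mono) (auto simp: X sqrt_iter_scalar_bounds)
  finally show ?case
    by (simp add: power2_eq_square)
qed simp

lemma sqrt_iter_commute_self: "sqrt_iter X m o\<^sub>L sqrt_iter X n = sqrt_iter X n o\<^sub>L sqrt_iter X m"
  by (rule sqrt_iter_commute) (rule sqrt_iter_commute[symmetric], rule refl)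

text \<open>The iterates commute, so a difference of their squares factors into sum and difference.
  The scalar recursion factors in the same way, and the induction reproduces the scalar
  increment.\<close>

lemma norm_sqrt_iter_diff:
  "norm (sqrt_iter X (Suc n) - sqrt_iter X n) \<le> sqrt_iter_scalar (Suc n) - sqrt_iter_scalar n"
proof (induction n)
  case 0
  then show ?case
    using norm_id_minus_positive[OF T T1] by (simp add: X)
next
  case (Suc n)
  let ?Y = "sqrt_iter X" and ?y = sqrt_iter_scalar
  have c: "blinfun_apply (?Y n) (blinfun_apply (?Y (Suc n)) v) = blinfun_apply (?Y (Suc n)) (blinfun_apply (?Y n) v)" for v
    by (metis sqrt_iter_commute_self blinfun_apply_blinfun_compose)
  have Y2: "?Y (Suc (Suc n)) = (1/2) *\<^sub>R (X + (?Y (Suc n) o\<^sub>L ?Y (Suc n)))"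
    by (rule sqrt_iter.simps)
  have Y1: "?Y (Suc n) = (1/2) *\<^sub>R (X + (?Y n o\<^sub>L ?Y n))"
    by (rule sqrt_iter.simps)
  have "?Y (Suc (Suc n)) - ?Y (Suc n) = (1/2) *\<^sub>R ((?Y (Suc n) o\<^sub>L ?Y (Suc n)) - (?Y n o\<^sub>L ?Y n))"
    unfolding Y2 by (subst (3) Y1) (simp add: algebra_simps)
  also have "(?Y (Suc n) o\<^sub>L ?Y (Suc n)) - (?Y n o\<^sub>L ?Y n) = (?Y (Suc n) + ?Y n) o\<^sub>L (?Y (Suc n) - ?Y n)"
    by (rule blinfun_eqI) (simp add: blinfun.bilinear_simps c del: sqrt_iter.simps)
  finally have "norm (?Y (Suc (Suc n)) - ?Y (Suc n)) = norm ((?Y (Suc n) + ?Y n) o\<^sub>L (?Y (Suc n) - ?Y n)) / 2"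
    by simp
  also have "\<dots> \<le> (norm (?Y (Suc n) + ?Y n) * norm (?Y (Suc n) - ?Y n)) / 2"
    by (intro divide_right_mono norm_blinfun_compose) simp
  also have "\<dots> \<le> ((?y (Suc n) + ?y n) * (?y (Suc n) - ?y n)) / 2"
  proof (intro divide_right_mono mult_mono Suc.IH)
    show "norm (?Y (Suc n) + ?Y n) \<le> ?y (Suc n) + ?y n"
      using norm_sqrt_iter[of "Suc n"] norm_sqrt_iter[of n] norm_triangle_ineq[of "?Y (Suc n)" "?Y n"]
      by linarith
    show "0 \<le> ?y (Suc n) + ?y n"
      using sqrt_iter_scalar_bounds[of "Suc n"] sqrt_iter_scalar_bounds[of n] by linarith
  qed auto
  also have "\<dots> = ?y (Suc (Suc n)) - ?y (Suc n)"
  proof -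
    have *: "(b + a) * (b - a) / 2 = c - b" if "b = (1 + a\<^sup>2) / 2" "c = (1 + b\<^sup>2) / 2" for a b c :: real
    proof -
      have "c - b = (b\<^sup>2 - a\<^sup>2) / 2"
        using that by argo
      moreover have "(b + a) * (b - a) = b\<^sup>2 - a\<^sup>2"
        by (simp add: power2_eq_square algebra_simps)
      ultimately show ?thesis
        by simp
    qed
    show ?thesis
      by (rule *) (rule sqrt_iter_scalar.simps)+
  qed
  finally show ?case .
qed

lemma sqrt_iter_Cauchy: "Cauchy (sqrt_iter X)"
proof -
  have *: "norm (sqrt_iter X (n + k) - sqrt_iter X n) \<le> sqrt_iter_scalar (n + k) - sqrt_iter_scalar n" for n k
  proof (induction k)
    case (Suc k)
    show ?case
      using norm_sqrt_iter_diff[of "n + k"] Suc.IH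
        norm_triangle_ineq[of "sqrt_iter X (n + Suc k) - sqrt_iter X (n + k)" "sqrt_iter X (n + k) - sqrt_iter X n"]
      by (simp del: sqrt_iter.simps sqrt_iter_scalar.simps)
  qed simp
  have "Cauchy sqrt_iter_scalar"
    using sqrt_iter_scalar_tendsto by (rule LIMSEQ_imp_Cauchy)
  show ?thesis
  proof (rule CauchyI')
    fix e :: real assume "e > 0"
    then obtain M where M: "\<And>m n. m \<ge> M \<Longrightarrow> n \<ge> M \<Longrightarrow> dist (sqrt_iter_scalar m) (sqrt_iter_scalar n) < e"
      using \<open>Cauchy sqrt_iter_scalar\<close> unfolding Cauchy_def by blast
    show "\<exists>M. \<forall>m\<ge>M. \<forall>n>m. dist (sqrt_iter X m) (sqrt_iter X n) < e"
    proof (intro exI[of _ M] allI impI)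
      fix m n assume "M \<le> m" "m < n"
      then obtain k where n: "n = m + k"
        using less_imp_add_positive by blast
      have "norm (sqrt_iter X m - sqrt_iter X n) \<le> sqrt_iter_scalar n - sqrt_iter_scalar m"
        using *[of m k] by (simp add: n norm_minus_commute)
      also have "\<dots> \<le> dist (sqrt_iter_scalar n) (sqrt_iter_scalar m)"
        by (simp add: dist_real_def)
      also have "\<dots> < e"
        using M \<open>M \<le> m\<close> \<open>m < n\<close> by simp
      finally show "dist (sqrt_iter X m) (sqrt_iter X n) < e"
        by (simp add: dist_norm)
    qed
  qed
qed

text \<open>Since \<open>I - X = T\<close> and the iterates \<open>y\<close>, \<open>Y\<close>
  satisfy \<open>y\<^sup>2 - Y\<^sup>2 = (y - Y) (y + Y)\<close>, the next difference is half of
  \<open>T + (y - Y) (y + Y)\<close>, which is the recursion for the quotient multiplied by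
  \<open>T\<close>.\<close>

lemma sqrt_iter_quot_eq: "T o\<^sub>L sqrt_iter_quot X n = sqrt_iter_scalar n *\<^sub>R id_blinfun - sqrt_iter X n"
proof (induction n)
  case (Suc n)
  have IH: "blinfun_apply T (blinfun_apply (sqrt_iter_quot X n) v)
      = sqrt_iter_scalar n *\<^sub>R v - blinfun_apply (sqrt_iter X n) v" for v
    using Suc.IH by (metis (no_types, lifting) blinfun.diff_left blinfun.scaleR_left
        blinfun_apply_blinfun_compose blinfun_apply_id_blinfun)
  have Xv: "blinfun_apply X v = v - blinfun_apply T v" for v
    by (simp add: X blinfun.diff_left)
  show ?case
    by (rule blinfun_eqI)
      (simp add: Xv IH blinfun.bilinear_simps power2_eq_square scaleR_add_left add_divide_distrib
        scaleR_diff_right scaleR_add_right)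
qed simp

text \<open>Two by-products are recorded with the root: it commutes with whatever commutes with
  \<open>T\<close>, which gives uniqueness, and it is a limit of right multiples of
  \<open>T\<close>, which later replaces division by the root.\<close>

lemma contraction_sqrt_exists:
  "\<exists>S R. op_positive S \<and> S o\<^sub>L S = T \<and> (\<forall>Z. Z o\<^sub>L T = T o\<^sub>L Z \<longrightarrow> Z o\<^sub>L S = S o\<^sub>L Z) \<and>
     (\<forall>n. R n \<in> bounded_ops) \<and> (\<lambda>n. T o\<^sub>L R n) \<longlonglongrightarrow> S"
proof -
  obtain Y where Y: "sqrt_iter X \<longlonglongrightarrow> Y"
    using sqrt_iter_Cauchy Cauchy_convergent_iff convergent_def by blast
  note compose_tendsto = bounded_bilinear.tendsto[OF bounded_bilinear_blinfun_compose]
  have "(\<lambda>n. (1/2) *\<^sub>R (X + (sqrt_iter X n o\<^sub>L sqrt_iter X n))) \<longlonglongrightarrow> (1/2) *\<^sub>R (X + (Y o\<^sub>L Y))"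
    by (intro tendsto_intros compose_tendsto Y)
  then have "(\<lambda>n. sqrt_iter X (Suc n)) \<longlonglongrightarrow> (1/2) *\<^sub>R (X + (Y o\<^sub>L Y))"
    by simp
  \<comment> \<open>The limit of the recursion is a fixed point equation, and it says that the
    square of \<open>I - Y\<close> is \<open>I - X = T\<close>.\<close>
  then have Yeq: "Y = (1/2) *\<^sub>R (X + (Y o\<^sub>L Y))"
    using LIMSEQ_Suc[OF Y] LIMSEQ_unique by blast
  have Yb: "Y \<in> bounded_ops"
    by (rule bounded_ops_lim[OF Y]) (simp_all add: sqrt_iter_bounded_ops)
  have Ysym: "cinner (blinfun_apply Y x) y = cinner x (blinfun_apply Y y)" for x y
  proof (rule LIMSEQ_unique)
    show "(\<lambda>n. cinner (blinfun_apply (sqrt_iter X n) x) y) \<longlonglongrightarrow> cinner (blinfun_apply Y x) y"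
      by (intro cinner.tendsto tendsto_intros Y)
    show "(\<lambda>n. cinner (blinfun_apply (sqrt_iter X n) x) y) \<longlonglongrightarrow> cinner x (blinfun_apply Y y)"
      unfolding sqrt_iter_symmetric by (intro cinner.tendsto tendsto_intros Y)
  qed
  have "norm Y \<le> 1"
    by (rule Lim_norm_ubound[OF _ Y])
      (auto intro!: eventuallyI order_trans[OF norm_sqrt_iter] simp: sqrt_iter_scalar_bounds)
  define S where "S = id_blinfun - Y"
  have "op_positive S"
  proof (rule op_positiveI)
    show "S \<in> bounded_ops"
      unfolding S_def by (intro bounded_ops_diff Yb) simp
    show "cinner (blinfun_apply S x) y = cinner x (blinfun_apply S y)" for x y
      by (simp add: S_def blinfun.diff_left cinner.diff_left cinner.diff_right Ysym)
    show "0 \<le> Re (cinner x (blinfun_apply S x))" for x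
    proof -
      have "Re (cinner x (blinfun_apply Y x)) \<le> norm x * (norm Y * norm x)"
        using complex_Re_le_cmod norm_cinner_le norm_blinfun
        by (meson mult_left_mono norm_ge_zero order_trans)
      also have "\<dots> \<le> norm x * (1 * norm x)"
        by (intro mult_left_mono mult_right_mono \<open>norm Y \<le> 1\<close>) auto
      finally show ?thesis
        by (simp add: S_def blinfun.diff_left cinner.diff_right cinner_self power2_eq_square)
    qed
  qed
  moreover have "S o\<^sub>L S = T"
  proof (rule blinfun_eqI)
    fix v
    have "blinfun_apply Y v = blinfun_apply ((1/2) *\<^sub>R (X + (Y o\<^sub>L Y))) v"
      using Yeq by simp
    also have "\<dots> = (1/2) *\<^sub>R ((v - blinfun_apply T v) + blinfun_apply Y (blinfun_apply Y v))"
      by (simp add: X blinfun.bilinear_simps)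
    finally have "2 *\<^sub>R blinfun_apply Y v = 2 *\<^sub>R (1/2) *\<^sub>R ((v - blinfun_apply T v) + blinfun_apply Y (blinfun_apply Y v))"
      by (rule arg_cong)
    then have "2 *\<^sub>R blinfun_apply Y v = (v - blinfun_apply T v) + blinfun_apply Y (blinfun_apply Y v)"
      by simp
    then show "blinfun_apply (S o\<^sub>L S) v = blinfun_apply T v"
      by (simp add: S_def blinfun.bilinear_simps scaleR_2 algebra_simps)
  qed
  moreover have "Z o\<^sub>L S = S o\<^sub>L Z" if "Z o\<^sub>L T = T o\<^sub>L Z" for Z
  proof -
    have "Z o\<^sub>L Y = Y o\<^sub>L Z"
    proof (rule LIMSEQ_unique)
      show "(\<lambda>n. Z o\<^sub>L sqrt_iter X n) \<longlonglongrightarrow> (Z o\<^sub>L Y)"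
        by (intro compose_tendsto tendsto_intros Y)
      show "(\<lambda>n. Z o\<^sub>L sqrt_iter X n) \<longlonglongrightarrow> (Y o\<^sub>L Z)"
        unfolding sqrt_iter_commute[OF that] by (intro compose_tendsto tendsto_intros Y)
    qed
    then have "blinfun_apply Z (blinfun_apply Y v) = blinfun_apply Y (blinfun_apply Z v)" for v
      by (metis blinfun_apply_blinfun_compose)
    then show ?thesis
      by (intro blinfun_eqI) (simp add: S_def blinfun.bilinear_simps)
  qed
  moreover have "(\<lambda>n. T o\<^sub>L sqrt_iter_quot X n) \<longlonglongrightarrow> S"
  proof -
    have "(\<lambda>n. sqrt_iter_scalar n *\<^sub>R id_blinfun - sqrt_iter X n) \<longlonglongrightarrow> 1 *\<^sub>R id_blinfun - Y"
      by (intro tendsto_intros sqrt_iter_scalar_tendsto Y)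
    then show ?thesis
      by (simp add: sqrt_iter_quot_eq S_def)
  qed
  ultimately show ?thesis
    using sqrt_iter_quot_bounded_ops by blast
qed

end

lemma op_sqrt_exists:
  assumes T: "op_positive T"
  shows "\<exists>S R. op_positive S \<and> S o\<^sub>L S = T \<and> (\<forall>Z. Z o\<^sub>L T = T o\<^sub>L Z \<longrightarrow> Z o\<^sub>L S = S o\<^sub>L Z) \<and>
     (\<forall>n. R n \<in> bounded_ops) \<and> (\<lambda>n. T o\<^sub>L R n) \<longlonglongrightarrow> S"
proof -
  \<comment> \<open>The summand 1 keeps the scaling factor positive when
    \<open>T = 0\<close>.\<close>
  define c where "c = norm T + 1"
  have "c > 0"
    by (simp add: c_def add_nonneg_pos)
  define T' where "T' = (1/c) *\<^sub>R T"
  have T': "op_positive T'" "norm T' \<le> 1"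
    using \<open>c > 0\<close> T by (auto simp: T'_def op_positive_scaleR) (simp add: c_def)
  have TT': "T = c *\<^sub>R T'"
    using \<open>c > 0\<close> by (simp add: T'_def)
  obtain S R where S: "op_positive S" "S o\<^sub>L S = T'"
    and comm: "\<And>Z. Z o\<^sub>L T' = T' o\<^sub>L Z \<Longrightarrow> Z o\<^sub>L S = S o\<^sub>L Z"
    and R: "\<And>n. R n \<in> bounded_ops" "(\<lambda>n. T' o\<^sub>L R n) \<longlonglongrightarrow> S"
    using contraction_sqrt_exists[OF T' refl] by blast
  note comp_simps = bounded_bilinear.scaleR_left[OF bounded_bilinear_blinfun_compose]
    bounded_bilinear.scaleR_right[OF bounded_bilinear_blinfun_compose]
  show ?thesis
  proof (intro exI[of _ "sqrt c *\<^sub>R S"] exI[of _ "\<lambda>n. (1 / sqrt c) *\<^sub>R R n"] conjI allI impI)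
    show "op_positive (sqrt c *\<^sub>R S)"
      using S \<open>c > 0\<close> by (simp add: op_positive_scaleR)
    show "sqrt c *\<^sub>R S o\<^sub>L sqrt c *\<^sub>R S = T"
      using \<open>c > 0\<close> by (simp add: comp_simps S TT')
    show "Z o\<^sub>L sqrt c *\<^sub>R S = sqrt c *\<^sub>R S o\<^sub>L Z" if "Z o\<^sub>L T = T o\<^sub>L Z" for Z
      using comm[of Z] that by (simp add: comp_simps T'_def)
    show "(1 / sqrt c) *\<^sub>R R n \<in> bounded_ops" for n
      by (rule bounded_ops_scaleR[OF R(1)])
    have "(\<lambda>n. sqrt c *\<^sub>R (T' o\<^sub>L R n)) \<longlonglongrightarrow> sqrt c *\<^sub>R S"
      by (intro tendsto_intros R)
    moreover have "T o\<^sub>L (1 / sqrt c) *\<^sub>R R n = sqrt c *\<^sub>R (T' o\<^sub>L R n)" for n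
      using \<open>c > 0\<close> by (simp add: comp_simps TT' real_div_sqrt)
    ultimately show "(\<lambda>n. T o\<^sub>L (1 / sqrt c) *\<^sub>R R n) \<longlonglongrightarrow> sqrt c *\<^sub>R S"
      by simp
  qed
qed

lemma op_positive_null:
  assumes P: "op_positive P" and "Re (cinner x (blinfun_apply P x)) = 0"
  shows "blinfun_apply P x = 0"
  using op_positive_norm_sq_le[OF P order.refl, of x] assms(2) by simp

text \<open>A positive root \<open>Q'\<close> commutes with its square, hence with the constructed
  root \<open>S\<close>. On the range of \<open>D = S - Q'\<close> the sum \<open>S + Q'\<close>
  therefore vanishes; as both are positive, each vanishes there, so \<open>D\<close> squares to zero
  and, being symmetric, is zero.\<close>

lemma op_sqrt_unique:
  assumes P: "op_positive P" and Q: "op_positive Q" and PQ: "P o\<^sub>L P = Q o\<^sub>L Q"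
  shows "P = Q"
proof -
  have T: "op_positive (P o\<^sub>L P)"
    using P by (intro op_positiveI)
      (auto simp: op_positive_bounded_ops op_positive_symmetric[OF P, symmetric] cinner_self)
  obtain S where S: "op_positive S" "S o\<^sub>L S = P o\<^sub>L P"
    and comm: "\<And>Z. Z o\<^sub>L (P o\<^sub>L P) = (P o\<^sub>L P) o\<^sub>L Z \<Longrightarrow> Z o\<^sub>L S = S o\<^sub>L Z"
    using op_sqrt_exists[OF T] by blast
  have uniq: "S = Q'" if Q': "op_positive Q'" and sq: "Q' o\<^sub>L Q' = P o\<^sub>L P" for Q'
  proof (rule blinfun_eqI)
    fix x
    have "Q' o\<^sub>L S = S o\<^sub>L Q'"
      by (rule comm) (simp add: blinfun_eqI flip: sq)
    then have c: "blinfun_apply Q' (blinfun_apply S v) = blinfun_apply S (blinfun_apply Q' v)" for v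
      by (metis blinfun_apply_blinfun_compose)
    have e: "blinfun_apply Q' (blinfun_apply Q' v) = blinfun_apply S (blinfun_apply S v)" for v
      using S(2) sq by (metis blinfun_apply_blinfun_compose)
    define D where "D = S - Q'"
    define y where "y = blinfun_apply D x"
    have "blinfun_apply S y + blinfun_apply Q' y = 0"
      by (simp add: y_def D_def blinfun.bilinear_simps c e)
    then have "Re (cinner y (blinfun_apply S y)) + Re (cinner y (blinfun_apply Q' y)) = 0"
      by (metis cinner_add_right cinner.zero_right plus_complex.sel(1) zero_complex.sel(1))
    then have "Re (cinner y (blinfun_apply S y)) = 0" "Re (cinner y (blinfun_apply Q' y)) = 0"
      using op_positive_Re[OF S(1), of y] op_positive_Re[OF Q', of y] by linarith+
    then have "blinfun_apply D y = 0"
      using op_positive_null[OF S(1), of y] op_positive_null[OF Q', of y] by (simp add: D_def blinfun.diff_left)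
    moreover have "cinner y y = cinner x (blinfun_apply D y)"
      unfolding y_def by (simp add: D_def blinfun.diff_left blinfun.diff_right cinner.diff_left cinner.diff_right
          op_positive_symmetric[OF S(1)] op_positive_symmetric[OF Q'])
    ultimately have "y = 0"
      by (simp add: cinner_self cinner.zero_right)
    then show "blinfun_apply S x = blinfun_apply Q' x"
      by (simp add: y_def D_def blinfun.diff_left)
  qed
  show ?thesis
    using uniq[OF P refl] uniq[OF Q PQ[symmetric]] by simp
qed

section \<open>The absolute value of an operator\<close>

lemma
  assumes A: "A \<in> bounded_ops"
  shows op_positive_op_abs: "op_positive (op_abs A)"
    and op_abs_square: "op_abs A o\<^sub>L op_abs A = op_adjoint A o\<^sub>L A"
proof -
  have "op_positive (op_adjoint A o\<^sub>L A)"
    by (rule op_positiveI)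
      (auto simp: A op_adjoint_bounded_ops cinner_adjoint_left cinner_adjoint_right cinner_self)
  then obtain S where S: "op_positive S \<and> S o\<^sub>L S = op_adjoint A o\<^sub>L A"
    using op_sqrt_exists by blast
  have "op_positive (op_abs A) \<and> op_abs A o\<^sub>L op_abs A = op_adjoint A o\<^sub>L A"
    unfolding op_abs_def by (rule theI[where a=S]) (use S op_sqrt_unique in metis)+
  then show "op_positive (op_abs A)" "op_abs A o\<^sub>L op_abs A = op_adjoint A o\<^sub>L A"
    by auto
qed

lemma op_abs_eqI:
  assumes "A \<in> bounded_ops" "op_positive P" "P o\<^sub>L P = op_adjoint A o\<^sub>L A"
  shows "op_abs A = P"
  by (rule op_sqrt_unique) (simp_all add: assms op_positive_op_abs op_abs_square)

lemma norm_op_abs_apply: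
  assumes A: "A \<in> bounded_ops"
  shows "norm (blinfun_apply (op_abs A) x) = norm (blinfun_apply A x)"
proof -
  have "cinner (blinfun_apply (op_abs A) x) (blinfun_apply (op_abs A) x)
      = cinner x (blinfun_apply (op_abs A o\<^sub>L op_abs A) x)"
    by (simp add: op_positive_symmetric[OF op_positive_op_abs[OF A]])
  also have "\<dots> = cinner (blinfun_apply A x) (blinfun_apply A x)"
    by (simp add: op_abs_square[OF A] cinner_adjoint_right[OF A])
  finally have "(norm (blinfun_apply (op_abs A) x))\<^sup>2 = (norm (blinfun_apply A x))\<^sup>2"
    unfolding cinner_self by (simp only: of_real_eq_iff)
  then show ?thesis
    by simp
qed

lemma op_abs_scaleC:
  assumes A: "A \<in> bounded_ops"
  shows "op_abs (c *\<^sub>C A) = cmod c *\<^sub>R op_abs A"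
proof (rule op_abs_eqI)
  show "cmod c *\<^sub>R op_abs A o\<^sub>L cmod c *\<^sub>R op_abs A = op_adjoint (c *\<^sub>C A) o\<^sub>L c *\<^sub>C A"
  proof (rule blinfun_eqI)
    fix x
    have "blinfun_apply (op_abs A) (blinfun_apply (op_abs A) x) = blinfun_apply (op_adjoint A) (blinfun_apply A x)"
      using op_abs_square[OF A] by (metis blinfun_apply_blinfun_compose)
    moreover have "complex_of_real (cmod c * cmod c) = cnj c * c"
      by (metis complex_norm_square mult.commute power2_eq_square of_real_mult of_real_power)
    ultimately show "blinfun_apply (cmod c *\<^sub>R op_abs A o\<^sub>L cmod c *\<^sub>R op_abs A) x
        = blinfun_apply (op_adjoint (c *\<^sub>C A) o\<^sub>L c *\<^sub>C A) x"
      by (simp add: op_adjoint_scaleC[OF A] scaleC_blinfun.rep_eq blinfun.bilinear_simps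
          bounded_opsD[OF op_adjoint_bounded_ops[OF A]]
          bounded_opsD[OF op_positive_bounded_ops[OF op_positive_op_abs[OF A]]] scaleC_scaleC scaleR_scaleC[where 'a='a])
  qed
qed (use A in \<open>auto intro: op_positive_scaleR op_positive_op_abs\<close>)

lemma mult_le_half_squares: "x * y \<le> (x\<^sup>2 + y\<^sup>2) / 2" for x y :: real
  using sum_squares_bound[of x y] by simp

subsection \<open>Inverses\<close>

lemma blinfun_eq_iff: "S = T \<longleftrightarrow> (\<forall>x. blinfun_apply S x = blinfun_apply T x)"
  by (auto intro: blinfun_eqI)

lemma is_op_inverse_unique:
  assumes "is_op_inverse T R" "is_op_inverse T R'"
  shows "R = R'"
proof -
  have "R = R o\<^sub>L (T o\<^sub>L R')"
    using assms by (intro blinfun_eqI) (simp add: is_op_inverse_def)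
  also have "\<dots> = (R o\<^sub>L T) o\<^sub>L R'"
    by (intro blinfun_eqI) simp
  also have "\<dots> = R'"
    using assms by (intro blinfun_eqI) (simp add: is_op_inverse_def)
  finally show ?thesis .
qed

lemma op_inverse_eq: "is_op_inverse T R \<Longrightarrow> op_inverse T = R"
  unfolding op_inverse_def using is_op_inverse_unique by blast

lemma is_op_inverse_op_inverse: "op_invertible T \<Longrightarrow> is_op_inverse T (op_inverse T)"
  using op_inverse_eq by (auto simp: op_invertible_def)

fun blinfun_power :: "('a::real_normed_vector \<Rightarrow>\<^sub>L 'a) \<Rightarrow> nat \<Rightarrow> ('a \<Rightarrow>\<^sub>L 'a)"
  where "blinfun_power T 0 = id_blinfun"
  | "blinfun_power T (Suc n) = T o\<^sub>L blinfun_power T n"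

lemma norm_blinfun_power: "norm (blinfun_power T n) \<le> norm T ^ n"
proof (induction n)
  case (Suc n)
  have "norm (blinfun_power T (Suc n)) \<le> norm T * norm (blinfun_power T n)"
    using norm_blinfun_compose by simp
  also have "\<dots> \<le> norm T * norm T ^ n"
    by (intro mult_left_mono Suc.IH) simp
  finally show ?case by simp
qed (simp add: norm_blinfun_id_le)

lemma blinfun_power_Suc_right: "blinfun_power T (Suc n) = blinfun_power T n o\<^sub>L T"
  by (induction n) (auto intro!: blinfun_eqI simp: blinfun_eq_iff)

lemma neumann_inverse:
  fixes T :: "'a::complex_hilbert_space \<Rightarrow>\<^sub>L 'a"
  assumes T: "T \<in> bounded_ops" and T1: "norm T < 1"
  shows "op_invertible (id_blinfun - T)"
proof -
  have summ: "summable (blinfun_power T)"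
    by (rule summable_comparison_test'[OF summable_geometric, of "norm T" 0])
      (use T1 norm_blinfun_power in auto)
  define S where "S = suminf (blinfun_power T)"
  have "blinfun_power T n \<in> bounded_ops" for n
    by (induction n) (auto simp: T)
  then have "S \<in> bounded_ops"
    unfolding S_def by (rule bounded_ops_suminf[OF summ])
  have bl: "bounded_linear (\<lambda>Z. T o\<^sub>L Z)" "bounded_linear (\<lambda>Z. Z o\<^sub>L T)"
    using bounded_bilinear_blinfun_compose
    by (auto intro: bounded_bilinear.bounded_linear_right bounded_bilinear.bounded_linear_left)
  have shift: "(\<Sum>n. blinfun_power T (Suc n)) = S - id_blinfun"
    using suminf_split_head[OF summ] by (simp add: S_def)
  have "T o\<^sub>L S = (\<Sum>n. T o\<^sub>L blinfun_power T n)"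
    unfolding S_def by (rule bounded_linear.suminf[OF bl(1) summ])
  then have 1: "T o\<^sub>L S = S - id_blinfun"
    using shift by simp
  have "S o\<^sub>L T = (\<Sum>n. blinfun_power T n o\<^sub>L T)"
    unfolding S_def by (rule bounded_linear.suminf[OF bl(2) summ])
  then have 2: "S o\<^sub>L T = S - id_blinfun"
    using shift unfolding blinfun_power_Suc_right by simp
  have "(id_blinfun - T) o\<^sub>L S = S - (T o\<^sub>L S)" "S o\<^sub>L (id_blinfun - T) = S - (S o\<^sub>L T)"
    by (rule blinfun_eqI, simp add: blinfun.bilinear_simps)+
  then have "is_op_inverse (id_blinfun - T) S"
    using \<open>S \<in> bounded_ops\<close> by (simp add: is_op_inverse_def 1 2)
  then show ?thesis
    unfolding op_invertible_def by blast
qed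

lemma op_invertible_compose:
  assumes "op_invertible S" "op_invertible T"
  shows "op_invertible (S o\<^sub>L T)"
proof -
  obtain S' T' where "is_op_inverse S S'" "is_op_inverse T T'"
    using assms by (auto simp: op_invertible_def)
  then have "is_op_inverse (S o\<^sub>L T) (T' o\<^sub>L S')"
    by (auto simp: is_op_inverse_def blinfun_eq_iff)
  then show ?thesis
    unfolding op_invertible_def by blast
qed

lemma op_invertible_scaleR:
  assumes "op_invertible T" "r \<noteq> 0"
  shows "op_invertible (r *\<^sub>R T)"
proof -
  obtain T' where "is_op_inverse T T'"
    using assms by (auto simp: op_invertible_def)
  then have "is_op_inverse (r *\<^sub>R T) ((1/r) *\<^sub>R T')"
    using assms(2) by (auto simp: is_op_inverse_def blinfun_eq_iff blinfun.bilinear_simps intro!: bounded_ops_scaleR)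
  then show ?thesis
    unfolding op_invertible_def by blast
qed

text \<open>Factorisation \<open>M' = M (I - R (M - M'))\<close> and the Neumann series for the
  second factor.\<close>

lemma op_invertible_perturb:
  fixes M M' :: "'a::complex_hilbert_space \<Rightarrow>\<^sub>L 'a"
  assumes R: "is_op_inverse M R" and M': "M' \<in> bounded_ops" and M: "M \<in> bounded_ops"
    and small: "norm R * norm (M - M') < 1"
  shows "op_invertible M'"
proof -
  have "op_invertible (id_blinfun - (R o\<^sub>L (M - M')))"
    using R M M' small norm_blinfun_compose[of R "M - M'"]
    by (intro neumann_inverse) (auto simp: is_op_inverse_def)
  moreover have "op_invertible M"
    using R by (auto simp: op_invertible_def)
  ultimately have "op_invertible (M o\<^sub>L (id_blinfun - (R o\<^sub>L (M - M'))))"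
    by (intro op_invertible_compose)
  also have "M o\<^sub>L (id_blinfun - (R o\<^sub>L (M - M'))) = M'"
    using R by (auto simp: is_op_inverse_def blinfun_eq_iff blinfun.bilinear_simps)
  finally show ?thesis .
qed

lemma op_positive_shift_invertible:
  assumes P: "op_positive P" and e: "e > 0"
  shows "op_invertible (P + e *\<^sub>R id_blinfun)"
proof -
  define c where "c = norm P + 1"
  have c: "c > 0"
    by (simp add: c_def add_nonneg_pos)
  have "op_positive ((1/c) *\<^sub>R P)" "norm ((1/c) *\<^sub>R P) \<le> 1"
    using c P by (auto intro: op_positive_scaleR simp: c_def)
  note le = norm_id_minus_positive[OF this]
  \<comment> \<open>\<open>Z\<close> is made so that \<open>(c + e) (I - Z) = P + e I\<close>. As
    \<open>I - P / c\<close> is a contraction, the norm of \<open>Z\<close> is at most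
    \<open>c / (c + e) < 1\<close>.\<close>
  define Z where "Z = (c / (c + e)) *\<^sub>R (id_blinfun - (1/c) *\<^sub>R P)"
  have "norm Z \<le> c / (c + e) * 1"
    unfolding Z_def norm_scaleR using c e le by (intro mult_mono) auto
  also have "\<dots> < 1"
    using c e by simp
  finally have "op_invertible (id_blinfun - Z)"
    by (intro neumann_inverse)
      (auto simp: Z_def op_positive_bounded_ops[OF P] intro!: bounded_ops_scaleR bounded_ops_diff)
  then have "op_invertible ((c + e) *\<^sub>R (id_blinfun - Z))"
    using c e by (intro op_invertible_scaleR) auto
  also have "(c + e) *\<^sub>R (id_blinfun - Z) = P + e *\<^sub>R id_blinfun"
    using c e by (auto simp: Z_def scaleR_diff_right scaleR_add_left)
  finally show ?thesis .
qed


section \<open>Nuclear representations of trace class operators\<close>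

text \<open>A sum of rank one operators with the weight of each term split evenly between its two
  vectors, so that one square-summable family controls both. The index set is arbitrary, in a type
  of its own, so that representations of two operators can be joined over a disjoint union.\<close>

definition nuclear_rep ::
    "'i set \<Rightarrow> ('i \<Rightarrow> 'a) \<Rightarrow> ('i \<Rightarrow> 'a) \<Rightarrow> ('a::complex_hilbert_space \<Rightarrow>\<^sub>L 'a) \<Rightarrow> bool"
  where "nuclear_rep N g h A \<longleftrightarrow>
    (\<forall>n\<in>N. norm (g n) = norm (h n)) \<and> (\<lambda>n. (norm (g n))\<^sup>2) summable_on N \<and>
    (\<forall>x. ((\<lambda>n. cinner (g n) x *\<^sub>C h n) has_sum blinfun_apply A x) N)"

lemma nuclear_repD:
  assumes "nuclear_rep N g h A"
  shows "n \<in> N \<Longrightarrow> norm (h n) = norm (g n)"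
    and "(\<lambda>n. (norm (g n))\<^sup>2) summable_on N"
    and "((\<lambda>n. cinner (g n) x *\<^sub>C h n) has_sum blinfun_apply A x) N"
  using assms by (auto simp: nuclear_rep_def)

lemma nuclear_rep_bounded_ops:
  assumes "nuclear_rep N g h A"
  shows "A \<in> bounded_ops"
  unfolding bounded_ops_def mem_Collect_eq
proof (intro allI)
  fix c x
  have "((\<lambda>n. c *\<^sub>C cinner (g n) x *\<^sub>C h n) has_sum c *\<^sub>C blinfun_apply A x) N"
    by (intro has_sum_scaleC_right nuclear_repD(3)[OF assms])
  then have "((\<lambda>n. cinner (g n) (c *\<^sub>C x) *\<^sub>C h n) has_sum c *\<^sub>C blinfun_apply A x) N"
    by (simp add: cinner_scaleC_right scaleC_scaleC)
  then show "blinfun_apply A (c *\<^sub>C x) = c *\<^sub>C blinfun_apply A x"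
    using nuclear_repD(3)[OF assms] has_sum_unique by blast
qed

lemma trace_class_bounded_ops: "trace_class A \<Longrightarrow> A \<in> bounded_ops"
  by (simp add: trace_class_def)

text \<open>With \<open>P = \<bar>A\<bar>\<close>, \<open>S\<close> its square root and \<open>R n\<close> such that \<open>P R n\<close> tends to \<open>S\<close>, the operators
  \<open>A R n\<close> converge to some \<open>W\<close> with \<open>W S = A\<close> and \<open>\<bar>W\<bar> = S\<close>; this replaces the polar decomposition.\<close>

lemma trace_class_nuclear_rep:
  fixes A :: "'a::complex_hilbert_space \<Rightarrow>\<^sub>L 'a"
  assumes "trace_class A"
  obtains g h :: "'a \<Rightarrow> 'a" where "nuclear_rep hbasis g h A" "((\<lambda>e. (norm (g e))\<^sup>2) has_sum trace_norm A) hbasis"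
proof -
  have A: "A \<in> bounded_ops"
    using assms by (rule trace_class_bounded_ops)
  define P where "P = op_abs A"
  have P: "op_positive P"
    unfolding P_def by (rule op_positive_op_abs[OF A])
  have PA: "norm (blinfun_apply A x) = norm (blinfun_apply P x)" for x
    unfolding P_def by (rule norm_op_abs_apply[OF A, symmetric])
  obtain S R where S: "op_positive S" "S o\<^sub>L S = P"
    and R: "\<And>n. R n \<in> bounded_ops" "(\<lambda>n. P o\<^sub>L R n) \<longlonglongrightarrow> S"
    using op_sqrt_exists[OF P] by blast
  have "Cauchy (\<lambda>n. A o\<^sub>L R n)"
  proof (rule CauchyI)
    fix e :: real assume "e > 0"
    have "Cauchy (\<lambda>n. P o\<^sub>L R n)"
      using R(2) by (rule LIMSEQ_imp_Cauchy)
    then obtain M where M: "\<And>m n. m \<ge> M \<Longrightarrow> n \<ge> M \<Longrightarrow> norm ((P o\<^sub>L R m) - (P o\<^sub>L R n)) < e"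
      using CauchyD[OF _ \<open>e > 0\<close>] by blast
    have "norm ((A o\<^sub>L R m) - (A o\<^sub>L R n)) \<le> norm ((P o\<^sub>L R m) - (P o\<^sub>L R n))" for m n
    proof (rule norm_blinfun_bound)
      fix x
      have "norm (blinfun_apply ((A o\<^sub>L R m) - (A o\<^sub>L R n)) x)
          = norm (blinfun_apply A (blinfun_apply (R m) x - blinfun_apply (R n) x))"
        by (simp add: blinfun.diff_left blinfun.diff_right)
      also have "\<dots> = norm (blinfun_apply ((P o\<^sub>L R m) - (P o\<^sub>L R n)) x)"
        unfolding PA by (simp add: blinfun.diff_left blinfun.diff_right)
      also have "\<dots> \<le> norm ((P o\<^sub>L R m) - (P o\<^sub>L R n)) * norm x"
        by (rule norm_blinfun)
      finally show "norm (blinfun_apply ((A o\<^sub>L R m) - (A o\<^sub>L R n)) x) \<le> norm ((P o\<^sub>L R m) - (P o\<^sub>L R n)) * norm x" .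
    qed simp
    then show "\<exists>M. \<forall>m\<ge>M. \<forall>n\<ge>M. norm ((A o\<^sub>L R m) - (A o\<^sub>L R n)) < e"
      using M by (meson le_less_trans)
  qed
  then obtain W where W: "(\<lambda>n. A o\<^sub>L R n) \<longlonglongrightarrow> W"
    using Cauchy_convergent_iff convergent_def by blast
  have Wb: "W \<in> bounded_ops"
    by (rule bounded_ops_lim[OF W]) (auto intro: A R)
  have Rx: "(\<lambda>n. blinfun_apply P (blinfun_apply (R n) x)) \<longlonglongrightarrow> blinfun_apply S x" for x
    using tendsto_intros(1) blinfun.tendsto[OF R(2) tendsto_const[of x]] by simp
  have Wx: "(\<lambda>n. blinfun_apply A (blinfun_apply (R n) x)) \<longlonglongrightarrow> blinfun_apply W x" for x
    using blinfun.tendsto[OF W tendsto_const[of x]] by simp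
  have WS: "norm (blinfun_apply W x) = norm (blinfun_apply S x)" for x
  proof (rule LIMSEQ_unique)
    show "(\<lambda>n. norm (blinfun_apply A (blinfun_apply (R n) x))) \<longlonglongrightarrow> norm (blinfun_apply W x)"
      by (intro tendsto_norm Wx)
    show "(\<lambda>n. norm (blinfun_apply A (blinfun_apply (R n) x))) \<longlonglongrightarrow> norm (blinfun_apply S x)"
      unfolding PA by (intro tendsto_norm Rx)
  qed
  have WSA: "blinfun_apply W (blinfun_apply S x) = blinfun_apply A x" for x
  proof -
    have "(\<lambda>n. norm (blinfun_apply P (blinfun_apply (R n) (blinfun_apply S x)) - blinfun_apply P x))
        \<longlonglongrightarrow> norm (blinfun_apply S (blinfun_apply S x) - blinfun_apply P x)"
      by (intro tendsto_intros Rx)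
    moreover have "blinfun_apply S (blinfun_apply S x) = blinfun_apply P x"
      using S(2) by (metis blinfun_apply_blinfun_compose)
    moreover have "norm (blinfun_apply P (blinfun_apply (R n) (blinfun_apply S x)) - blinfun_apply P x)
      = norm (blinfun_apply A (blinfun_apply (R n) (blinfun_apply S x)) - blinfun_apply A x)" for n
      using PA[of "blinfun_apply (R n) (blinfun_apply S x) - x"] by (simp add: blinfun.diff_right)
    ultimately have "(\<lambda>n. blinfun_apply A (blinfun_apply (R n) (blinfun_apply S x)) - blinfun_apply A x) \<longlonglongrightarrow> 0"
      by (simp add: tendsto_norm_zero_iff)
    then have "(\<lambda>n. blinfun_apply A (blinfun_apply (R n) (blinfun_apply S x))) \<longlonglongrightarrow> blinfun_apply A x"
      by (simp add: LIM_zero_iff)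
    then show ?thesis
      using Wx LIMSEQ_unique by blast
  qed
  have "((\<lambda>e. complex_of_real ((norm (blinfun_apply S e))\<^sup>2)) has_sum op_trace P) hbasis"
  proof -
    have eq: "cinner e (blinfun_apply P e) = complex_of_real ((norm (blinfun_apply S e))\<^sup>2)" for e
      by (metis S blinfun_apply_blinfun_compose cinner_self op_positive_symmetric)
    have "((\<lambda>e. cinner e (blinfun_apply P e)) has_sum op_trace P) hbasis"
      using assms unfolding op_trace_def trace_on_def trace_class_def P_def by (intro has_sum_infsum) simp
    then show ?thesis
      unfolding eq .
  qed
  then have sum: "((\<lambda>e. (norm (blinfun_apply S e))\<^sup>2) has_sum trace_norm A) hbasis"
    using has_sum_Re by (fastforce simp: trace_norm_def P_def)
  \<comment> \<open>This produces \<open>g = S\<close> and \<open>h = W\<close> on the basis: expand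
    \<open>S x\<close>, apply \<open>W\<close>, and move \<open>S\<close> to the other side of the
    inner product. The squared norms of \<open>S e\<close> are the diagonal entries of
    \<open>P\<close>, so their sum is the trace norm.\<close>
  have "((\<lambda>e. blinfun_apply W (cinner e (blinfun_apply S x) *\<^sub>C e)) has_sum blinfun_apply W (blinfun_apply S x)) hbasis" for x
    by (intro has_sum_apply hbasis_expansion)
  then have "((\<lambda>e. cinner (blinfun_apply S e) x *\<^sub>C blinfun_apply W e) has_sum blinfun_apply A x) hbasis" for x
    by (simp add: WSA bounded_opsD[OF Wb] op_positive_symmetric[OF S(1)])
  then have "nuclear_rep hbasis (blinfun_apply S) (blinfun_apply W) A"
    using sum by (auto simp: nuclear_rep_def WS summable_on_def)
  then show ?thesis
    using sum by (rule that)
qed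

text \<open>With \<open>P = \<bar>A\<bar>\<close>, the contractions \<open>U = A (P + \<epsilon> I)\<^sup>-\<^sup>1\<close> stand in for the partial isometry of the polar
  decomposition: the adjoint of \<open>U\<close> composed with \<open>A\<close> differs from \<open>P\<close> by at most \<open>\<epsilon>\<close> in norm.\<close>

lemma nuclear_rep_abs_diagonal_le:
  assumes rep: "nuclear_rep N g h A" and fin: "finite F" "F \<subseteq> hbasis"
  shows "(\<Sum>e\<in>F. Re (cinner e (blinfun_apply (op_abs A) e))) \<le> (\<Sum>\<^sub>\<infinity>n\<in>N. (norm (g n))\<^sup>2)"
proof -
  have A: "A \<in> bounded_ops"
    using rep by (rule nuclear_rep_bounded_ops)
  define P where "P = op_abs A"
  have P: "op_positive P"
    unfolding P_def by (rule op_positive_op_abs[OF A])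
  have PA: "norm (blinfun_apply A x) = norm (blinfun_apply P x)" for x
    unfolding P_def by (rule norm_op_abs_apply[OF A, symmetric])
  define a where "a = (\<Sum>\<^sub>\<infinity>n\<in>N. (norm (g n))\<^sup>2)"
  have a: "((\<lambda>n. (norm (g n))\<^sup>2) has_sum a) N"
    unfolding a_def by (rule has_sum_infsum[OF nuclear_repD(2)[OF rep]])
  have approx: "(\<Sum>e\<in>F. Re (cinner e (blinfun_apply P e))) \<le> a + \<epsilon> * card F"
    if F: "finite F" "F \<subseteq> hbasis" and "\<epsilon> > 0" for F and \<epsilon> :: real
  proof -
    obtain K where K: "is_op_inverse (P + \<epsilon> *\<^sub>R id_blinfun) K"
      using op_positive_shift_invertible[OF P \<open>\<epsilon> > 0\<close>] by (auto simp: op_invertible_def)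
    then have Kb: "K \<in> bounded_ops"
      by (simp add: is_op_inverse_def)
    have PK: "blinfun_apply P (blinfun_apply K x) + \<epsilon> *\<^sub>R blinfun_apply K x = x" for x
      using K by (simp add: is_op_inverse_def blinfun_eq_iff blinfun.bilinear_simps)
    have KP: "blinfun_apply K (blinfun_apply P x) + \<epsilon> *\<^sub>R blinfun_apply K x = x" for x
      using K by (simp add: is_op_inverse_def blinfun_eq_iff blinfun.bilinear_simps)
    have comm: "blinfun_apply K (blinfun_apply P x) = blinfun_apply P (blinfun_apply K x)" for x
      using PK[of x] KP[of x] by (metis add_right_cancel)
    have Ksym: "cinner (blinfun_apply K x) y = cinner x (blinfun_apply K y)" for x y
    proof -
      have "cinner (blinfun_apply K x) y
          = cinner (blinfun_apply K x) (blinfun_apply P (blinfun_apply K y) + \<epsilon> *\<^sub>R blinfun_apply K y)"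
        by (simp only: PK)
      also have "\<dots> = cinner (blinfun_apply P (blinfun_apply K x) + \<epsilon> *\<^sub>R blinfun_apply K x) (blinfun_apply K y)"
        by (simp add: cinner_add_left cinner_add_right op_positive_symmetric[OF P] cinner_scaleR_left cinner_scaleR_right)
      also have "\<dots> = cinner x (blinfun_apply K y)"
        by (simp only: PK)
      finally show ?thesis .
    qed
    have contr: "norm (blinfun_apply P (blinfun_apply K x)) \<le> norm x" for x
    proof -
      let ?y = "blinfun_apply K x"
      have "(norm x)\<^sup>2 = (norm (blinfun_apply P ?y - (- \<epsilon> *\<^sub>R ?y)))\<^sup>2"
        using PK[of x] by simp
      also have "\<dots> = (norm (blinfun_apply P ?y))\<^sup>2 + 2 * \<epsilon> * Re (cinner (blinfun_apply P ?y) ?y) + (norm (\<epsilon> *\<^sub>R ?y))\<^sup>2"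
        unfolding norm_diff_sq by (simp add: cinner_scaleR_right cinner.minus_right)
      also have "\<dots> \<ge> (norm (blinfun_apply P ?y))\<^sup>2"
        using op_positive_Re[OF P, of ?y] \<open>\<epsilon> > 0\<close> by (simp add: op_positive_symmetric[OF P])
      finally show ?thesis
        by (rule power2_le_imp_le) simp
    qed
    define U where "U = A o\<^sub>L K"
    have Ub: "U \<in> bounded_ops"
      unfolding U_def by (intro bounded_ops_compose A Kb)
    have U1: "norm U \<le> 1"
      by (rule norm_blinfun_bound) (simp_all add: U_def PA contr)
    have UA: "cinner (blinfun_apply U e) (blinfun_apply A e) = cinner e (blinfun_apply P e) - \<epsilon> *\<^sub>R cinner e (blinfun_apply P (blinfun_apply K e))" for e
    proof -
      have "op_adjoint A o\<^sub>L A = P o\<^sub>L P"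
        unfolding P_def using op_abs_square[OF A] by simp
      then have AA: "blinfun_apply (op_adjoint A) (blinfun_apply A v) = blinfun_apply P (blinfun_apply P v)" for v
        by (metis blinfun_apply_blinfun_compose)
      have "cinner (blinfun_apply U e) (blinfun_apply A e) = cinner e (blinfun_apply K (blinfun_apply P (blinfun_apply P e)))"
        by (simp add: U_def Ksym cinner_adjoint_right[OF A, symmetric] AA)
      also have "blinfun_apply K (blinfun_apply P (blinfun_apply P e)) = blinfun_apply P e - \<epsilon> *\<^sub>R blinfun_apply P (blinfun_apply K e)"
        using KP[of "blinfun_apply P e"] comm by (metis add_diff_cancel_right')
      finally show ?thesis
        by (simp add: cinner.diff_right cinner_scaleR_right)
    qed
    have "((\<lambda>n. \<Sum>e\<in>F. cinner (blinfun_apply U e) (cinner (g n) e *\<^sub>C h n)) has_sum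
        (\<Sum>e\<in>F. cinner (blinfun_apply U e) (blinfun_apply A e))) N"
      by (intro has_sum_finite_sum has_sum_cinner_right nuclear_repD(3)[OF rep])
    then have "cmod (\<Sum>e\<in>F. cinner (blinfun_apply U e) (blinfun_apply A e)) \<le> a"
    proof (rule norm_infsum_le[OF _ a])
      \<comment> \<open>For fixed \<open>n\<close> the sum over \<open>F\<close> pairs the
        coefficients of \<open>g n\<close> with those of the adjoint of \<open>U\<close> at
        \<open>h n\<close>. Bessel's inequality bounds both families by the same weight, and the
        mean of squares bounds the pairing.\<close>
      fix n assume n: "n \<in> N"
      have b1: "(\<Sum>e\<in>F. (cmod (cinner (blinfun_apply U e) (h n)))\<^sup>2) \<le> (norm (g n))\<^sup>2"
      proof -
        have "(\<Sum>e\<in>F. (cmod (cinner (blinfun_apply U e) (h n)))\<^sup>2) \<le> (norm U * norm (h n))\<^sup>2"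
          by (rule adjoint_bessel[OF F Ub])
        also have "\<dots> \<le> (1 * norm (h n))\<^sup>2"
          by (intro power_mono mult_right_mono U1) auto
        finally show ?thesis
          by (simp add: nuclear_repD(1)[OF rep n])
      qed
      have b2: "(\<Sum>e\<in>F. (cmod (cinner (g n) e))\<^sup>2) \<le> (norm (g n))\<^sup>2"
        using bessel_finite[OF orthonormal_hbasis F, of "g n"] by (simp add: cmod_cinner_commute)
      have "cmod (\<Sum>e\<in>F. cinner (blinfun_apply U e) (cinner (g n) e *\<^sub>C h n))
          \<le> (\<Sum>e\<in>F. cmod (cinner (g n) e) * cmod (cinner (blinfun_apply U e) (h n)))"
        by (rule order_trans[OF norm_sum]) (simp add: cinner_scaleC_right norm_mult)
      also have "\<dots> \<le> (\<Sum>e\<in>F. ((cmod (cinner (g n) e))\<^sup>2 + (cmod (cinner (blinfun_apply U e) (h n)))\<^sup>2) / 2)"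
        by (intro sum_mono mult_le_half_squares)
      also have "\<dots> \<le> (norm (g n))\<^sup>2"
        using b1 b2 by (simp add: sum.distrib flip: sum_divide_distrib)
      finally show "cmod (\<Sum>e\<in>F. cinner (blinfun_apply U e) (cinner (g n) e *\<^sub>C h n)) \<le> (norm (g n))\<^sup>2" .
    qed
    moreover have "(\<Sum>e\<in>F. cinner (blinfun_apply U e) (blinfun_apply A e))
        = (\<Sum>e\<in>F. cinner e (blinfun_apply P e)) - \<epsilon> *\<^sub>R (\<Sum>e\<in>F. cinner e (blinfun_apply P (blinfun_apply K e)))"
      by (simp add: UA sum_subtractf scaleR_sum_right)
    ultimately have "cmod ((\<Sum>e\<in>F. cinner e (blinfun_apply P e)) - \<epsilon> *\<^sub>R (\<Sum>e\<in>F. cinner e (blinfun_apply P (blinfun_apply K e)))) \<le> a"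
      by simp
    moreover have "cmod (\<epsilon> *\<^sub>R (\<Sum>e\<in>F. cinner e (blinfun_apply P (blinfun_apply K e)))) \<le> \<epsilon> * card F"
    proof -
      have "cmod (cinner e (blinfun_apply P (blinfun_apply K e))) \<le> 1" if "e \<in> F" for e
        using norm_cinner_le[of e "blinfun_apply P (blinfun_apply K e)"] contr[of e] norm_hbasis[of e] F that
        by auto
      then have "cmod (\<Sum>e\<in>F. cinner e (blinfun_apply P (blinfun_apply K e))) \<le> card F"
        using sum_norm_bound[of F "\<lambda>e. cinner e (blinfun_apply P (blinfun_apply K e))" 1] by simp
      then show ?thesis
        using \<open>\<epsilon> > 0\<close> by (simp add: mult_left_mono)
    qed
    ultimately have "cmod (\<Sum>e\<in>F. cinner e (blinfun_apply P e)) \<le> a + \<epsilon> * card F"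
      using norm_triangle_sub[of "\<Sum>e\<in>F. cinner e (blinfun_apply P e)"
          "\<epsilon> *\<^sub>R (\<Sum>e\<in>F. cinner e (blinfun_apply P (blinfun_apply K e)))"] by linarith
    moreover have "(\<Sum>e\<in>F. Re (cinner e (blinfun_apply P e))) \<le> cmod (\<Sum>e\<in>F. cinner e (blinfun_apply P e))"
      using complex_Re_le_cmod[of "\<Sum>e\<in>F. cinner e (blinfun_apply P e)"] by simp
    ultimately show ?thesis by linarith
  qed
  have "(\<Sum>e\<in>F. Re (cinner e (blinfun_apply P e))) \<le> a"
  proof (rule field_le_epsilon)
    fix \<delta> :: real assume "\<delta> > 0"
    \<comment> \<open>The error is proportional to \<open>card F\<close>, which is fixed while
      \<epsilon> shrinks; the added 1 covers the empty set.\<close>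
    then have "(\<Sum>e\<in>F. Re (cinner e (blinfun_apply P e))) \<le> a + \<delta> / (card F + 1) * card F"
      by (intro approx fin) simp
    also have "\<delta> / (card F + 1) * card F \<le> \<delta>"
      using \<open>\<delta> > 0\<close> by (simp add: field_simps)
    finally show "(\<Sum>e\<in>F. Re (cinner e (blinfun_apply P e))) \<le> a + \<delta>"
      by simp
  qed
  then show ?thesis
    by (simp add: P_def a_def)
qed

text \<open>Converse of \<open>trace_class_nuclear_rep\<close>. An arbitrary representation bounds
  the trace norm from above; closure under sums and the triangle inequality come from joining two
  representations.\<close>

lemma
  assumes rep: "nuclear_rep N g h A"
  shows nuclear_rep_trace_class: "trace_class A"
    and nuclear_rep_trace_norm_le: "trace_norm A \<le> (\<Sum>\<^sub>\<infinity>n\<in>N. (norm (g n))\<^sup>2)"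
proof -
  have A: "A \<in> bounded_ops"
    using rep by (rule nuclear_rep_bounded_ops)
  let ?f = "\<lambda>e. Re (cinner e (blinfun_apply (op_abs A) e))"
  have "?f summable_on hbasis"
    by (rule nonneg_bdd_above_summable_on)
      (auto intro!: bdd_aboveI2[where M = "\<Sum>\<^sub>\<infinity>n\<in>N. (norm (g n))\<^sup>2"] nuclear_rep_abs_diagonal_le[OF rep]
        op_positive_Re[OF op_positive_op_abs[OF A]])
  then have f: "(?f has_sum infsum ?f hbasis) hbasis"
    by (rule has_sum_infsum)
  have re: "complex_of_real (?f e) = cinner e (blinfun_apply (op_abs A) e)" for e
    using op_positive_op_abs[OF A] by (simp add: op_positive_def of_real_Re)
  have c: "((\<lambda>e. cinner e (blinfun_apply (op_abs A) e)) has_sum complex_of_real (infsum ?f hbasis)) hbasis"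
    using has_sum_of_real[OF f, where 'a = complex] unfolding re .
  then show "trace_class A"
    using A by (auto simp: trace_class_def summable_on_def)
  have "trace_norm A = infsum ?f hbasis"
    using infsumI[OF c] by (simp add: trace_norm_def op_trace_def trace_on_def)
  also have "\<dots> \<le> (\<Sum>\<^sub>\<infinity>n\<in>N. (norm (g n))\<^sup>2)"
    by (rule has_sum_le_finite_sums[OF f]) (rule nuclear_rep_abs_diagonal_le[OF rep])
  finally show "trace_norm A \<le> (\<Sum>\<^sub>\<infinity>n\<in>N. (norm (g n))\<^sup>2)" .
qed

lemma trace_class_scaleC:
  assumes "trace_class A"
  shows "trace_class (c *\<^sub>C A)"
proof -
  have A: "A \<in> bounded_ops"
    using assms by (rule trace_class_bounded_ops)
  have "(\<lambda>e. cmod c *\<^sub>R cinner e (blinfun_apply (op_abs A) e)) summable_on hbasis"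
    using assms by (intro summable_on_scaleR_right) (simp add: trace_class_def)
  then show ?thesis
    using A by (auto simp: trace_class_def op_abs_scaleC[OF A] blinfun.scaleR_left cinner_scaleR_right)
qed

subsection \<open>Traces\<close>

text \<open>The double family \<open>u\<close> is absolutely summable. Summing over the basis first
  gives the left-hand terms, summing over \<open>N\<close> first gives the diagonal of
  \<open>A o\<^sub>L B\<close>. In particular the trace can be computed from any nuclear
  representation.\<close>

lemma nuclear_rep_trace:
  assumes rep: "nuclear_rep N g h A" and B: "B \<in> bounded_ops"
  shows "((\<lambda>n. cinner (g n) (blinfun_apply B (h n))) has_sum op_trace (A o\<^sub>L B)) N"
proof -
  define u where "u n e = cinner (g n) (blinfun_apply B e) * cinner e (h n)" for n e
  define g' where "g' n = blinfun_apply (op_adjoint B) (g n)" for n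
  have ug: "u n e = cinner (g' n) e * cinner e (h n)" for n e
    by (simp add: u_def g'_def cinner_adjoint_left[OF B])
  have u1: "((\<lambda>e. u n e) has_sum cinner (g n) (blinfun_apply B (h n))) hbasis" for n
    using parseval_cinner[of "g' n" "h n"] unfolding ug by (simp add: g'_def cinner_adjoint_left[OF B])
  have bnd: "cmod (u n e) \<le> (cmod (cinner e (g' n)))\<^sup>2 + (cmod (cinner e (h n)))\<^sup>2" for n e
  proof -
    have "2 * (cmod (cinner (g' n) e) * cmod (cinner e (h n))) \<le> (cmod (cinner (g' n) e))\<^sup>2 + (cmod (cinner e (h n)))\<^sup>2"
      using sum_squares_bound[of "cmod (cinner (g' n) e)" "cmod (cinner e (h n))"] by simp
    moreover have "0 \<le> cmod (cinner (g' n) e) * cmod (cinner e (h n))"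
      by simp
    ultimately show ?thesis
      unfolding ug norm_mult cmod_cinner_commute[of "g' n" e] by linarith
  qed
  have summ: "(\<lambda>(n, e). u n e) summable_on N \<times> hbasis"
  proof (rule abs_summable_summable[OF Infinite_Sum.abs_summable_on_comparison_test'])
    show "(\<lambda>(n, e). (cmod (cinner e (g' n)))\<^sup>2 + (cmod (cinner e (h n)))\<^sup>2) summable_on N \<times> hbasis"
    proof (rule summable_on_SigmaI)
      show "((\<lambda>e. case (n, e) of (n, e) \<Rightarrow> (cmod (cinner e (g' n)))\<^sup>2 + (cmod (cinner e (h n)))\<^sup>2) has_sum
          ((norm (g' n))\<^sup>2 + (norm (h n))\<^sup>2)) hbasis" for n
        unfolding case_prod_conv by (intro has_sum_add parseval)
      show "(\<lambda>n. (norm (g' n))\<^sup>2 + (norm (h n))\<^sup>2) summable_on N"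
      proof (rule summable_on_comparison_test)
        show "(\<lambda>n. ((norm B)\<^sup>2 + 1) * (norm (g n))\<^sup>2) summable_on N"
          by (intro summable_on_cmult_right nuclear_repD(2)[OF rep])
        fix n assume "n \<in> N"
        have "norm (g' n) \<le> norm B * norm (g n)"
          unfolding g'_def by (rule norm_op_adjoint_apply[OF B])
        then have "(norm (g' n))\<^sup>2 \<le> (norm B)\<^sup>2 * (norm (g n))\<^sup>2"
          by (metis norm_ge_zero power_mono power_mult_distrib)
        then show "(norm (g' n))\<^sup>2 + (norm (h n))\<^sup>2 \<le> ((norm B)\<^sup>2 + 1) * (norm (g n))\<^sup>2"
          using nuclear_repD(1)[OF rep \<open>n \<in> N\<close>] by (simp add: algebra_simps)
      qed simp
    qed auto
    show "cmod (case ne of (n, e) \<Rightarrow> u n e)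
        \<le> (case ne of (n, e) \<Rightarrow> (cmod (cinner e (g' n)))\<^sup>2 + (cmod (cinner e (h n)))\<^sup>2)" for ne
      by (cases ne) (use bnd in simp)
  qed
  define t where "t = (\<Sum>\<^sub>\<infinity>ne\<in>N \<times> hbasis. case ne of (n, e) \<Rightarrow> u n e)"
  have t: "((\<lambda>(n, e). u n e) has_sum t) (N \<times> hbasis)"
    unfolding t_def by (rule has_sum_infsum[OF summ])
  have "((\<lambda>n. cinner (g n) (blinfun_apply B (h n))) has_sum t) N"
    by (rule has_sum_Sigma'[OF t]) (simp add: u1)
  moreover have "((\<lambda>e. cinner e (blinfun_apply (A o\<^sub>L B) e)) has_sum t) hbasis"
  proof (rule has_sum_Sigma'[where B = "\<lambda>_. N"])
    show "((\<lambda>(e, n). u n e) has_sum t) (hbasis \<times> N)"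
      using t by (subst (asm) has_sum_swap) (simp add: case_prod_unfold)
    fix e
    have "((\<lambda>n. cinner e (cinner (g n) (blinfun_apply B e) *\<^sub>C h n)) has_sum cinner e (blinfun_apply A (blinfun_apply B e))) N"
      by (intro has_sum_cinner_right nuclear_repD(3)[OF rep])
    then show "((\<lambda>n. case (e, n) of (e, n) \<Rightarrow> u n e) has_sum cinner e (blinfun_apply (A o\<^sub>L B) e)) N"
      by (simp add: u_def cinner_scaleC_right)
  qed
  then have "op_trace (A o\<^sub>L B) = t"
    unfolding op_trace_def trace_on_def by (rule infsumI)
  ultimately show ?thesis
    by simp
qed


section \<open>Sums over tuples\<close>

lemma has_sum_product_nonneg:
  fixes f :: "'i \<Rightarrow> real" and g :: "'j \<Rightarrow> real"
  assumes f: "(f has_sum a) A" and g: "(g has_sum b) B"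
    and f0: "\<And>x. x \<in> A \<Longrightarrow> 0 \<le> f x" and g0: "\<And>y. y \<in> B \<Longrightarrow> 0 \<le> g y"
  shows "((\<lambda>(x, y). f x * g y) has_sum a * b) (A \<times> B)"
proof (rule has_sum_SigmaI)
  show 1: "((\<lambda>y. case (x, y) of (x, y) \<Rightarrow> f x * g y) has_sum f x * b) B" if "x \<in> A" for x
    unfolding case_prod_conv by (rule has_sum_cmult_right[OF g])
  show 2: "((\<lambda>x. f x * b) has_sum a * b) A"
    by (rule has_sum_cmult_left[OF f])
  show "(\<lambda>(x, y). f x * g y) summable_on A \<times> B"
    by (rule summable_on_SigmaI[OF 1]) (use 2 f0 g0 in \<open>auto simp: summable_on_def\<close>)
qed

definition tuples :: "nat \<Rightarrow> 'i set \<Rightarrow> 'i list set"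
  where "tuples k N = {ns. length ns = k \<and> set ns \<subseteq> N}"

lemma basis_tuples_eq: "basis_tuples k = tuples k hbasis"
  by (simp add: basis_tuples_def tuples_def)

lemma tuples_0 [simp]: "tuples 0 N = {[]}"
  by (auto simp: tuples_def)

text \<open>The new entry goes to the end because the determinants below are expanded along their
  last row.\<close>

lemma bij_betw_tuples_snoc: "bij_betw (\<lambda>(n, ns). ns @ [n]) (N \<times> tuples k N) (tuples (Suc k) N)"
proof (rule bij_betwI[where g = "\<lambda>ns. (last ns, butlast ns)"])
  show "(\<lambda>ns. (last ns, butlast ns)) \<in> tuples (Suc k) N \<rightarrow> N \<times> tuples k N"
  proof
    fix ns assume ns: "ns \<in> tuples (Suc k) N"
    then have "ns \<noteq> []"
      by (auto simp: tuples_def)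
    then show "(last ns, butlast ns) \<in> N \<times> tuples k N"
      using ns by (auto simp: tuples_def dest: in_set_butlastD)
  qed
  show "(case (last y, butlast y) of (n, ns) \<Rightarrow> ns @ [n]) = y" if "y \<in> tuples (Suc k) N" for y
  proof -
    have "y \<noteq> []"
      using that by (auto simp: tuples_def)
    then show ?thesis by simp
  qed
qed (auto simp: tuples_def)

lemma has_sum_tuples_Suc:
  "(f has_sum s) (tuples (Suc k) N) \<longleftrightarrow> ((\<lambda>(n, ns). f (ns @ [n])) has_sum s) (N \<times> tuples k N)"
  using has_sum_reindex_bij_betw[OF bij_betw_tuples_snoc, where f = f and S = s]
  by (simp add: case_prod_unfold)

lemma summable_on_tuples_Suc:
  "f summable_on (tuples (Suc k) N) \<longleftrightarrow> (\<lambda>(n, ns). f (ns @ [n])) summable_on (N \<times> tuples k N)"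
  unfolding summable_on_def has_sum_tuples_Suc ..

lemma has_sum_tuples_weight:
  fixes W :: "'v \<Rightarrow> 'i \<Rightarrow> real"
  assumes "\<And>v. v \<in> set vs \<Longrightarrow> (W v has_sum w v) N" and nonneg: "\<And>v n. 0 \<le> W v n"
  shows "((\<lambda>ns. prod_list (map2 W vs ns)) has_sum prod_list (map w vs)) (tuples (length vs) N)"
  using assms(1)
proof (induction vs rule: rev_induct)
  case Nil
  show ?case by (rule has_sum_finiteI) auto
next
  case (snoc v vs)
  have "((\<lambda>(n, ns). W v n * prod_list (map2 W vs ns)) has_sum w v * prod_list (map w vs)) (N \<times> tuples (length vs) N)"
    by (rule has_sum_product_nonneg) (use snoc nonneg in \<open>auto intro!: prod_list_nonneg\<close>)
  then have "((\<lambda>(n, ns). prod_list (map2 W (vs @ [v]) (ns @ [n]))) has_sum w v * prod_list (map w vs)) (N \<times> tuples (length vs) N)"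
    by (rule has_sum_cong[THEN iffD1, rotated]) (auto simp: tuples_def)
  then show ?case
    by (simp add: has_sum_tuples_Suc mult.commute)
qed

lemma has_sum_tuples_power:
  fixes w :: "'i \<Rightarrow> real"
  assumes "(w has_sum a) N" and nonneg: "\<And>n. 0 \<le> w n"
  shows "((\<lambda>ns. prod_list (map w ns)) has_sum a ^ k) (tuples k N)"
proof -
  have "((\<lambda>ns. prod_list (map2 (\<lambda>_. w) (replicate k ()) ns)) has_sum prod_list (map (\<lambda>_. a) (replicate k ())))
      (tuples (length (replicate k ())) N)"
    by (rule has_sum_tuples_weight) (use assms in auto)
  then have "((\<lambda>ns. prod_list (map2 (\<lambda>_. w) (replicate k ()) ns)) has_sum a ^ k) (tuples k N)"
    by (simp add: prod_list_replicate)
  then show ?thesis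
    by (rule has_sum_cong[THEN iffD1, rotated]) (auto simp: tuples_def zip_replicate1 o_def)
qed

text \<open>Iterated expansion of a function of several vectors, one slot after the other. Only the joint
  sum is required to converge absolutely, the expansions of the single slots need not.\<close>

lemma has_sum_multi_expand:
  fixes F :: "'a list \<Rightarrow> complex" and K :: "'v \<Rightarrow> 'i \<Rightarrow> complex"
  assumes slot: "\<And>us v ws. length us + length ws < k \<Longrightarrow>
      ((\<lambda>n. K v n * F (us @ u n # ws)) has_sum F (us @ \<tau> v # ws)) N"
    and "length vs + length ws = k"
    and "(\<lambda>ns. prod_list (map2 K vs ns) * F (map u ns @ ws)) summable_on tuples (length vs) N"
  shows "((\<lambda>ns. prod_list (map2 K vs ns) * F (map u ns @ ws)) has_sum F (map \<tau> vs @ ws)) (tuples (length vs) N)"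
  using assms(2,3)
proof (induction vs arbitrary: ws rule: rev_induct)
  case Nil
  show ?case by (rule has_sum_finiteI) auto
next
  case (snoc v vs)
  let ?f = "\<lambda>ns. prod_list (map2 K (vs @ [v]) ns) * F (map u ns @ ws)"
  have eq: "?f (ns @ [n]) = K v n * (prod_list (map2 K vs ns) * F (map u ns @ u n # ws))"
    if "ns \<in> tuples (length vs) N" for n ns
    using that by (simp add: tuples_def mult_ac)
  have "(\<lambda>(n, ns). ?f (ns @ [n])) summable_on N \<times> tuples (length vs) N"
    using snoc.prems(2) by (simp only: length_append_singleton summable_on_tuples_Suc)
  then obtain t where t: "((\<lambda>(n, ns). ?f (ns @ [n])) has_sum t) (N \<times> tuples (length vs) N)"
    by (auto simp: summable_on_def)
  have inner: "((\<lambda>ns. ?f (ns @ [n])) has_sum K v n * F (map \<tau> vs @ u n # ws)) (tuples (length vs) N)"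
    if n: "n \<in> N" for n
  proof -
    have "(\<lambda>ns. ?f (ns @ [n])) summable_on tuples (length vs) N"
      using summable_on_SigmaD1[of "\<lambda>n ns. ?f (ns @ [n])" N "\<lambda>_. tuples (length vs) N" n] t n
      by (auto simp: summable_on_def)
    then have sl: "(\<lambda>ns. K v n * (prod_list (map2 K vs ns) * F (map u ns @ u n # ws))) summable_on tuples (length vs) N"
      by (rule summable_on_cong[THEN iffD1, rotated]) (rule eq)
    have "((\<lambda>ns. K v n * (prod_list (map2 K vs ns) * F (map u ns @ u n # ws)))
        has_sum K v n * F (map \<tau> vs @ u n # ws)) (tuples (length vs) N)"
    proof (cases "K v n = 0")
      case False
      then have "(\<lambda>ns. prod_list (map2 K vs ns) * F (map u ns @ u n # ws)) summable_on tuples (length vs) N"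
        using sl by (simp add: summable_on_cmult_right')
      then show ?thesis
        using snoc.prems(1) by (intro has_sum_cmult_right snoc.IH) auto
    qed simp
    then show ?thesis
      by (rule has_sum_cong[THEN iffD1, rotated]) (rule eq[symmetric])
  qed
  have "((\<lambda>n. K v n * F (map \<tau> vs @ u n # ws)) has_sum t) N"
    by (rule has_sum_Sigma'[OF t]) (use inner in simp)
  moreover have "((\<lambda>n. K v n * F (map \<tau> vs @ u n # ws)) has_sum F (map \<tau> vs @ \<tau> v # ws)) N"
    using snoc.prems(1) by (intro slot) auto
  ultimately have "t = F (map \<tau> vs @ \<tau> v # ws)"
    by (rule has_sum_unique)
  then show ?case
    using t by (simp only: length_append_singleton has_sum_tuples_Suc map_append append_assoc) simp
qed


section \<open>Exterior powers\<close>

lemma ext_powerD: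
  assumes "\<phi> \<in> ext_power k"
  shows "length ys \<noteq> k \<Longrightarrow> \<phi> ys = 0"
    and "length us + length ws < k \<Longrightarrow> length us + length ws + 1 = k \<Longrightarrow>
      \<phi> (us @ (x + y) # ws) = \<phi> (us @ x # ws) + \<phi> (us @ y # ws)"
    and "length us + length ws + 1 = k \<Longrightarrow> \<phi> (us @ (c *\<^sub>C x) # ws) = cnj c * \<phi> (us @ x # ws)"
    and "\<not> distinct ys \<Longrightarrow> \<phi> ys = 0"
    and "(\<lambda>bs. (cmod (\<phi> bs))\<^sup>2) summable_on tuples k hbasis"
proof -
  have add: "\<And>ys i x y. length ys = k \<and> i < k \<Longrightarrow> \<phi> (ys[i := x + y]) = \<phi> (ys[i := x]) + \<phi> (ys[i := y])"
    and scale: "\<And>ys i c x. length ys = k \<and> i < k \<Longrightarrow> \<phi> (ys[i := c *\<^sub>C x]) = cnj c * \<phi> (ys[i := x])"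
    using assms unfolding ext_power_def by blast+
  show "length us + length ws < k \<Longrightarrow> length us + length ws + 1 = k \<Longrightarrow>
      \<phi> (us @ (x + y) # ws) = \<phi> (us @ x # ws) + \<phi> (us @ y # ws)"
    using add[of "us @ x # ws" "length us" x y] by simp
  show "length us + length ws + 1 = k \<Longrightarrow> \<phi> (us @ (c *\<^sub>C x) # ws) = cnj c * \<phi> (us @ x # ws)"
    using scale[of "us @ x # ws" "length us" c x] by simp
  show 1: "length ys \<noteq> k \<Longrightarrow> \<phi> ys = 0"
    using assms unfolding ext_power_def by blast
  show "\<not> distinct ys \<Longrightarrow> \<phi> ys = 0"
    using assms 1 unfolding ext_power_def by (cases "length ys = k") blast+
  show "(\<lambda>bs. (cmod (\<phi> bs))\<^sup>2) summable_on tuples k hbasis"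
    using assms unfolding ext_power_def basis_tuples_eq by blast
qed

lemma ext_power_bound:
  assumes "\<phi> \<in> ext_power k"
  obtains C where "0 \<le> C" "\<And>ys. cmod (\<phi> ys) \<le> C * prod_list (map norm ys)"
proof -
  obtain C where C: "\<And>ys. length ys = k \<Longrightarrow> cmod (\<phi> ys) \<le> C * prod_list (map norm ys)"
    using assms unfolding ext_power_def by blast
  have "cmod (\<phi> ys) \<le> \<bar>C\<bar> * prod_list (map norm ys)" for ys
  proof (cases "length ys = k")
    case True
    have "C * prod_list (map norm ys) \<le> \<bar>C\<bar> * prod_list (map norm ys)"
      by (intro mult_right_mono prod_list_nonneg) auto
    then show ?thesis
      using C[OF True] by linarith
  next
    case False
    then show ?thesis
      using ext_powerD(1)[OF assms] by (auto intro!: mult_nonneg_nonneg prod_list_nonneg)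
  qed
  then show ?thesis
    using that[of "\<bar>C\<bar>"] by simp
qed

lemma ext_power_slot_bounded_linear:
  assumes \<phi>: "\<phi> \<in> ext_power k" and len: "length us + length ws + 1 = k"
  shows "bounded_linear (\<lambda>x. \<phi> (us @ x # ws))"
proof -
  obtain C where C: "0 \<le> C" "\<And>ys. cmod (\<phi> ys) \<le> C * prod_list (map norm ys)"
    using ext_power_bound[OF \<phi>] by blast
  show ?thesis
  proof (rule bounded_linear_intro)
    show "\<phi> (us @ (x + y) # ws) = \<phi> (us @ x # ws) + \<phi> (us @ y # ws)" for x y
      using ext_powerD(2)[OF \<phi>] len by simp
    show "\<phi> (us @ (r *\<^sub>R x) # ws) = r *\<^sub>R \<phi> (us @ x # ws)" for r x
      using ext_powerD(3)[OF \<phi> len, of "complex_of_real r" x]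
      by (simp add: scaleR_scaleC[where 'a='a] scaleR_conv_of_real)
    show "cmod (\<phi> (us @ x # ws)) \<le> norm x * (C * prod_list (map norm us) * prod_list (map norm ws))" for x
      using C(2)[of "us @ x # ws"] by (simp add: mult_ac)
  qed
qed

lemma ext_power_slot_has_sum:
  assumes \<phi>: "\<phi> \<in> ext_power k" and len: "length us + length ws + 1 = k"
    and sum: "((\<lambda>n. c n *\<^sub>C u n) has_sum x) N"
  shows "((\<lambda>n. cnj (c n) * \<phi> (us @ u n # ws)) has_sum \<phi> (us @ x # ws)) N"
  using has_sum_bounded_linear[OF ext_power_slot_bounded_linear[OF \<phi> len] sum]
  by (simp add: ext_powerD(3)[OF \<phi> len])

text \<open>The definition asks only that forms vanish on repeated arguments; antisymmetry comes
  from placing the sum of the two arguments in both slots and expanding.\<close>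

lemma ext_power_swap:
  assumes \<phi>: "\<phi> \<in> ext_power k" and ij: "i < length ys" "j < length ys" "i \<noteq> j"
  shows "\<phi> (ys[i := ys ! j, j := ys ! i]) = - \<phi> ys"
proof (cases "length ys = k")
  case True
  have add: "\<phi> (zs[l := x + y]) = \<phi> (zs[l := x]) + \<phi> (zs[l := y])" if "length zs = k" "l < k" for zs l x y
    using \<phi> that unfolding ext_power_def by blast
  define z where "z a b = \<phi> (ys[i := a, j := b])" for a b
  have z0: "z a a = 0" for a
  proof -
    have "\<not> distinct (ys[i := a, j := a])"
      using ij nth_eq_iff_index_eq[of "ys[i := a, j := a]" i j] by (auto simp: nth_list_update)
    then show ?thesis
      unfolding z_def by (rule ext_powerD(4)[OF \<phi>])
  qed
  have "z (a + b) c = z a c + z b c" for a b c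
    unfolding z_def list_update_swap[OF ij(3)] using ij True by (intro add) auto
  moreover have "z c (a + b) = z c a + z c b" for a b c
    unfolding z_def using ij True by (intro add) auto
  ultimately have "z (ys ! i + ys ! j) (ys ! i + ys ! j)
      = z (ys ! i) (ys ! i) + z (ys ! j) (ys ! i) + (z (ys ! i) (ys ! j) + z (ys ! j) (ys ! j))"
    by (simp only:)
  then have "z (ys ! j) (ys ! i) + z (ys ! i) (ys ! j) = 0"
    unfolding z0 by simp
  moreover have "z (ys ! i) (ys ! j) = \<phi> ys"
    by (simp add: z_def)
  ultimately show ?thesis
    unfolding z_def by (simp add: eq_neg_iff_add_eq_0)
next
  case False
  then show ?thesis
    using ext_powerD(1)[OF \<phi>] by simp
qed

lemma permute_list_transpose:
  assumes "i < length ys" "j < length ys"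
  shows "permute_list (Transposition.transpose i j) ys = ys[i := ys ! j, j := ys ! i]"
  by (rule nth_equalityI) (use assms in \<open>auto simp: permute_list_def nth_list_update Transposition.transpose_def\<close>)

lemma ext_power_permute:
  assumes \<phi>: "\<phi> \<in> ext_power k" and p: "p permutes {..<length ys}"
  shows "\<phi> (permute_list p ys) = of_int (sign p) * \<phi> ys"
proof -
  have "\<forall>zs. length zs = length ys \<longrightarrow> \<phi> (permute_list p zs) = of_int (sign p) * \<phi> zs"
    using p finite_lessThan
  proof (induction p rule: permutes_induct)
    case id
    then show ?case by (simp add: sign_id)
  next
    case (swap a b p)
    show ?case
    proof (intro allI impI)
      fix zs :: "'a list" assume len: "length zs = length ys"
      have "permute_list (Transposition.transpose a b \<circ> p) zs = permute_list p (permute_list (Transposition.transpose a b) zs)"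
        using swap len by (intro permute_list_compose) simp
      then have "\<phi> (permute_list (Transposition.transpose a b \<circ> p) zs) = of_int (sign p) * \<phi> (permute_list (Transposition.transpose a b) zs)"
        using swap len by simp
      also have "\<phi> (permute_list (Transposition.transpose a b) zs) = - \<phi> zs"
        using ext_power_swap[OF \<phi>, of a zs b] permute_list_transpose[of a zs b] swap len by simp
      also have "of_int (sign p) * - \<phi> zs = of_int (sign (Transposition.transpose a b \<circ> p)) * \<phi> zs"
      proof -
        have "permutation p"
          using swap permutation_permutes by blast
        then show ?thesis
          using swap by (simp add: sign_compose sign_swap_id permutation_swap_id)
      qed
      finally show "\<phi> (permute_list (Transposition.transpose a b \<circ> p) zs) = of_int (sign (Transposition.transpose a b \<circ> p)) * \<phi> zs" .
    qed
  qed
  then show ?thesis by simp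
qed

lemma abs_of_int_sign [simp]: "\<bar>real_of_int (sign p)\<bar> = 1"
  by (simp add: sign_def)

lemma prod_list_map2_nth:
  "length xs = length ys \<Longrightarrow> prod_list (map2 f xs ys) = (\<Prod>i<length xs. f (xs ! i) (ys ! i))"
  by (simp add: prod.list_conv_set_nth atLeast0LessThan)

lemma wedge_permute_right:
  assumes "length ys = length xs"
  shows "wedge xs ys = (\<Sum>p | p permutes {..<length xs}. of_int (sign p) * prod_list (map2 cinner ys (permute_list p xs)))"
  unfolding wedge_def using assms
  by (auto intro!: sum.cong prod.cong simp: prod_list_map2_nth permute_list_nth)

lemma prod_list_map_permute:
  fixes f :: "'b \<Rightarrow> 'c::comm_monoid_mult"
  assumes "p permutes {..<length xs}"
  shows "prod_list (map f (permute_list p xs)) = prod_list (map f xs)"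
  using arg_cong[OF mset_permute_list[OF assms], of "\<lambda>M. prod_mset (image_mset f M)"]
  by (simp add: prod_mset_prod_list flip: mset_map)

lemma cmod_prod_list_cinner_le:
  "length ys = length xs \<Longrightarrow>
    cmod (prod_list (map2 cinner ys xs)) \<le> prod_list (map norm xs) * prod_list (map norm ys)"
proof (induction ys xs rule: list_induct2)
  case (Cons y ys x xs)
  have "cmod (cinner y x) * cmod (prod_list (map2 cinner ys xs))
      \<le> (norm y * norm x) * (prod_list (map norm xs) * prod_list (map norm ys))"
    by (intro mult_mono Cons.IH norm_cinner_le) (auto intro!: prod_list_nonneg mult_nonneg_nonneg)
  then show ?case
    by (simp add: norm_mult mult_ac)
qed simp

text \<open>The crude bound with one term for each permutation. It serves boundedness and
  summability in a fixed degree; the estimates that are summed over the degree use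
  \<open>hadamard\<close>.\<close>

lemma wedge_bound:
  assumes "length ys = length xs"
  shows "cmod (wedge xs ys) \<le> fact (length xs) * prod_list (map norm xs) * prod_list (map norm ys)"
proof -
  let ?P = "{p. p permutes {..<length xs}}"
  have "cmod (wedge xs ys) \<le> (\<Sum>p\<in>?P. cmod (prod_list (map2 cinner ys (permute_list p xs))))"
    unfolding wedge_permute_right[OF assms]
    by (rule order_trans[OF norm_sum]) (simp add: norm_mult)
  also have "\<dots> \<le> (\<Sum>p\<in>?P. prod_list (map norm xs) * prod_list (map norm ys))"
  proof (rule sum_mono)
    fix p assume "p \<in> ?P"
    then show "cmod (prod_list (map2 cinner ys (permute_list p xs))) \<le> prod_list (map norm xs) * prod_list (map norm ys)"
      using cmod_prod_list_cinner_le[of ys "permute_list p xs"] prod_list_map_permute[of p xs norm] assms by simp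
  qed
  also have "\<dots> = fact (length xs) * prod_list (map norm xs) * prod_list (map norm ys)"
    by (simp add: card_permutations)
  finally show ?thesis .
qed

lemma prod_list_map2_cmod: "(cmod (prod_list (map2 f xs ys)))\<^sup>2 = prod_list (map2 (\<lambda>x y. (cmod (f x y))\<^sup>2) xs ys)"
proof (induction xs arbitrary: ys)
  case (Cons x xs)
  then show ?case by (cases ys) (simp_all add: norm_mult power_mult_distrib)
qed simp

lemma has_sum_basis_tuples_prod:
  "((\<lambda>bs. (cmod (prod_list (map2 cinner xs bs)))\<^sup>2) has_sum prod_list (map (\<lambda>x. (norm x)\<^sup>2) xs)) (tuples (length xs) hbasis)"
  unfolding prod_list_map2_cmod
  by (rule has_sum_tuples_weight) (subst cmod_cinner_commute, auto intro: parseval)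

lemma wedge_in_ext_power: "wedge xs \<in> ext_power (length xs)"
  unfolding ext_power_def mem_Collect_eq
proof (intro conjI allI impI)
  let ?k = "length xs"
  let ?P = "{p. p permutes {..<?k}}"
  have upd: "(\<Prod>j<?k. cinner (ys[i := x] ! j) (xs ! p j)) = cinner x (xs ! p i) * (\<Prod>j\<in>{..<?k} - {i}. cinner (ys ! j) (xs ! p j))"
    if "length ys = ?k" "i < ?k" for ys i x p
    using that by (subst prod.remove[of _ i]) (auto intro!: prod.cong)
  fix ys :: "'a list"
  show "length ys \<noteq> ?k \<Longrightarrow> wedge xs ys = 0"
    by (simp add: wedge_def)
  show "wedge xs (ys[i := x + y]) = wedge xs (ys[i := x]) + wedge xs (ys[i := y])" if "length ys = ?k \<and> i < ?k" for i x y
    using that by (simp add: wedge_def upd cinner_add_left algebra_simps sum.distrib)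
  show "wedge xs (ys[i := c *\<^sub>C x]) = cnj c * wedge xs (ys[i := x])" if "length ys = ?k \<and> i < ?k" for i c x
    using that by (simp add: wedge_def upd cinner_scaleC_left sum_distrib_left mult_ac)
  show "wedge xs ys = 0" if "length ys = ?k \<and> \<not> distinct ys"
  proof -
    from that obtain i j where ij: "i < ?k" "j < ?k" "i \<noteq> j" "ys ! i = ys ! j"
      by (auto simp: distinct_conv_nth)
    let ?t = "Transposition.transpose i j"
    have t: "?t permutes {..<?k}"
      using ij by (intro permutes_swap_id) auto
    let ?f = "\<lambda>p. of_int (sign p) * (\<Prod>i<?k. cinner (ys ! i) (xs ! p i))"
    \<comment> \<open>Exchanging the two equal arguments leaves the product unchanged and reverses
      the sign, so the sum over all permutations equals its own negative.\<close>
    have "?f (p \<circ> ?t) = - ?f p" if "p \<in> ?P" for p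
    proof -
      have "permutation p"
        using that permutation_permutes by blast
      then have s: "sign (p \<circ> ?t) = - sign p"
        using ij by (simp add: sign_compose sign_swap_id permutation_swap_id)
      have "(\<Prod>m<?k. cinner (ys ! m) (xs ! p m)) = (\<Prod>m<?k. cinner (ys ! ?t m) (xs ! p (?t m)))"
        using prod.permute[OF t, of "\<lambda>m. cinner (ys ! m) (xs ! p m)"] by (simp add: o_def)
      also have "\<dots> = (\<Prod>m<?k. cinner (ys ! m) (xs ! p (?t m)))"
        using ij(4) by (intro prod.cong) (auto simp: Transposition.transpose_def)
      finally show ?thesis
        by (simp add: s)
    qed
    then have "(\<Sum>p\<in>?P. ?f (p \<circ> ?t)) = - (\<Sum>p\<in>?P. ?f p)"
      by (simp add: sum_negf)
    then have "(\<Sum>p\<in>?P. ?f p) = - (\<Sum>p\<in>?P. ?f p)"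
      using sum_permutations_compose_right[OF t, of ?f] by simp
    then show ?thesis
      using that by (simp add: wedge_def)
  qed
  show "\<exists>C. \<forall>ys. length ys = ?k \<longrightarrow> cmod (wedge xs ys) \<le> C * prod_list (map norm ys)"
    using wedge_bound by blast
  show "(\<lambda>bs. (cmod (wedge xs bs))\<^sup>2) summable_on basis_tuples ?k"
    unfolding basis_tuples_eq
  proof (rule summable_on_comparison_test)
    have "(\<lambda>bs. (cmod (prod_list (map2 cinner bs (permute_list p xs))))\<^sup>2) summable_on tuples ?k hbasis" for p
    proof -
      have "(cmod (prod_list (map2 cinner bs zs)))\<^sup>2 = (cmod (prod_list (map2 cinner zs bs)))\<^sup>2" for bs zs :: "'a list"
        unfolding prod_list_map2_cmod by (subst zip_commute) (simp add: case_prod_unfold o_def cmod_cinner_commute)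
      then show ?thesis
        using has_sum_basis_tuples_prod[of "permute_list p xs"] by (auto simp: summable_on_def)
    qed
    then show "(\<lambda>bs. (\<Sum>p\<in>?P. (cmod (prod_list (map2 cinner bs (permute_list p xs))))\<^sup>2) * card ?P) summable_on tuples ?k hbasis"
      by (intro summable_on_cmult_left has_sum_imp_summable[OF has_sum_finite_sum[OF has_sum_infsum]])
    fix bs assume "bs \<in> tuples ?k (hbasis :: 'a set)"
    then have len: "length bs = ?k" by (simp add: tuples_def)
    have "cmod (wedge xs bs) \<le> (\<Sum>p\<in>?P. cmod (prod_list (map2 cinner bs (permute_list p xs))))"
      unfolding wedge_permute_right[OF len]
      by (rule order_trans[OF norm_sum]) (simp add: norm_mult)
    then have "(cmod (wedge xs bs))\<^sup>2 \<le> (\<Sum>p\<in>?P. cmod (prod_list (map2 cinner bs (permute_list p xs))))\<^sup>2"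
      by (intro power_mono) auto
    also have "\<dots> \<le> (\<Sum>p\<in>?P. (cmod (prod_list (map2 cinner bs (permute_list p xs))))\<^sup>2) * card ?P"
      by (rule sum_squared_le_sum_of_squares)
    finally show "(cmod (wedge xs bs))\<^sup>2 \<le> (\<Sum>p\<in>?P. (cmod (prod_list (map2 cinner bs (permute_list p xs))))\<^sup>2) * card ?P" .
  qed simp
qed

text \<open>All slots are expanded in the basis at once. Slotwise convergence comes from boundedness
  of the form; joint convergence comes from the Hilbert-Schmidt condition in
  \<open>ext_power\<close>, as a product of two square-summable families.\<close>

lemma ext_power_tensor_expand:
  assumes \<phi>: "\<phi> \<in> ext_power k" and len: "length vs = k"
  shows "((\<lambda>bs. prod_list (map2 cinner vs bs) * \<phi> bs) has_sum \<phi> vs) (tuples k hbasis)"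
proof -
  have "(\<lambda>bs. prod_list (map2 cinner vs bs) * \<phi> bs) summable_on tuples k hbasis"
  proof (rule abs_summable_summable[OF Infinite_Sum.abs_summable_on_comparison_test'])
    show "(\<lambda>bs. (cmod (prod_list (map2 cinner vs bs)))\<^sup>2 + (cmod (\<phi> bs))\<^sup>2) summable_on tuples k hbasis"
      using has_sum_basis_tuples_prod[of vs] ext_powerD(5)[OF \<phi>] len
      by (intro summable_on_add) (auto simp: summable_on_def)
    show "cmod (prod_list (map2 cinner vs bs) * \<phi> bs) \<le> (cmod (prod_list (map2 cinner vs bs)))\<^sup>2 + (cmod (\<phi> bs))\<^sup>2" for bs
      using mult_le_half_squares[of "cmod (prod_list (map2 cinner vs bs))" "cmod (\<phi> bs)"]
      by (simp add: norm_mult) (smt (verit) zero_le_power2)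
  qed
  then have "((\<lambda>bs. prod_list (map2 cinner vs bs) * \<phi> (map id bs @ [])) has_sum \<phi> (map id vs @ [])) (tuples (length vs) hbasis)"
  proof (intro has_sum_multi_expand[where k = k])
    fix us ws :: "'a list" and v assume l: "length us + length ws < k"
    show "((\<lambda>n. cinner v n * \<phi> (us @ id n # ws)) has_sum \<phi> (us @ id v # ws)) hbasis"
    proof (cases "length us + length ws + 1 = k")
      case True
      then show ?thesis
        using ext_power_slot_has_sum[OF \<phi> True hbasis_expansion[of v]] by (simp flip: cinner_commute)
    next
      case False
      then show ?thesis
        using ext_powerD(1)[OF \<phi>] by simp
    qed
  qed (use len in auto)
  then show ?thesis
    using len by simp
qed

lemma map2_cinner_cnj: "cnj (prod_list (map2 cinner bs zs)) = prod_list (map2 cinner zs bs)"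
proof (induction bs arbitrary: zs)
  case (Cons b bs)
  then show ?case by (cases zs) (simp_all flip: cinner_commute)
qed simp

text \<open>The reproducing property of the form model: pairing with a decomposable form is
  evaluation. Each of the k! permutations contributes the same value, because its sign occurs once
  in the wedge and once in the form, and the normalisation of \<open>ext_inner\<close> removes the
  k!.\<close>

lemma ext_inner_wedge:
  assumes \<phi>: "\<phi> \<in> ext_power k" and len: "length ys = k"
  shows "((\<lambda>bs. cnj (wedge ys bs) * \<phi> bs) has_sum (fact k * \<phi> ys)) (tuples k hbasis)"
    and "ext_inner k (wedge ys) \<phi> = \<phi> ys"
proof -
  let ?P = "{p. p permutes {..<k}}"
  have "((\<lambda>bs. \<Sum>p\<in>?P. of_int (sign p) * (prod_list (map2 cinner (permute_list p ys) bs) * \<phi> bs))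
      has_sum (\<Sum>p\<in>?P. of_int (sign p) * \<phi> (permute_list p ys))) (tuples k hbasis)"
    by (intro has_sum_finite_sum has_sum_cmult_right ext_power_tensor_expand[OF \<phi>]) (simp add: len)
  also have "(\<Sum>p\<in>?P. of_int (sign p) * \<phi> (permute_list p ys)) = (\<Sum>p\<in>?P. \<phi> ys)"
    using ext_power_permute[OF \<phi>] len
    by (intro sum.cong) (auto simp flip: mult.assoc of_int_mult)
  also have "\<dots> = fact k * \<phi> ys"
    by (simp add: card_permutations)
  finally show 1: "((\<lambda>bs. cnj (wedge ys bs) * \<phi> bs) has_sum (fact k * \<phi> ys)) (tuples k hbasis)"
  proof (rule has_sum_cong[THEN iffD1, rotated])
    fix bs assume "bs \<in> tuples k (hbasis :: 'a set)"
    then have l: "length bs = length ys"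
      using len by (simp add: tuples_def)
    show "(\<Sum>p\<in>?P. of_int (sign p) * (prod_list (map2 cinner (permute_list p ys) bs) * \<phi> bs)) = cnj (wedge ys bs) * \<phi> bs"
      unfolding wedge_permute_right[OF l] using len by (simp add: map2_cinner_cnj sum_distrib_right mult.assoc)
  qed
  show "ext_inner k (wedge ys) \<phi> = \<phi> ys"
    using 1 unfolding ext_inner_def basis_tuples_eq by (simp add: infsumI)
qed


subsection \<open>Hilbert bases of the exterior powers\<close>

lemma ext_power_update:
  assumes "\<phi> \<in> ext_power k" "length ys = k" "i < k"
  shows "\<phi> (ys[i := x + y]) = \<phi> (ys[i := x]) + \<phi> (ys[i := y])"
    and "\<phi> (ys[i := c *\<^sub>C x]) = cnj c * \<phi> (ys[i := x])"
  using assms unfolding ext_power_def by blast+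

lemma ext_power_lincomb:
  fixes \<phi> \<psi> :: "'a::complex_hilbert_space list \<Rightarrow> complex"
  assumes \<phi>: "\<phi> \<in> ext_power k" and \<psi>: "\<psi> \<in> ext_power k"
  shows "(\<lambda>ys. \<phi> ys + c * \<psi> ys) \<in> ext_power k"
proof -
  obtain C1 where C1: "\<And>ys. cmod (\<phi> ys) \<le> C1 * prod_list (map norm ys)"
    using ext_power_bound[OF \<phi>] by metis
  obtain C2 where C2: "\<And>ys. cmod (\<psi> ys) \<le> C2 * prod_list (map norm ys)"
    using ext_power_bound[OF \<psi>] by metis
  have "cmod (\<phi> ys + c * \<psi> ys) \<le> (C1 + cmod c * C2) * prod_list (map norm ys)" for ys
  proof -
    have "cmod (\<phi> ys + c * \<psi> ys) \<le> cmod (\<phi> ys) + cmod c * cmod (\<psi> ys)"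
      by (metis norm_mult norm_triangle_ineq)
    also have "\<dots> \<le> C1 * prod_list (map norm ys) + cmod c * (C2 * prod_list (map norm ys))"
      by (intro add_mono mult_left_mono C1 C2) simp
    finally show ?thesis
      by (simp add: algebra_simps)
  qed
  then have bound: "\<exists>C. \<forall>ys. length ys = k \<longrightarrow> cmod (\<phi> ys + c * \<psi> ys) \<le> C * prod_list (map norm ys)"
    by blast
  have summ: "(\<lambda>bs. (cmod (\<phi> bs + c * \<psi> bs))\<^sup>2) summable_on basis_tuples k"
  proof (rule summable_on_comparison_test)
    show "(\<lambda>bs. 2 * (cmod (\<phi> bs))\<^sup>2 + 2 * (cmod c)\<^sup>2 * (cmod (\<psi> bs))\<^sup>2) summable_on basis_tuples k"
      unfolding basis_tuples_eq
      by (intro summable_on_add summable_on_cmult_right ext_powerD(5) \<phi> \<psi>)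
    fix bs
    have "(cmod (\<phi> bs + c * \<psi> bs))\<^sup>2 \<le> (cmod (\<phi> bs) + cmod c * cmod (\<psi> bs))\<^sup>2"
      by (rule power_mono) (metis norm_mult norm_triangle_ineq, simp)
    also have "\<dots> \<le> 2 * (cmod (\<phi> bs))\<^sup>2 + 2 * (cmod c * cmod (\<psi> bs))\<^sup>2"
      using mult_le_half_squares[of "cmod (\<phi> bs)" "cmod c * cmod (\<psi> bs)"] by (simp add: power2_sum)
    finally show "(cmod (\<phi> bs + c * \<psi> bs))\<^sup>2 \<le> 2 * (cmod (\<phi> bs))\<^sup>2 + 2 * (cmod c)\<^sup>2 * (cmod (\<psi> bs))\<^sup>2"
      by (simp add: power_mult_distrib)
  qed simp
  have lin: "(\<phi> s + c * \<psi> s) = (\<phi> t + c * \<psi> t) + (\<phi> u + c * \<psi> u)"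
    if "\<phi> s = \<phi> t + \<phi> u" "\<psi> s = \<psi> t + \<psi> u" for s t u
    using that by (simp add: algebra_simps)
  have sc: "(\<phi> s + c * \<psi> s) = e * (\<phi> t + c * \<psi> t)"
    if "\<phi> s = e * \<phi> t" "\<psi> s = e * \<psi> t" for s t e
    using that by (simp add: algebra_simps)
  show ?thesis
    unfolding ext_power_def mem_Collect_eq
  proof (intro conjI allI impI bound[rule_format] summ)
    fix ys :: "'a list" and i x y
    assume l: "length ys = k \<and> i < k"
    show "\<phi> (ys[i := x + y]) + c * \<psi> (ys[i := x + y]) = \<phi> (ys[i := x]) + c * \<psi> (ys[i := x]) + (\<phi> (ys[i := y]) + c * \<psi> (ys[i := y]))"
      using l by (intro lin ext_power_update(1)[OF \<phi>] ext_power_update(1)[OF \<psi>]) auto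
  next
    fix ys :: "'a list" and i e x
    assume l: "length ys = k \<and> i < k"
    show "\<phi> (ys[i := e *\<^sub>C x]) + c * \<psi> (ys[i := e *\<^sub>C x]) = cnj e * (\<phi> (ys[i := x]) + c * \<psi> (ys[i := x]))"
      using l by (intro sc ext_power_update(2)[OF \<phi>] ext_power_update(2)[OF \<psi>]) auto
  qed (use ext_powerD(1)[OF \<phi>] ext_powerD(1)[OF \<psi>] ext_powerD(4)[OF \<phi>] ext_powerD(4)[OF \<psi>] bound in auto)
qed

lemma ext_inner_has_sum:
  assumes \<phi>: "\<phi> \<in> ext_power k" and \<psi>: "\<psi> \<in> ext_power k"
  shows "((\<lambda>bs. cnj (\<phi> bs) * \<psi> bs) has_sum (fact k * ext_inner k \<phi> \<psi>)) (tuples k hbasis)"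
proof -
  have "(\<lambda>bs. cnj (\<phi> bs) * \<psi> bs) summable_on tuples k hbasis"
  proof (rule abs_summable_summable[OF Infinite_Sum.abs_summable_on_comparison_test'])
    show "(\<lambda>bs. (cmod (\<phi> bs))\<^sup>2 + (cmod (\<psi> bs))\<^sup>2) summable_on tuples k hbasis"
      by (intro summable_on_add ext_powerD(5) \<phi> \<psi>)
    show "cmod (cnj (\<phi> bs) * \<psi> bs) \<le> (cmod (\<phi> bs))\<^sup>2 + (cmod (\<psi> bs))\<^sup>2" for bs
      using mult_le_half_squares[of "cmod (\<phi> bs)" "cmod (\<psi> bs)"]
      by (simp add: norm_mult) (smt (verit) zero_le_power2)
  qed
  then show ?thesis
    by (simp add: ext_inner_def basis_tuples_eq)
qed

lemma ext_inner_commute: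
  assumes \<phi>: "\<phi> \<in> ext_power k" and \<psi>: "\<psi> \<in> ext_power k"
  shows "ext_inner k \<psi> \<phi> = cnj (ext_inner k \<phi> \<psi>)"
proof -
  have "((\<lambda>bs. cnj (\<psi> bs) * \<phi> bs) has_sum (cnj (fact k * ext_inner k \<phi> \<psi>))) (tuples k hbasis)"
    using has_sum_cnj_iff[THEN iffD2, OF ext_inner_has_sum[OF \<phi> \<psi>]] by (simp add: mult.commute)
  then have "fact k * ext_inner k \<psi> \<phi> = cnj (fact k * ext_inner k \<phi> \<psi>)"
    using ext_inner_has_sum[OF \<psi> \<phi>] has_sum_unique by blast
  then show ?thesis
    by simp
qed

lemma ext_inner_lincomb:
  assumes \<phi>: "\<phi> \<in> ext_power k" and \<psi>: "\<psi> \<in> ext_power k" and \<eta>: "\<eta> \<in> ext_power k"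
  shows "ext_inner k \<eta> (\<lambda>ys. \<phi> ys + c * \<psi> ys) = ext_inner k \<eta> \<phi> + c * ext_inner k \<eta> \<psi>"
proof -
  have "((\<lambda>bs. cnj (\<eta> bs) * \<phi> bs + c * (cnj (\<eta> bs) * \<psi> bs))
      has_sum (fact k * ext_inner k \<eta> \<phi> + c * (fact k * ext_inner k \<eta> \<psi>))) (tuples k hbasis)"
    by (intro has_sum_add has_sum_cmult_right ext_inner_has_sum assms)
  then have "((\<lambda>bs. cnj (\<eta> bs) * (\<phi> bs + c * \<psi> bs))
      has_sum (fact k * ext_inner k \<eta> \<phi> + c * (fact k * ext_inner k \<eta> \<psi>))) (tuples k hbasis)"
    by (simp add: algebra_simps)
  then have "fact k * ext_inner k \<eta> (\<lambda>ys. \<phi> ys + c * \<psi> ys) = fact k * ext_inner k \<eta> \<phi> + c * (fact k * ext_inner k \<eta> \<psi>)"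
    using ext_inner_has_sum[OF \<eta> ext_power_lincomb[OF \<phi> \<psi>]] has_sum_unique by blast
  then have "fact k * ext_inner k \<eta> (\<lambda>ys. \<phi> ys + c * \<psi> ys) = fact k * (ext_inner k \<eta> \<phi> + c * ext_inner k \<eta> \<psi>)"
    by (simp add: algebra_simps)
  then show ?thesis
    by simp
qed

lemma wedge_orthonormal_self:
  assumes bs: "set bs \<subseteq> hbasis" "distinct bs"
  shows "wedge bs bs = 1"
proof -
  let ?P = "{p. p permutes {..<length bs}}"
  have "wedge bs bs = (\<Sum>p\<in>?P. of_int (sign p) * (\<Prod>i<length bs. cinner (bs ! i) (bs ! p i)))"
    by (simp add: wedge_def)
  also have "\<dots> = (\<Sum>p\<in>?P. if p = id then 1 else 0)"
  proof (rule sum.cong[OF refl])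
    fix p assume "p \<in> ?P"
    then have p: "p permutes {..<length bs}" by simp
    have c: "cinner (bs ! i) (bs ! p i) = (if p i = i then 1 else 0)" if "i < length bs" for i
    proof -
      have "p i < length bs"
        using permutes_in_image[OF p, of i] that by simp
      then show ?thesis
        using that bs by (auto simp: cinner_hbasis subset_iff nth_eq_iff_index_eq)
    qed
    show "of_int (sign p) * (\<Prod>i<length bs. cinner (bs ! i) (bs ! p i)) = (if p = id then 1 else 0)"
    proof (cases "p = id")
      case False
      then obtain i where "p i \<noteq> i"
        by (auto simp: fun_eq_iff)
      moreover then have "i < length bs"
        using p by (meson lessThan_iff permutes_def)
      ultimately have "(\<Prod>i<length bs. cinner (bs ! i) (bs ! p i)) = 0"
        by (intro prod_zero) (auto intro!: bexI[of _ i] simp: c)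
      then show ?thesis
        using False by simp
    next
      case True
      then have "cinner (bs ! i) (bs ! i) = 1" if "i < length bs" for i
        using c[OF that] by simp
      then show ?thesis
        using True by (simp add: sign_id)
    qed
  qed
  also have "\<dots> = 1"
    by (simp add: finite_permutations permutes_id)
  finally show ?thesis .
qed

lemma wedge_orthogonal:
  assumes "b \<in> set ys" "\<And>x. x \<in> set xs \<Longrightarrow> cinner b x = 0"
  shows "wedge xs ys = 0"
proof (cases "length ys = length xs")
  case True
  obtain i where i: "i < length xs" "ys ! i = b"
    using assms(1) True by (metis in_set_conv_nth)
  have *: "(\<Prod>i<length xs. cinner (ys ! i) (xs ! p i)) = 0" if p: "p permutes {..<length xs}" for p
  proof (rule prod_zero)
    have "p i < length xs"
      using permutes_in_image[OF p, of i] i by simp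
    then show "\<exists>i\<in>{..<length xs}. cinner (ys ! i) (xs ! p i) = 0"
      using i assms(2) by (intro bexI[of _ i]) auto
  qed simp
  show ?thesis
    by (simp add: wedge_def * del: prod_zero_iff)
qed (simp add: wedge_def)

text \<open>The basis consists of the wedges over the k-element subsets of \<open>hbasis\<close>.
  For Parseval's identity, tuples with a repetition drop out, and the others are grouped by their
  underlying set into k! orderings on which the modulus of a form is constant.\<close>

lemma hilbert_basis_ext_power_exists:
  "\<exists>B. hilbert_basis (ext_power k :: ('a::complex_hilbert_space list \<Rightarrow> complex) set) (ext_inner k) B"
proof -
  define J where "J = {I. I \<subseteq> (hbasis :: 'a set) \<and> finite I \<and> card I = k}"
  \<comment> \<open>There is no preferred order on the basis, so each subset is listed in an
    arbitrary fixed order.\<close>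
  define l where "l I = (SOME bs. set bs = I \<and> distinct bs)" for I :: "'a set"
  have l: "set (l I) = I" "distinct (l I)" "length (l I) = k" if "I \<in> J" for I
  proof -
    have "\<exists>bs. set bs = I \<and> distinct bs"
      using that finite_distinct_list by (auto simp: J_def)
    then have "set (l I) = I \<and> distinct (l I)"
      unfolding l_def by (rule someI_ex)
    then show "set (l I) = I" "distinct (l I)" "length (l I) = k"
      using that distinct_card[of "l I"] by (auto simp: J_def)
  qed
  have wl: "wedge (l I) \<in> ext_power k" if "I \<in> J" for I
    using wedge_in_ext_power[of "l I"] l[OF that] by simp
  have on: "ext_inner k (wedge (l I)) (wedge (l I')) = (if I = I' then 1 else 0)" if I: "I \<in> J" "I' \<in> J" for I I'
  proof (cases "I = I'")
    case True
    then show ?thesis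
      using ext_inner_wedge(2)[OF wl l(3)] wedge_orthonormal_self[of "l I"] l[OF I(1)] I by (simp add: J_def)
  next
    case False
    have "\<not> I \<subseteq> I'"
      using False I card_subset_eq[of I' I] by (auto simp: J_def)
    then obtain b where b: "b \<in> I" "b \<notin> I'" by blast
    have "wedge (l I') (l I) = 0"
    proof (rule wedge_orthogonal)
      show "b \<in> set (l I)"
        using b l I by simp
      show "cinner b x = 0" if "x \<in> set (l I')" for x
      proof -
        have "b \<in> hbasis" "x \<in> hbasis" "b \<noteq> x"
          using b l(1)[OF I(2)] I that by (auto simp: J_def)
        then show ?thesis
          by (simp add: cinner_hbasis)
      qed
    qed
    then show ?thesis
      using False ext_inner_wedge(2)[OF wl l(3)] I by simp
  qed
  have parseval: "((\<lambda>I. (cmod (\<phi> (l I)))\<^sup>2) has_sum Re (ext_inner k \<phi> \<phi>)) J" if \<phi>: "\<phi> \<in> ext_power k" for \<phi>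
  proof -
    have "((\<lambda>bs. Re (cnj (\<phi> bs) * \<phi> bs)) has_sum Re (fact k * ext_inner k \<phi> \<phi>)) (tuples k hbasis)"
      by (intro has_sum_Re ext_inner_has_sum \<phi>)
    moreover have "Re (cnj (\<phi> bs) * \<phi> bs) = (cmod (\<phi> bs))\<^sup>2" for bs
      by (metis Re_complex_of_real complex_norm_square mult.commute)
    moreover have "Re (fact k * ext_inner k \<phi> \<phi>) = fact k * Re (ext_inner k \<phi> \<phi>)"
      by (subst of_real_fact[symmetric]) (simp del: of_real_fact)
    ultimately have "((\<lambda>bs. (cmod (\<phi> bs))\<^sup>2) has_sum fact k * Re (ext_inner k \<phi> \<phi>)) (tuples k hbasis)"
      by simp
    then have "((\<lambda>bs. (cmod (\<phi> bs))\<^sup>2) has_sum fact k * Re (ext_inner k \<phi> \<phi>)) {bs \<in> tuples k hbasis. distinct bs}"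
      by (rule has_sum_cong_neutral[THEN iffD1, rotated -1]) (use ext_powerD(4)[OF \<phi>] in auto)
    moreover have "bij_betw snd (Sigma J permutations_of_set) {bs \<in> tuples k hbasis. distinct bs}"
      by (rule bij_betwI[where g = "\<lambda>bs. (set bs, bs)"])
        (auto simp: J_def tuples_def distinct_card permutations_of_set_def)
    ultimately have "((\<lambda>x. (cmod (\<phi> (snd x)))\<^sup>2) has_sum fact k * Re (ext_inner k \<phi> \<phi>)) (Sigma J permutations_of_set)"
      using has_sum_reindex_bij_betw[of snd "Sigma J permutations_of_set" _ "\<lambda>bs. (cmod (\<phi> bs))\<^sup>2"] by blast
    then have "((\<lambda>I. fact k * (cmod (\<phi> (l I)))\<^sup>2) has_sum fact k * Re (ext_inner k \<phi> \<phi>)) J"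
    proof (rule has_sum_Sigma')
      fix I assume I: "I \<in> J"
      have "cmod (\<phi> bs) = cmod (\<phi> (l I))" if bs: "bs \<in> permutations_of_set I" for bs
      proof -
        have "mset bs = mset (l I)"
          using bs l[OF I] by (simp add: permutations_of_set_def flip: set_eq_iff_mset_eq_distinct)
        then obtain p where p: "p permutes {..<length (l I)}" "permute_list p (l I) = bs"
          using mset_eq_permutation by blast
        then show ?thesis
          using ext_power_permute[OF \<phi> p(1)] by (auto simp: norm_mult)
      qed
      then have "(\<Sum>bs\<in>permutations_of_set I. (cmod (\<phi> bs))\<^sup>2) = fact k * (cmod (\<phi> (l I)))\<^sup>2"
        using I by (simp add: J_def)
      then show "((\<lambda>y. (cmod (\<phi> (snd (I, y))))\<^sup>2) has_sum fact k * (cmod (\<phi> (l I)))\<^sup>2) (permutations_of_set I)"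
        by (intro has_sum_finiteI) simp_all
    qed
    then show ?thesis
      by (simp add: has_sum_cmult_right_iff)
  qed
  have inj: "inj_on (\<lambda>I. wedge (l I)) J"
    by (rule inj_onI) (metis on zero_neq_one)
  have "hilbert_basis (ext_power k) (ext_inner k) ((\<lambda>I. wedge (l I)) ` J)"
    unfolding hilbert_basis_def
  proof (intro conjI ballI)
    show "(\<lambda>I. wedge (l I)) ` J \<subseteq> ext_power k"
      using wl by blast
    fix x y assume "x \<in> (\<lambda>I. wedge (l I)) ` J" "y \<in> (\<lambda>I. wedge (l I)) ` J"
    then obtain I I' where "I \<in> J" "I' \<in> J" "x = wedge (l I)" "y = wedge (l I')"
      by blast
    then show "ext_inner k x y = (if x = y then 1 else 0)"
      using on[of I I'] inj_onD[OF inj, of I I'] by auto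
  next
    fix \<phi> :: "'a list \<Rightarrow> complex" assume \<phi>: "\<phi> \<in> ext_power k"
    have "((\<lambda>I. (cmod (ext_inner k (wedge (l I)) \<phi>))\<^sup>2) has_sum Re (ext_inner k \<phi> \<phi>)) J"
      using parseval[OF \<phi>] by (rule has_sum_cong[THEN iffD1, rotated]) (simp add: ext_inner_wedge(2)[OF \<phi>] l)
    then show "((\<lambda>b. (cmod (ext_inner k b \<phi>))\<^sup>2) has_sum Re (ext_inner k \<phi> \<phi>)) ((\<lambda>I. wedge (l I)) ` J)"
      by (simp add: has_sum_reindex[OF inj] o_def)
  qed
  then show ?thesis ..
qed

definition ext_basis :: "nat \<Rightarrow> ('a::complex_hilbert_space list \<Rightarrow> complex) set"
  where "ext_basis k = some_hilbert_basis (ext_power k) (ext_inner k)"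

lemma hilbert_basis_ext_basis: "hilbert_basis (ext_power k) (ext_inner k) (ext_basis k)"
  unfolding ext_basis_def some_hilbert_basis_def by (rule someI_ex[OF hilbert_basis_ext_power_exists])

lemma ext_basis_in_ext_power: "b \<in> ext_basis k \<Longrightarrow> b \<in> ext_power k"
  using hilbert_basis_ext_basis unfolding hilbert_basis_def by blast

text \<open>A Hilbert basis comes with Parseval's identity for squared norms only. The identity for
  two different forms is recovered by polarization, from \<open>wedge gs + c wedge hs\<close> with
  \<open>c\<close> running through the fourth roots of unity.\<close>

lemma wedge_parseval:
  assumes gs: "length gs = k" and hs: "length hs = k"
  shows "((\<lambda>b. b gs * cnj (b hs)) has_sum wedge hs gs) (ext_basis k)"
proof -
  have x: "wedge gs \<in> ext_power k" and y: "wedge hs \<in> ext_power k"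
    using wedge_in_ext_power[of gs] wedge_in_ext_power[of hs] gs hs by auto
  have ib: "ext_inner k b (\<lambda>ys. wedge gs ys + c * wedge hs ys) = cnj (b gs) + c * cnj (b hs)"
    if "b \<in> ext_basis k" for b c
    using ext_basis_in_ext_power[OF that] x y gs hs
    by (simp add: ext_inner_lincomb ext_inner_wedge(2) ext_inner_commute[of "wedge _" k b])
  define S where "S = wedge gs gs + wedge hs hs"
  define z where "z = wedge hs gs"
  have ixy: "ext_inner k (wedge gs) (wedge hs) = z"
    using ext_inner_wedge(2)[OF y gs] by (simp add: z_def)
  have iyx: "ext_inner k (wedge hs) (wedge gs) = cnj z"
    using ext_inner_commute[OF x y] ixy by simp
  have N: "ext_inner k (\<lambda>ys. wedge gs ys + c * wedge hs ys) (\<lambda>ys. wedge gs ys + c * wedge hs ys)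
      = S + c * z + cnj c * cnj z" if "cmod c = 1" for c
  proof -
    let ?w = "\<lambda>ys. wedge gs ys + c * wedge hs ys"
    have w: "?w \<in> ext_power k"
      by (rule ext_power_lincomb[OF x y])
    have "ext_inner k ?w ?w = ext_inner k ?w (wedge gs) + c * ext_inner k ?w (wedge hs)"
      by (rule ext_inner_lincomb[OF x y w])
    also have "ext_inner k ?w (wedge gs) = cnj (ext_inner k (wedge gs) ?w)"
      by (rule ext_inner_commute[OF x w])
    also have "ext_inner k ?w (wedge hs) = cnj (ext_inner k (wedge hs) ?w)"
      by (rule ext_inner_commute[OF y w])
    also have "ext_inner k (wedge gs) ?w = wedge gs gs + c * z"
      by (simp add: ext_inner_lincomb[OF x y x] ixy ext_inner_wedge(2)[OF x gs])
    also have "ext_inner k (wedge hs) ?w = cnj z + c * wedge hs hs"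
      by (simp add: ext_inner_lincomb[OF x y y] iyx ext_inner_wedge(2)[OF y hs])
    also have "cnj (wedge gs gs + c * z) + c * cnj (cnj z + c * wedge hs hs)
        = cnj (wedge gs gs) + cnj c * cnj z + c * z + (c * cnj c) * cnj (wedge hs hs)"
      by (simp add: algebra_simps)
    also have "c * cnj c = 1"
      using that by (simp flip: complex_norm_square)
    also have "cnj (wedge gs gs) = wedge gs gs"
      using ext_inner_commute[OF x x] ext_inner_wedge(2)[OF x gs] by simp
    also have "cnj (wedge hs hs) = wedge hs hs"
      using ext_inner_commute[OF y y] ext_inner_wedge(2)[OF y hs] by simp
    finally show ?thesis
      by (simp add: S_def)
  qed
  have P: "((\<lambda>b. complex_of_real ((cmod (cnj (b gs) + c * cnj (b hs)))\<^sup>2))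
      has_sum complex_of_real (Re (S + c * z + cnj c * cnj z))) (ext_basis k)" if c: "cmod c = 1" for c
  proof -
    have "((\<lambda>b. (cmod (ext_inner k b (\<lambda>ys. wedge gs ys + c * wedge hs ys)))\<^sup>2)
      has_sum Re (S + c * z + cnj c * cnj z)) (ext_basis k)"
      using hilbert_basis_ext_basis ext_power_lincomb[OF x y, of c] unfolding hilbert_basis_def N[OF c, symmetric] by blast
    then have "((\<lambda>b. (cmod (cnj (b gs) + c * cnj (b hs)))\<^sup>2)
      has_sum Re (S + c * z + cnj c * cnj z)) (ext_basis k)"
      by (rule has_sum_cong[THEN iffD1, rotated]) (simp add: ib)
    then show ?thesis
      by (rule has_sum_of_real)
  qed
  let ?q = "\<lambda>c b. complex_of_real ((cmod (cnj (b gs) + c * cnj (b hs)))\<^sup>2)"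
  let ?r = "\<lambda>c. complex_of_real (Re (S + c * z + cnj c * cnj z))"
  \<comment> \<open>The four coefficients of the polarization identity, arranged to leave
    \<open>b gs * cnj (b hs)\<close>.\<close>
  have "((\<lambda>b. (1/4) * ?q 1 b + (- 1/4) * ?q (- 1) b + (- \<i>/4) * ?q \<i> b + (\<i>/4) * ?q (- \<i>) b)
      has_sum ((1/4) * ?r 1 + (- 1/4) * ?r (- 1) + (- \<i>/4) * ?r \<i> + (\<i>/4) * ?r (- \<i>))) (ext_basis k)"
    by (intro has_sum_add has_sum_cmult_right P) simp_all
  moreover have "(1/4) * ?q 1 b + (- 1/4) * ?q (- 1) b + (- \<i>/4) * ?q \<i> b + (\<i>/4) * ?q (- \<i>) b = b gs * cnj (b hs)" for b
    unfolding cmod_power2 by (simp add: complex_eq_iff power2_eq_square algebra_simps)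
  moreover have "(1/4) * ?r 1 + (- 1/4) * ?r (- 1) + (- \<i>/4) * ?r \<i> + (\<i>/4) * ?r (- \<i>) = z"
    by (simp add: complex_eq_iff algebra_simps)
  ultimately show ?thesis
    by (simp add: z_def)
qed

text \<open>A Gram determinant is the squared norm of a decomposable form; its nonnegativity and the
  use of Gram determinants in \<open>hadamard\<close> rest on this.\<close>

lemma wedge_square_sum:
  assumes "length xs = k"
  shows "((\<lambda>b. (cmod (b xs))\<^sup>2) has_sum Re (wedge xs xs)) (ext_basis k)"
proof -
  have "((\<lambda>b. Re (b xs * cnj (b xs))) has_sum Re (wedge xs xs)) (ext_basis k)"
    by (intro has_sum_Re wedge_parseval assms)
  then show ?thesis
    unfolding cmod_power2 by (simp add: power2_eq_square)
qed

subsection \<open>The trace of the induced operator\<close>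

lemma nuclear_rep_adjoint:
  fixes A :: "'a::complex_hilbert_space \<Rightarrow>\<^sub>L 'a"
  assumes rep: "nuclear_rep N g h A"
  shows "((\<lambda>n. cinner (h n) y *\<^sub>C g n) has_sum blinfun_apply (op_adjoint A) y) N"
proof -
  note A = nuclear_rep_bounded_ops[OF rep]
  have "(\<lambda>n. cinner (h n) y *\<^sub>C g n) summable_on N"
  proof (rule abs_summable_summable[OF Infinite_Sum.abs_summable_on_comparison_test'])
    show "(\<lambda>n. norm y * (norm (g n))\<^sup>2) summable_on N"
      by (intro summable_on_cmult_right nuclear_repD(2)[OF rep])
    fix n assume "n \<in> N"
    have "cmod (cinner (h n) y) * norm (g n) \<le> (norm (h n) * norm y) * norm (g n)"
      by (intro mult_right_mono norm_cinner_le) simp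
    then show "norm (cinner (h n) y *\<^sub>C g n) \<le> norm y * (norm (g n))\<^sup>2"
      using nuclear_repD(1)[OF rep \<open>n \<in> N\<close>] by (simp add: norm_scaleC power2_eq_square mult_ac)
  qed
  then obtain s where s: "((\<lambda>n. cinner (h n) y *\<^sub>C g n) has_sum s) N"
    by (auto simp: summable_on_def)
  have "s = blinfun_apply (op_adjoint A) y"
  proof (rule cinner_eqI)
    fix x
    have "((\<lambda>n. cinner x (cinner (h n) y *\<^sub>C g n)) has_sum cinner x s) N"
      by (rule has_sum_cinner_right[OF s])
    moreover have "((\<lambda>n. cinner (cinner (g n) x *\<^sub>C h n) y) has_sum cinner (blinfun_apply A x) y) N"
      by (rule has_sum_cinner_left[OF nuclear_repD(3)[OF rep]])
    then have "((\<lambda>n. cinner x (cinner (h n) y *\<^sub>C g n)) has_sum cinner (blinfun_apply A x) y) N"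
      by (simp add: cinner_scaleC_left cinner_scaleC_right mult.commute flip: cinner_commute)
    ultimately have "cinner x s = cinner (blinfun_apply A x) y"
      by (rule has_sum_unique)
    then show "cinner x s = cinner x (blinfun_apply (op_adjoint A) y)"
      by (simp add: cinner_adjoint_right[OF A])
  qed
  then show ?thesis
    using s by simp
qed

lemma prod_list_map_power2: "prod_list (map (\<lambda>x. (f x)\<^sup>2) xs) = (prod_list (map f xs))\<^sup>2"
  for f :: "'b \<Rightarrow> real"
  by (induction xs) (simp_all add: power_mult_distrib)

lemma nuclear_rep_tuple_weight:
  assumes "nuclear_rep N g h A"
  shows "(\<lambda>ns. (prod_list (map (\<lambda>n. norm (g n)) ns))\<^sup>2) summable_on tuples k N"
  using has_sum_tuples_power[OF has_sum_infsum[OF nuclear_repD(2)[OF assms]], of k]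
  by (auto simp: summable_on_def prod_list_map_power2)

lemma nuclear_rep_tuple_norm:
  assumes "nuclear_rep N g h A" "ns \<in> tuples k N"
  shows "prod_list (map (\<lambda>n. norm (h n)) ns) = prod_list (map (\<lambda>n. norm (g n)) ns)"
  by (rule arg_cong[where f = prod_list], rule map_cong[OF refl])
    (use assms nuclear_repD(1)[OF assms(1)] in \<open>auto simp: tuples_def\<close>)

text \<open>The induced operator evaluates a form at images under the adjoint, whose nuclear
  expansion has \<open>g\<close> and \<open>h\<close> exchanged; it is inserted in every
  slot.\<close>

lemma nuclear_rep_ext_op:
  fixes A :: "'a::complex_hilbert_space \<Rightarrow>\<^sub>L 'a"
  assumes rep: "nuclear_rep N g h A" and \<phi>: "\<phi> \<in> ext_power k" and ys: "length ys = k"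
  shows "((\<lambda>ns. prod_list (map2 cinner ys (map h ns)) * \<phi> (map g ns)) has_sum ext_op A \<phi> ys) (tuples k N)"
proof -
  obtain C where C: "0 \<le> C" "\<And>ys. cmod (\<phi> ys) \<le> C * prod_list (map norm ys)"
    using ext_power_bound[OF \<phi>] by blast
  have summ: "(\<lambda>ns. prod_list (map2 cinner ys (map h ns)) * \<phi> (map g ns)) summable_on tuples k N"
  proof (rule abs_summable_summable[OF Infinite_Sum.abs_summable_on_comparison_test'])
    show "(\<lambda>ns. prod_list (map norm ys) * C * (prod_list (map (\<lambda>n. norm (g n)) ns))\<^sup>2) summable_on tuples k N"
      by (intro summable_on_cmult_right nuclear_rep_tuple_weight[OF rep])
    fix ns assume ns: "ns \<in> tuples k N"
    have "cmod (prod_list (map2 cinner ys (map h ns))) * cmod (\<phi> (map g ns))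
        \<le> (prod_list (map norm (map h ns)) * prod_list (map norm ys)) * (C * prod_list (map norm (map g ns)))"
      using ns ys C
      by (intro mult_mono cmod_prod_list_cinner_le C) (auto simp: tuples_def intro!: mult_nonneg_nonneg prod_list_nonneg)
    then show "cmod (prod_list (map2 cinner ys (map h ns)) * \<phi> (map g ns))
        \<le> prod_list (map norm ys) * C * (prod_list (map (\<lambda>n. norm (g n)) ns))\<^sup>2"
      using nuclear_rep_tuple_norm[OF rep ns] by (simp add: norm_mult power2_eq_square mult_ac o_def)
  qed
  have map2h: "map2 cinner ys (map h ns) = map2 (\<lambda>y n. cinner y (h n)) ys ns" for ns
    by (simp add: zip_map2 o_def case_prod_unfold)
  have "((\<lambda>ns. prod_list (map2 (\<lambda>y n. cinner y (h n)) ys ns) * \<phi> (map g ns @ [])) has_sum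
      \<phi> (map (blinfun_apply (op_adjoint A)) ys @ [])) (tuples (length ys) N)"
  proof (rule has_sum_multi_expand[where k = k])
    fix us ws :: "'a list" and v assume l: "length us + length ws < k"
    show "((\<lambda>n. cinner v (h n) * \<phi> (us @ g n # ws)) has_sum \<phi> (us @ blinfun_apply (op_adjoint A) v # ws)) N"
    proof (cases "length us + length ws + 1 = k")
      case True
      then show ?thesis
        using ext_power_slot_has_sum[OF \<phi> True nuclear_rep_adjoint[OF rep, of v]] by (simp flip: cinner_commute)
    next
      case False
      then show ?thesis
        using ext_powerD(1)[OF \<phi>] by simp
    qed
  qed (use ys summ in \<open>simp_all add: map2h\<close>)
  then show ?thesis
    using ys by (simp add: ext_op_def map2h)
qed

text \<open>Interchange of summation again. Over basis tuples, the tensor expansion rebuilds the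
  form at \<open>map h ns\<close>; over index tuples, \<open>nuclear_rep_ext_op\<close> rebuilds the
  induced operator.\<close>

lemma nuclear_rep_ext_inner:
  fixes A :: "'a::complex_hilbert_space \<Rightarrow>\<^sub>L 'a"
  assumes rep: "nuclear_rep N g h A" and \<phi>: "\<phi> \<in> ext_power k"
  shows "((\<lambda>ns. \<phi> (map g ns) * cnj (\<phi> (map h ns))) has_sum (fact k * ext_inner k \<phi> (ext_op A \<phi>))) (tuples k N)"
proof -
  obtain C where C: "0 \<le> C" "\<And>ys. cmod (\<phi> ys) \<le> C * prod_list (map norm ys)"
    using ext_power_bound[OF \<phi>] by blast
  let ?G = "\<lambda>ns. prod_list (map (\<lambda>n. norm (g n)) ns)"
  define u where "u ns bs = cnj (\<phi> bs) * (prod_list (map2 cinner bs (map h ns)) * \<phi> (map g ns))" for ns bs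
  have u1: "((\<lambda>bs. u ns bs) has_sum \<phi> (map g ns) * cnj (\<phi> (map h ns))) (tuples k hbasis)" if "ns \<in> tuples k N" for ns
  proof -
    have "((\<lambda>bs. cnj (prod_list (map2 cinner (map h ns) bs) * \<phi> bs)) has_sum cnj (\<phi> (map h ns))) (tuples k hbasis)"
      unfolding has_sum_cnj_iff by (rule ext_power_tensor_expand[OF \<phi>]) (use that in \<open>simp add: tuples_def\<close>)
    then have "((\<lambda>bs. \<phi> (map g ns) * cnj (prod_list (map2 cinner (map h ns) bs) * \<phi> bs)) has_sum \<phi> (map g ns) * cnj (\<phi> (map h ns))) (tuples k hbasis)"
      by (rule has_sum_cmult_right)
    then show ?thesis
      by (simp add: u_def map2_cinner_cnj mult_ac)
  qed
  have bnd: "cmod (u ns bs) \<le> C\<^sup>2 * (?G ns)\<^sup>2 * (cmod (\<phi> bs))\<^sup>2 + (cmod (prod_list (map2 cinner (map h ns) bs)))\<^sup>2" for ns bs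
  proof -
    have "cmod (u ns bs) = (cmod (\<phi> (map g ns)) * cmod (\<phi> bs)) * cmod (prod_list (map2 cinner (map h ns) bs))"
      by (simp add: u_def norm_mult mult_ac flip: map2_cinner_cnj[of bs])
    also have "\<dots> \<le> (C * ?G ns * cmod (\<phi> bs)) * cmod (prod_list (map2 cinner (map h ns) bs))"
      using C(2)[of "map g ns"] by (intro mult_right_mono) (auto simp: o_def)
    also have "\<dots> \<le> ((C * ?G ns * cmod (\<phi> bs))\<^sup>2 + (cmod (prod_list (map2 cinner (map h ns) bs)))\<^sup>2) / 2"
      by (rule mult_le_half_squares)
    also have "\<dots> \<le> (C * ?G ns * cmod (\<phi> bs))\<^sup>2 + (cmod (prod_list (map2 cinner (map h ns) bs)))\<^sup>2"
      by (simp add: field_simps)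
    finally show ?thesis
      by (simp add: power_mult_distrib)
  qed
  have summ: "(\<lambda>(ns, bs). u ns bs) summable_on tuples k N \<times> tuples k hbasis"
  proof (rule abs_summable_summable[OF Infinite_Sum.abs_summable_on_comparison_test'])
    show "(\<lambda>(ns, bs). C\<^sup>2 * (?G ns)\<^sup>2 * (cmod (\<phi> bs))\<^sup>2 + (cmod (prod_list (map2 cinner (map h ns) bs)))\<^sup>2)
        summable_on tuples k N \<times> tuples k hbasis"
    proof (rule summable_on_SigmaI)
      fix ns assume ns: "ns \<in> tuples k N"
      have "((\<lambda>bs. (cmod (prod_list (map2 cinner (map h ns) bs)))\<^sup>2) has_sum (?G ns)\<^sup>2) (tuples k hbasis)"
        using has_sum_basis_tuples_prod[of "map h ns"] ns nuclear_rep_tuple_norm[OF rep ns]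
        by (simp add: tuples_def prod_list_map_power2 o_def)
      then show "((\<lambda>bs. case (ns, bs) of (ns, bs) \<Rightarrow> C\<^sup>2 * (?G ns)\<^sup>2 * (cmod (\<phi> bs))\<^sup>2 + (cmod (prod_list (map2 cinner (map h ns) bs)))\<^sup>2)
          has_sum (C\<^sup>2 * (?G ns)\<^sup>2 * (\<Sum>\<^sub>\<infinity>bs\<in>tuples k hbasis. (cmod (\<phi> bs))\<^sup>2) + (?G ns)\<^sup>2)) (tuples k hbasis)"
        unfolding case_prod_conv
        by (intro has_sum_add has_sum_cmult_right has_sum_infsum ext_powerD(5)[OF \<phi>])
    next
      have "(\<lambda>ns. (C\<^sup>2 * (\<Sum>\<^sub>\<infinity>bs\<in>tuples k hbasis. (cmod (\<phi> bs))\<^sup>2) + 1) * (?G ns)\<^sup>2) summable_on tuples k N"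
        by (intro summable_on_cmult_right nuclear_rep_tuple_weight[OF rep])
      then show "(\<lambda>ns. C\<^sup>2 * (?G ns)\<^sup>2 * (\<Sum>\<^sub>\<infinity>bs\<in>tuples k hbasis. (cmod (\<phi> bs))\<^sup>2) + (?G ns)\<^sup>2) summable_on tuples k N"
        by (simp add: algebra_simps)
    qed auto
    show "cmod (case x of (ns, bs) \<Rightarrow> u ns bs)
        \<le> (case x of (ns, bs) \<Rightarrow> C\<^sup>2 * (?G ns)\<^sup>2 * (cmod (\<phi> bs))\<^sup>2 + (cmod (prod_list (map2 cinner (map h ns) bs)))\<^sup>2)" for x
      by (cases x) (use bnd in simp)
  qed
  then obtain t where t: "((\<lambda>(ns, bs). u ns bs) has_sum t) (tuples k N \<times> tuples k hbasis)"
    by (auto simp: summable_on_def)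
  have "((\<lambda>ns. \<phi> (map g ns) * cnj (\<phi> (map h ns))) has_sum t) (tuples k N)"
    by (rule has_sum_Sigma'[OF t]) (simp add: u1)
  moreover have "((\<lambda>bs. cnj (\<phi> bs) * ext_op A \<phi> bs) has_sum t) (tuples k hbasis)"
  proof (rule has_sum_Sigma'[where B = "\<lambda>_. tuples k N"])
    show "((\<lambda>(bs, ns). u ns bs) has_sum t) (tuples k hbasis \<times> tuples k N)"
      using t by (subst (asm) has_sum_swap) (simp add: case_prod_unfold)
    fix bs assume "bs \<in> tuples k (hbasis :: 'a set)"
    then show "((\<lambda>ns. case (bs, ns) of (bs, ns) \<Rightarrow> u ns bs) has_sum cnj (\<phi> bs) * ext_op A \<phi> bs) (tuples k N)"
      unfolding case_prod_conv u_def by (intro has_sum_cmult_right nuclear_rep_ext_op[OF rep \<phi>]) (simp add: tuples_def)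
  qed
  then have "fact k * ext_inner k \<phi> (ext_op A \<phi>) = t"
    unfolding ext_inner_def basis_tuples_eq by (simp add: infsumI)
  ultimately show ?thesis
    by simp
qed

text \<open>Fredholm's series. The double family over index tuples and an arbitrary basis of the
  exterior power gives determinants when the basis is summed first, by
  \<open>wedge_parseval\<close>, and diagonal entries of the induced operator in the other order.
  Gram determinants dominate it.\<close>

lemma nuclear_rep_ext_trace:
  fixes A :: "'a::complex_hilbert_space \<Rightarrow>\<^sub>L 'a"
  assumes rep: "nuclear_rep N g h A"
  shows "((\<lambda>ns. wedge (map h ns) (map g ns)) has_sum (fact k * ext_trace k A)) (tuples k N)"
proof -
  let ?G = "\<lambda>ns. prod_list (map (\<lambda>n. norm (g n)) ns)"
  define u where "u ns b = b (map g ns) * cnj (b (map h ns))" for ns and b :: "'a list \<Rightarrow> complex"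
  have summ: "(\<lambda>(ns, b). u ns b) summable_on tuples k N \<times> ext_basis k"
  proof (rule abs_summable_summable[OF Infinite_Sum.abs_summable_on_comparison_test'])
    show "(\<lambda>(ns, b). (cmod (b (map g ns)))\<^sup>2 + (cmod (b (map h ns)))\<^sup>2) summable_on tuples k N \<times> ext_basis k"
    proof (rule summable_on_SigmaI)
      fix ns assume "ns \<in> tuples k N"
      then show "((\<lambda>b. case (ns, b) of (ns, b) \<Rightarrow> (cmod (b (map g ns)))\<^sup>2 + (cmod (b (map h ns)))\<^sup>2)
          has_sum (Re (wedge (map g ns) (map g ns)) + Re (wedge (map h ns) (map h ns)))) (ext_basis k)"
        unfolding case_prod_conv by (intro has_sum_add wedge_square_sum) (simp_all add: tuples_def)
    next
      show "(\<lambda>ns. Re (wedge (map g ns) (map g ns)) + Re (wedge (map h ns) (map h ns))) summable_on tuples k N"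
      proof (rule abs_summable_summable[OF Infinite_Sum.abs_summable_on_comparison_test'])
        show "(\<lambda>ns. 2 * fact k * (?G ns)\<^sup>2) summable_on tuples k N"
          by (intro summable_on_cmult_right nuclear_rep_tuple_weight[OF rep])
        fix ns assume ns: "ns \<in> tuples k N"
        have "\<bar>Re (wedge xs xs)\<bar> \<le> fact k * (prod_list (map norm xs))\<^sup>2" if "length xs = k" for xs :: "'a list"
          using wedge_bound[of xs xs] abs_Re_le_cmod[of "wedge xs xs"] that by (simp add: power2_eq_square mult_ac)
        from this[of "map g ns"] this[of "map h ns"]
        show "norm (Re (wedge (map g ns) (map g ns)) + Re (wedge (map h ns) (map h ns))) \<le> 2 * fact k * (?G ns)\<^sup>2"
          using ns nuclear_rep_tuple_norm[OF rep ns] by (simp add: tuples_def o_def)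
      qed
    qed auto
    show "cmod (case x of (ns, b) \<Rightarrow> u ns b) \<le> (case x of (ns, b) \<Rightarrow> (cmod (b (map g ns)))\<^sup>2 + (cmod (b (map h ns)))\<^sup>2)" for x
    proof (cases x)
      case (Pair ns b)
      have "cmod (b (map g ns)) * cmod (b (map h ns)) \<le> (cmod (b (map g ns)))\<^sup>2 + (cmod (b (map h ns)))\<^sup>2"
        by (rule order_trans[OF mult_le_half_squares]) simp
      then show ?thesis
        using Pair by (simp add: u_def norm_mult)
    qed
  qed
  then obtain t where t: "((\<lambda>(ns, b). u ns b) has_sum t) (tuples k N \<times> ext_basis k)"
    by (auto simp: summable_on_def)
  have "((\<lambda>ns. wedge (map h ns) (map g ns)) has_sum t) (tuples k N)"
    by (rule has_sum_Sigma'[OF t]) (auto simp: u_def tuples_def intro!: wedge_parseval)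
  moreover have "((\<lambda>b. fact k * ext_inner k b (ext_op A b)) has_sum t) (ext_basis k)"
  proof (rule has_sum_Sigma'[where B = "\<lambda>_. tuples k N"])
    show "((\<lambda>(b, ns). u ns b) has_sum t) (ext_basis k \<times> tuples k N)"
      using t by (subst (asm) has_sum_swap) (simp add: case_prod_unfold)
    fix b :: "'a list \<Rightarrow> complex" assume "b \<in> ext_basis k"
    then show "((\<lambda>ns. case (b, ns) of (b, ns) \<Rightarrow> u ns b) has_sum fact k * ext_inner k b (ext_op A b)) (tuples k N)"
      unfolding case_prod_conv u_def by (intro nuclear_rep_ext_inner[OF rep] ext_basis_in_ext_power)
  qed
  then have "fact k * ext_trace k A = t"
    unfolding ext_trace_def trace_on_def ext_basis_def[symmetric]
    by (metis infsumI infsum_cmult_right')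
  ultimately show ?thesis
    by simp
qed

lemma wedge_cnj: "wedge xs ys = cnj (wedge ys xs)"
proof (cases "length xs = length ys")
  case True
  have x: "wedge xs \<in> ext_power (length xs)" and y: "wedge ys \<in> ext_power (length xs)"
    using wedge_in_ext_power[of xs] wedge_in_ext_power[of ys] True by auto
  have "wedge ys xs = cnj (wedge xs ys)"
    using ext_inner_commute[OF y x] ext_inner_wedge(2)[OF x, of ys] ext_inner_wedge(2)[OF y, of xs] True
    by simp
  then show ?thesis
    by simp
qed (simp add: wedge_def)

text \<open>The sign occurs twice and cancels. The terms of Fredholm's series are thus symmetric in
  the index tuple, and any slot may be moved to the last place.\<close>

lemma wedge_permute_both:
  assumes len: "length ys = length xs" and p: "p permutes {..<length xs}"
  shows "wedge (permute_list p xs) (permute_list p ys) = wedge xs ys"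
proof -
  have "wedge (permute_list p xs) (permute_list p ys) = of_int (sign p) * wedge (permute_list p xs) ys"
    using ext_power_permute[OF wedge_in_ext_power, of p ys "permute_list p xs"] len p by simp
  also have "wedge (permute_list p xs) ys = cnj (wedge ys (permute_list p xs))"
    by (rule wedge_cnj)
  also have "wedge ys (permute_list p xs) = of_int (sign p) * wedge ys xs"
    using ext_power_permute[OF wedge_in_ext_power p, of ys] by simp
  finally show ?thesis
    by (simp add: wedge_cnj[of xs ys] flip: mult.assoc of_int_mult)
qed

lemma wedge_Nil [simp]: "wedge [] [] = 1"
  by (simp add: wedge_def)

text \<open>Laplace expansion along the last row. Instead of deleting column \<open>b\<close> and
  carrying alternating signs, the last column \<open>y\<close> is moved into its place, so every
  off-diagonal term has the single sign of a transposition.\<close>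

lemma wedge_snoc_expand:
  assumes len: "length hs = k" "length gs = k"
  shows "wedge (hs @ [y]) (gs @ [x]) = cinner x y * wedge hs gs - (\<Sum>b<k. cinner x (hs ! b) * wedge (hs[b := y]) gs)"
proof -
  let ?P = "{p. p permutes {..<k}}"
  define F where "F p = of_int (sign p) * (\<Prod>i<Suc k. cinner ((gs @ [x]) ! i) ((hs @ [y]) ! p i))" for p
  have "wedge (hs @ [y]) (gs @ [x]) = (\<Sum>p | p permutes (insert k {..<k}). F p)"
    using len by (simp add: wedge_def F_def lessThan_Suc del: prod.lessThan_Suc)
  also have "\<dots> = (\<Sum>b\<in>insert k {..<k}. \<Sum>q\<in>?P. F (Transposition.transpose k b \<circ> q))"
    by (rule sum_over_permutations_insert) auto
  also have "\<dots> = (\<Sum>q\<in>?P. F q) + (\<Sum>b<k. \<Sum>q\<in>?P. F (Transposition.transpose k b \<circ> q))"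
    by simp
  also have "(\<Sum>q\<in>?P. F q) = cinner x y * wedge hs gs"
  proof -
    have "F q = cinner x y * (of_int (sign q) * (\<Prod>i<k. cinner (gs ! i) (hs ! q i)))" if q: "q permutes {..<k}" for q
    proof -
      have "q k = k"
        using q by (simp add: permutes_def)
      moreover have "q i < k" if "i < k" for i
        using permutes_in_image[OF q, of i] that by simp
      ultimately show ?thesis
        using len by (simp add: F_def nth_append)
    qed
    then show ?thesis
      using len by (simp add: wedge_def sum_distrib_left)
  qed
  also have "(\<Sum>b<k. \<Sum>q\<in>?P. F (Transposition.transpose k b \<circ> q)) = (\<Sum>b<k. - (cinner x (hs ! b) * wedge (hs[b := y]) gs))"
  proof (rule sum.cong[OF refl])
    fix b assume b: "b \<in> {..<k}"
    have "F (Transposition.transpose k b \<circ> q) = - (cinner x (hs ! b) * (of_int (sign q) * (\<Prod>i<k. cinner (gs ! i) (hs[b := y] ! q i))))"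
      if q: "q permutes {..<k}" for q
    proof -
      have "permutation q"
        using q permutation_permutes by blast
      then have s: "sign (Transposition.transpose k b \<circ> q) = - sign q"
        using b by (simp add: sign_compose sign_swap_id permutation_swap_id)
      have "q k = k"
        using q by (simp add: permutes_def)
      then have last: "(hs @ [y]) ! (Transposition.transpose k b (q k)) = hs ! b"
        using b len by (simp add: nth_append)
      have rest: "(hs @ [y]) ! (Transposition.transpose k b (q i)) = hs[b := y] ! q i" if "i < k" for i
      proof -
        have "q i < k"
          using permutes_in_image[OF q, of i] that by simp
        then show ?thesis
          using b len by (auto simp: Transposition.transpose_def nth_append nth_list_update)
      qed
      have "(\<Prod>i<k. cinner ((gs @ [x]) ! i) ((hs @ [y]) ! Transposition.transpose k b (q i))) = (\<Prod>i<k. cinner (gs ! i) (hs[b := y] ! q i))"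
        using rest len by (intro prod.cong) (auto simp: nth_append)
      moreover have "(gs @ [x]) ! k = x"
        using len by (simp add: nth_append)
      ultimately show ?thesis
        by (simp add: F_def s last)
    qed
    then show "(\<Sum>q\<in>?P. F (Transposition.transpose k b \<circ> q)) = - (cinner x (hs ! b) * wedge (hs[b := y]) gs)"
      using len by (simp add: wedge_def sum_distrib_left sum_negf)
  qed
  finally show ?thesis
    by (simp add: sum_negf)
qed

subsection \<open>Hadamard's inequality\<close>

lemma finite_projection_exists:
  fixes x :: "'a::complex_hilbert_space"
  assumes "finite S"
  shows "\<exists>v\<in>cvec.span S. \<forall>s\<in>S. cinner s (x - v) = 0"
  using assms
proof (induction S arbitrary: x)
  case empty
  show ?case
    by (rule bexI[of _ 0]) (auto simp: cvec.span_zero)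
next
  case (insert s S)
  obtain w where w: "w \<in> cvec.span S" "\<And>t. t \<in> S \<Longrightarrow> cinner t (s - w) = 0"
    using insert.IH[of s] by blast
  obtain v where v: "v \<in> cvec.span S" "\<And>t. t \<in> S \<Longrightarrow> cinner t (x - v) = 0"
    using insert.IH[of x] by blast
  have mono: "z \<in> cvec.span (insert s S)" if "z \<in> cvec.span S" for z
    using that cvec.span_mono[of S "insert s S"] by blast
  define u where "u = s - w"
  have u_in: "u \<in> cvec.span (insert s S)"
    unfolding u_def by (intro cvec.span_diff mono w cvec.span_base) simp
  have perp: "cinner z (x - v) = 0" if "z \<in> cvec.span S" for z
    using that
  proof (induction rule: cvec.span_induct_alt)
    case (step c t z)
    then show ?case
      by (simp add: cinner_add_left cinner_scaleC_left v)
  qed (simp add: cinner.zero_left)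
  have perp_u: "cinner z u = 0" if "z \<in> cvec.span S" for z
    using that
  proof (induction rule: cvec.span_induct_alt)
    case (step c t z)
    then show ?case
      by (simp add: cinner_add_left cinner_scaleC_left w u_def)
  qed (simp add: cinner.zero_left)
  \<comment> \<open>If \<open>s\<close> already lies in the span of \<open>S\<close>, then
    \<open>u = 0\<close>, and the value 0 of the quotient is an admissible coefficient.\<close>
  define c where "c = cinner u (x - v) / cinner u u"
  have u_eq: "cinner u (x - v) = c * cinner u u"
    by (cases "u = 0") (simp_all add: c_def cinner_self cinner.zero_left)
  show ?case
  proof (intro bexI ballI)
    show "v + c *\<^sub>C u \<in> cvec.span (insert s S)"
      by (intro cvec.span_add cvec.span_scale mono v u_in)
    fix t assume t: "t \<in> insert s S"
    have S: "cinner z (x - (v + c *\<^sub>C u)) = 0" if "z \<in> cvec.span S" for z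
    proof -
      have "cinner z (x - (v + c *\<^sub>C u)) = cinner z (x - v) - c * cinner z u"
        by (simp add: cinner.diff_right cinner_add_right cinner_scaleC_right)
      then show ?thesis
        using perp[OF that] perp_u[OF that] by simp
    qed
    show "cinner t (x - (v + c *\<^sub>C u)) = 0"
    proof (cases "t = s")
      case True
      have "cinner t (x - (v + c *\<^sub>C u)) = cinner u (x - (v + c *\<^sub>C u)) + cinner w (x - (v + c *\<^sub>C u))"
        by (simp add: True u_def flip: cinner_add_left)
      also have "cinner u (x - (v + c *\<^sub>C u)) = cinner u (x - v) - c * cinner u u"
        by (simp add: cinner.diff_right cinner_add_right cinner_scaleC_right)
      finally show ?thesis
        using S[OF w(1)] u_eq by simp
    next
      case False
      then show ?thesis
        using t S cvec.span_base by auto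
    qed
  qed
qed

lemma gram_nonneg: "0 \<le> Re (wedge xs xs)"
  using has_sum_nonneg[OF wedge_square_sum[OF refl]] by simp

text \<open>Subtracting from \<open>x\<close> its projection on the span of the earlier vectors
  leaves the determinant unchanged. For the orthogonal remainder \<open>u\<close> the expansion has
  only its first term, and Pythagoras bounds \<open>norm u\<close> by \<open>norm x\<close>.\<close>

lemma gram_snoc_le: "Re (wedge (xs @ [x]) (xs @ [x])) \<le> (norm x)\<^sup>2 * Re (wedge xs xs)"
proof -
  obtain v where v: "v \<in> cvec.span (set xs)" "\<And>s. s \<in> set xs \<Longrightarrow> cinner s (x - v) = 0"
    using finite_projection_exists[of "set xs" x] by blast
  define u where "u = x - v"
  have z: "wedge zs (xs @ [w]) = 0" if "w \<in> cvec.span (set xs)" "length zs = Suc (length xs)" for w zs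
    using that(1)
  proof (induction rule: cvec.span_induct_alt)
    case base
    show ?case
      using ext_powerD(3)[OF wedge_in_ext_power, of xs "[]" zs 0] that(2) by simp
  next
    case (step c t w)
    have "wedge zs (xs @ [t]) = 0"
      using step by (intro ext_powerD(4)[OF wedge_in_ext_power]) auto
    then show ?case
      using step ext_powerD(2)[OF wedge_in_ext_power, of xs "[]" zs "c *\<^sub>C t" w]
        ext_powerD(3)[OF wedge_in_ext_power, of xs "[]" zs c t] that(2) by simp
  qed
  have repl: "wedge zs (xs @ [x]) = wedge zs (xs @ [u])" if "length zs = Suc (length xs)" for zs
    using ext_powerD(2)[OF wedge_in_ext_power, of xs "[]" zs u v] z[OF v(1) that] that by (simp add: u_def)
  have "wedge (xs @ [x]) (xs @ [x]) = cnj (wedge (xs @ [u]) (xs @ [x]))"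
    using repl[of "xs @ [x]"] wedge_cnj[of "xs @ [x]" "xs @ [u]"] by simp
  also have "\<dots> = cnj (wedge (xs @ [u]) (xs @ [u]))"
    using repl[of "xs @ [u]"] by simp
  also have "wedge (xs @ [u]) (xs @ [u]) = cinner u u * wedge xs xs"
  proof -
    have "cinner u (xs ! b) = 0" if "b < length xs" for b
      using v(2)[of "xs ! b"] that cinner_commute[of u "xs ! b"] by (simp add: u_def)
    then show ?thesis
      by (simp add: wedge_snoc_expand[of xs "length xs" xs])
  qed
  finally have eq: "Re (wedge (xs @ [x]) (xs @ [x])) = (norm u)\<^sup>2 * Re (wedge xs xs)"
    by (simp add: cinner_self flip: of_real_power)
  have "cinner w u = 0" if "w \<in> cvec.span (set xs)" for w
    using that
  proof (induction rule: cvec.span_induct_alt)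
    case (step c t z)
    then show ?case
      by (simp add: cinner_add_left cinner_scaleC_left v u_def)
  qed (simp add: cinner.zero_left)
  then have "Re (cinner u v) = 0"
    using v(1) cinner_commute[of u v] by simp
  moreover have "x = u - (- v)"
    by (simp add: u_def)
  then have "(norm x)\<^sup>2 = (norm u)\<^sup>2 + 2 * Re (cinner u v) + (norm v)\<^sup>2"
    using norm_diff_sq[of u "- v"] by (simp add: cinner.minus_right)
  ultimately have "(norm u)\<^sup>2 \<le> (norm x)\<^sup>2"
    by simp
  then show ?thesis
    unfolding eq by (rule mult_right_mono) (rule gram_nonneg)
qed

lemma hadamard_gram: "Re (wedge xs xs) \<le> (prod_list (map norm xs))\<^sup>2"
proof (induction xs rule: rev_induct)
  case (snoc x xs)
  have "Re (wedge (xs @ [x]) (xs @ [x])) \<le> (norm x)\<^sup>2 * Re (wedge xs xs)"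
    by (rule gram_snoc_le)
  also have "\<dots> \<le> (norm x)\<^sup>2 * (prod_list (map norm xs))\<^sup>2"
    by (intro mult_left_mono snoc.IH) simp
  finally show ?case
    by (simp add: power_mult_distrib mult.commute)
qed simp

text \<open>The determinant is an inner product of two decomposable forms, hence at most the mean of
  their squared norms. Equal products of norms make this mean as good as the geometric one; balanced
  representations satisfy that condition.\<close>

lemma hadamard:
  assumes len: "length xs = length ys" and prod: "prod_list (map norm xs) = prod_list (map norm ys)"
  shows "cmod (wedge xs ys) \<le> (prod_list (map norm ys))\<^sup>2"
proof -
  have "((\<lambda>b. ((cmod (b ys))\<^sup>2 + (cmod (b xs))\<^sup>2) / 2) has_sum ((Re (wedge ys ys) + Re (wedge xs xs)) / 2)) (ext_basis (length ys))"
    by (intro has_sum_divide_const has_sum_add wedge_square_sum len refl)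
  then have "cmod (wedge xs ys) \<le> (Re (wedge ys ys) + Re (wedge xs xs)) / 2"
    by (rule norm_infsum_le[OF wedge_parseval[OF refl len]])
      (simp only: norm_mult complex_mod_cnj mult_le_half_squares)
  also have "\<dots> \<le> (prod_list (map norm ys))\<^sup>2"
    using hadamard_gram[of xs] hadamard_gram[of ys] by (simp add: prod)
  finally show ?thesis .
qed

subsection \<open>Fredholm minors\<close>

text \<open>Testing on unit vectors is what \<open>hadamard\<close> permits: bordering two lists by
  unit vectors keeps their products of norms equal.\<close>

lemma norm_blinfun_le_cinner:
  fixes T :: "'a::complex_hilbert_space \<Rightarrow>\<^sub>L 'a"
  assumes unit: "\<And>x y. norm x = 1 \<Longrightarrow> norm y = 1 \<Longrightarrow> cmod (cinner x (blinfun_apply T y)) \<le> c" and "0 \<le> c"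
  shows "norm T \<le> c"
proof (rule norm_blinfun_bound)
  fix y
  show "norm (blinfun_apply T y) \<le> c * norm y"
  proof (cases "y = 0 \<or> blinfun_apply T y = 0")
    case True
    then show ?thesis
      using \<open>0 \<le> c\<close> by (auto simp: blinfun.zero_right)
  next
    case False
    let ?w = "blinfun_apply T y"
    have "cmod (cinner ((1 / norm ?w) *\<^sub>R ?w) (blinfun_apply T ((1 / norm y) *\<^sub>R y))) \<le> c"
      by (rule unit) (use False in auto)
    moreover have "cinner ((1 / norm ?w) *\<^sub>R ?w) (blinfun_apply T ((1 / norm y) *\<^sub>R y)) = complex_of_real (norm ?w / norm y)"
      using False by (simp add: blinfun.scaleR_right cinner_scaleR_left cinner_scaleR_right cinner_self
          scaleR_conv_of_real power2_eq_square field_simps)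
    ultimately have "norm ?w / norm y \<le> c"
      by (simp only: norm_of_real)
    then show ?thesis
      using False by (simp add: field_simps)
  qed
qed fact

text \<open>The homogeneous parts of the adjugate of \<open>I + A\<close>. The recursion is that of
  Faddeev and LeVerrier; with it as definition, commutation with \<open>A\<close> is immediate and
  the determinant formula becomes a theorem, \<open>nuclear_rep_minor\<close>.\<close>

fun fredholm_minor :: "('a::complex_hilbert_space \<Rightarrow>\<^sub>L 'a) \<Rightarrow> nat \<Rightarrow> ('a \<Rightarrow>\<^sub>L 'a)"
  where "fredholm_minor A 0 = id_blinfun"
  | "fredholm_minor A (Suc k) = ext_trace (Suc k) A *\<^sub>C id_blinfun - (A o\<^sub>L fredholm_minor A k)"

lemma fredholm_minor_bounded_ops: "A \<in> bounded_ops \<Longrightarrow> fredholm_minor A k \<in> bounded_ops"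
  by (induction k) (auto intro!: bounded_ops_diff bounded_ops_scaleC bounded_ops_compose)

lemma fredholm_minor_commute: "A \<in> bounded_ops \<Longrightarrow> A o\<^sub>L fredholm_minor A k = fredholm_minor A k o\<^sub>L A"
proof (induction k)
  case (Suc k)
  then have "blinfun_apply A (blinfun_apply (fredholm_minor A k) v) = blinfun_apply (fredholm_minor A k) (blinfun_apply A v)" for v
    by (metis blinfun_apply_blinfun_compose)
  then show ?case
    using Suc.prems
    by (intro blinfun_eqI) (simp add: blinfun.bilinear_simps scaleC_blinfun.rep_eq bounded_opsD)
qed (auto intro: blinfun_eqI)

lemma nuclear_rep_snoc_summable:
  fixes A :: "'a::complex_hilbert_space \<Rightarrow>\<^sub>L 'a"
  assumes rep: "nuclear_rep N g h A"
    and bound: "\<And>ns. ns \<in> tuples k N \<Longrightarrow> cmod (F ns) \<le> C * (prod_list (map (\<lambda>n. norm (g n)) ns))\<^sup>2"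
  shows "F summable_on tuples k N"
  by (rule abs_summable_summable[OF Infinite_Sum.abs_summable_on_comparison_test'[OF _ bound]])
    (intro summable_on_cmult_right nuclear_rep_tuple_weight[OF rep])

text \<open>In the expansion of the bordered determinant the first term sums to the coefficient of
  the identity, and the \<open>Suc k\<close> others all have the same sum \<open>S\<close>, which
  comes from applying \<open>A\<close> to the previous minor.\<close>

lemma nuclear_rep_minor:
  fixes A :: "'a::complex_hilbert_space \<Rightarrow>\<^sub>L 'a"
  assumes rep: "nuclear_rep N g h A"
  shows "((\<lambda>ns. wedge (map h ns @ [y]) (map g ns @ [x])) has_sum
    (fact k * cinner x (blinfun_apply (fredholm_minor A k) y))) (tuples k N)"
proof (induction k arbitrary: x)
  case 0
  have "wedge [y] [x] = cinner x y"
    using wedge_snoc_expand[of "[]" 0 "[]" y x] by simp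
  then show ?case
    by (intro has_sum_finiteI) simp_all
next
  case (Suc k)
  define T where "T b ns = cinner x (h (ns ! b)) * wedge ((map h ns)[b := y]) (map g ns)" for b ns
  let ?D = "fredholm_minor A k"
  define S where "S = fact k * cinner x (blinfun_apply A (blinfun_apply ?D y))"
  \<comment> \<open>With last index \<open>n\<close>, the factor \<open>cinner x (h n)\<close>
    splits off and leaves a bordered determinant over \<open>k\<close> indices with border
    \<open>y\<close>, \<open>g n\<close>. The induction hypothesis is used at \<open>g n\<close>,
    which is why \<open>x\<close> is arbitrary.\<close>
  have T_last: "(T k has_sum S) (tuples (Suc k) N)"
    unfolding has_sum_tuples_Suc
  proof (rule has_sum_SigmaI)
    have Tk: "T k (ns @ [n]) = cinner x (h n) * wedge (map h ns @ [y]) (map g ns @ [g n])" if "ns \<in> tuples k N" for n ns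
      using that by (simp add: T_def tuples_def nth_append list_update_append)
    show "((\<lambda>ns. case (n, ns) of (n, ns) \<Rightarrow> T k (ns @ [n])) has_sum
        cinner x (h n) * (fact k * cinner (g n) (blinfun_apply ?D y))) (tuples k N)" if "n \<in> N" for n
      unfolding case_prod_conv
      using has_sum_cmult_right[OF Suc.IH] by (rule has_sum_cong[THEN iffD1, rotated]) (simp add: Tk)
    have "((\<lambda>n. fact k * cinner x (cinner (g n) (blinfun_apply ?D y) *\<^sub>C h n)) has_sum S) N"
      unfolding S_def by (intro has_sum_cmult_right has_sum_cinner_right nuclear_repD(3)[OF rep])
    then show "((\<lambda>n. cinner x (h n) * (fact k * cinner (g n) (blinfun_apply ?D y))) has_sum S) N"
      by (simp add: cinner_scaleC_right mult_ac)
    have "T k summable_on tuples (Suc k) N"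
    proof (rule nuclear_rep_snoc_summable[OF rep])
      fix ms assume "ms \<in> tuples (Suc k) N"
      then obtain n ns where ms: "ms = ns @ [n]" "n \<in> N" "ns \<in> tuples k N"
        by (cases ms rule: rev_cases) (auto simp: tuples_def)
      let ?G = "prod_list (map (\<lambda>n. norm (g n)) ns)"
      have "cmod (wedge (map h ns @ [y]) (map g ns @ [g n])) \<le> fact (Suc k) * (?G * norm y) * (?G * norm (g n))"
        using wedge_bound[of "map g ns @ [g n]" "map h ns @ [y]"] ms nuclear_rep_tuple_norm[OF rep ms(3)]
        by (simp add: tuples_def o_def)
      then have "cmod (T k ms) \<le> (norm x * norm (g n)) * (fact (Suc k) * (?G * norm y) * (?G * norm (g n)))"
        unfolding ms(1) Tk[OF ms(3)] norm_mult
        using norm_cinner_le[of x "h n"] nuclear_repD(1)[OF rep ms(2)] by (intro mult_mono) auto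
      then show "cmod (T k ms) \<le> (norm x * norm y * fact (Suc k)) * (prod_list (map (\<lambda>n. norm (g n)) ms))\<^sup>2"
        by (simp add: ms(1) power2_eq_square mult_ac)
    qed
    then show "(\<lambda>(n, ns). T k (ns @ [n])) summable_on N \<times> tuples k N"
      by (simp add: summable_on_tuples_Suc)
  qed
  \<comment> \<open>Relabelling the tuples by the transposition of \<open>b\<close> and
    \<open>k\<close> carries this term into the last one.\<close>
  have T: "(T b has_sum S) (tuples (Suc k) N)" if b: "b < Suc k" for b
  proof -
    let ?t = "Transposition.transpose b k"
    have t: "?t permutes {..<Suc k}"
      using b by (intro permutes_swap_id) auto
    have tt: "permute_list ?t (permute_list ?t ns) = ns" if "length ns = Suc k" for ns :: "'b list"
      using permute_list_compose[of ?t ns ?t] t that by simp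
    have bij: "bij_betw (permute_list ?t) (tuples (Suc k) N) (tuples (Suc k) N)"
      by (rule bij_betwI[where g = "permute_list ?t"]) (use t tt in \<open>auto simp: tuples_def\<close>)
    have "T k (permute_list ?t ns) = T b ns" if ns: "ns \<in> tuples (Suc k) N" for ns
    proof -
      have l: "length ns = Suc k"
        using ns by (simp add: tuples_def)
      have "(map h (permute_list ?t ns))[k := y] = permute_list ?t ((map h ns)[b := y])"
        by (rule nth_equalityI) (use l b in \<open>auto simp: permute_list_def nth_list_update Transposition.transpose_def simp del: upt_Suc\<close>)
      moreover have "map g (permute_list ?t ns) = permute_list ?t (map g ns)"
        using t l by (simp add: permute_list_map)
      ultimately have "wedge ((map h (permute_list ?t ns))[k := y]) (map g (permute_list ?t ns)) = wedge ((map h ns)[b := y]) (map g ns)"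
        using wedge_permute_both[of "map g ns" "(map h ns)[b := y]" ?t] t l by simp
      moreover have "permute_list ?t ns ! k = ns ! b"
        using t l by (simp add: permute_list_nth)
      ultimately show ?thesis
        by (simp add: T_def)
    qed
    then have "((\<lambda>ns. T k (permute_list ?t ns)) has_sum S) (tuples (Suc k) N) \<longleftrightarrow> (T b has_sum S) (tuples (Suc k) N)"
      by (rule has_sum_cong)
    then show ?thesis
      using has_sum_reindex_bij_betw[OF bij, of "T k"] T_last by simp
  qed
  have "((\<lambda>ns. cinner x y * wedge (map h ns) (map g ns) + (\<Sum>b<Suc k. - T b ns)) has_sum
      (cinner x y * (fact (Suc k) * ext_trace (Suc k) A) + (\<Sum>b<Suc k. - S))) (tuples (Suc k) N)"
    by (intro has_sum_add has_sum_cmult_right nuclear_rep_ext_trace[OF rep] has_sum_finite_sum has_sum_uminusI T) simp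
  moreover have "wedge (map h ns @ [y]) (map g ns @ [x]) = cinner x y * wedge (map h ns) (map g ns) + (\<Sum>b<Suc k. - T b ns)"
    if "ns \<in> tuples (Suc k) N" for ns
    using that wedge_snoc_expand[of "map h ns" "Suc k" "map g ns" y x]
    by (simp add: tuples_def T_def sum_negf del: sum.lessThan_Suc)
  \<comment> \<open>The \<open>Suc k\<close> equal terms turn \<open>fact k\<close> in
    \<open>S\<close> into \<open>fact (Suc k)\<close>.\<close>
  moreover have "cinner x y * (fact (Suc k) * ext_trace (Suc k) A) + (\<Sum>b<Suc k. - S)
      = fact (Suc k) * cinner x (blinfun_apply (fredholm_minor A (Suc k)) y)"
    by (simp add: S_def blinfun.diff_left scaleC_blinfun.rep_eq cinner.diff_right cinner_scaleC_right algebra_simps)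
  ultimately show ?case
    using has_sum_cong[of "tuples (Suc k) N"] by (metis (no_types, lifting))
qed

text \<open>A determinant over \<open>Suc k\<close> indices is itself a bordered determinant, with
  border \<open>h n\<close>, \<open>g n\<close> for its last index \<open>n\<close>. Summing the
  other indices first gives the minor, and the last sum is a trace.\<close>

lemma ext_trace_minor:
  fixes A :: "'a::complex_hilbert_space \<Rightarrow>\<^sub>L 'a"
  assumes rep: "nuclear_rep N g h A"
  shows "of_nat (Suc k) * ext_trace (Suc k) A = op_trace (A o\<^sub>L fredholm_minor A k)"
proof -
  note A = nuclear_rep_bounded_ops[OF rep]
  have "((\<lambda>(n, ns). wedge (map h (ns @ [n])) (map g (ns @ [n]))) has_sum (fact (Suc k) * ext_trace (Suc k) A)) (N \<times> tuples k N)"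
    using nuclear_rep_ext_trace[OF rep, of "Suc k"] unfolding has_sum_tuples_Suc .
  then have "((\<lambda>n. fact k * cinner (g n) (blinfun_apply (fredholm_minor A k) (h n))) has_sum (fact (Suc k) * ext_trace (Suc k) A)) N"
    by (rule has_sum_Sigma') (use nuclear_rep_minor[OF rep] in simp)
  moreover have "((\<lambda>n. fact k * cinner (g n) (blinfun_apply (fredholm_minor A k) (h n))) has_sum (fact k * op_trace (A o\<^sub>L fredholm_minor A k))) N"
    by (intro has_sum_cmult_right nuclear_rep_trace[OF rep] fredholm_minor_bounded_ops A)
  ultimately have "fact (Suc k) * ext_trace (Suc k) A = fact k * op_trace (A o\<^sub>L fredholm_minor A k)"
    by (rule has_sum_unique)
  then have "fact k * (of_nat (Suc k) * ext_trace (Suc k) A) = fact k * op_trace (A o\<^sub>L fredholm_minor A k)"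
    by (simp add: algebra_simps)
  then show ?thesis
    by (simp only: mult_cancel_left fact_nonzero simp_thms)
qed

lemma ext_trace_0:
  fixes A :: "'a::complex_hilbert_space \<Rightarrow>\<^sub>L 'a"
  assumes rep: "nuclear_rep N g h A"
  shows "ext_trace 0 A = 1"
proof -
  have "((\<lambda>ns. wedge (map h ns) (map g ns)) has_sum 1) (tuples 0 N)"
    by (rule has_sum_finiteI) auto
  then show ?thesis
    using nuclear_rep_ext_trace[OF rep, of 0] has_sum_unique by fastforce
qed

text \<open>Hadamard's inequality bounds each determinant by the product of the weights of its
  indices, and these products sum to \<open>a ^ k\<close> over all tuples. The surviving factorial
  yields an exponential majorant for every \<open>a\<close>.\<close>

lemma
  fixes A :: "'a::complex_hilbert_space \<Rightarrow>\<^sub>L 'a"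
  assumes rep: "nuclear_rep N g h A" and a: "((\<lambda>n. (norm (g n))\<^sup>2) has_sum a) N"
  shows ext_trace_le: "cmod (ext_trace k A) \<le> a ^ k / fact k"
    and norm_fredholm_minor_le: "norm (fredholm_minor A k) \<le> a ^ k / fact k"
proof -
  have w: "((\<lambda>ns. (prod_list (map (\<lambda>n. norm (g n)) ns))\<^sup>2) has_sum a ^ k) (tuples k N)"
    using has_sum_tuples_power[OF a, of k] by (simp add: prod_list_map_power2)
  have "cmod (fact k * ext_trace k A) \<le> a ^ k"
  proof (rule norm_infsum_le[OF nuclear_rep_ext_trace[OF rep] w])
    fix ns assume ns: "ns \<in> tuples k N"
    show "cmod (wedge (map h ns) (map g ns)) \<le> (prod_list (map (\<lambda>n. norm (g n)) ns))\<^sup>2"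
      using hadamard[of "map h ns" "map g ns"] nuclear_rep_tuple_norm[OF rep ns] by (simp add: o_def)
  qed
  then show "cmod (ext_trace k A) \<le> a ^ k / fact k"
    by (simp add: norm_mult field_simps)
  have a0: "0 \<le> a"
    by (rule has_sum_nonneg[OF a]) simp
  let ?D = "fredholm_minor A k"
  have unit: "cmod (cinner x (blinfun_apply ?D y)) \<le> a ^ k / fact k" if "norm x = 1" "norm y = 1" for x y
  proof -
    have "cmod (fact k * cinner x (blinfun_apply ?D y)) \<le> a ^ k"
    proof (rule norm_infsum_le[OF nuclear_rep_minor[OF rep] w])
      fix ns assume ns: "ns \<in> tuples k N"
      show "cmod (wedge (map h ns @ [y]) (map g ns @ [x])) \<le> (prod_list (map (\<lambda>n. norm (g n)) ns))\<^sup>2"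
        using hadamard[of "map h ns @ [y]" "map g ns @ [x]"] nuclear_rep_tuple_norm[OF rep ns] that
        by (simp add: o_def)
    qed
    then show ?thesis
      by (simp add: norm_mult field_simps)
  qed
  show "norm ?D \<le> a ^ k / fact k"
    by (rule norm_blinfun_le_cinner) (use unit a0 in auto)
qed


section \<open>The Fredholm determinant and its adjugate\<close>

lemma exp_sums_real: "(\<lambda>k. a ^ k / fact k) sums exp a" for a :: real
  using exp_converges[of a] by (simp add: divide_inverse mult.commute)

lemma norm_sums_le:
  fixes f :: "nat \<Rightarrow> 'b::banach"
  assumes "f sums s" "g sums t" "\<And>k. norm (f k) \<le> g k"
  shows "norm s \<le> t"
proof -
  have "norm (suminf f) \<le> suminf g"
    using assms(3) sums_summable[OF assms(2)] by (rule norm_suminf_le)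
  then show ?thesis
    using assms(1,2) by (simp add: sums_iff)
qed

lemma sums_shift:
  fixes f :: "nat \<Rightarrow> 'b::real_normed_vector"
  shows "f sums s \<Longrightarrow> (\<lambda>k. f (Suc k)) sums (s - f 0)"
  by (subst sums_Suc_iff) simp

lemma trace_class_rep:
  fixes A :: "'a::complex_hilbert_space \<Rightarrow>\<^sub>L 'a"
  assumes "trace_class A"
  obtains g h :: "'a \<Rightarrow> 'a" and a :: real where "nuclear_rep hbasis g h A" "((\<lambda>n. (norm (g n))\<^sup>2) has_sum a) hbasis"
  by (rule trace_class_nuclear_rep[OF assms]) (rule that)

text \<open>The candidate for the product of determinant and inverse, given by a series that
  converges whether or not \<open>I + A\<close> is invertible.\<close>

definition fredholm_adj :: "('a::complex_hilbert_space \<Rightarrow>\<^sub>L 'a) \<Rightarrow> ('a \<Rightarrow>\<^sub>L 'a)"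
  where "fredholm_adj A = (\<Sum>k. fredholm_minor A k)"

lemma fredholm_minor_sums:
  fixes A :: "'a::complex_hilbert_space \<Rightarrow>\<^sub>L 'a"
  assumes "trace_class A"
  shows "fredholm_minor A sums fredholm_adj A"
proof -
  obtain g h :: "'a \<Rightarrow> 'a" and a :: real where rep: "nuclear_rep hbasis g h A" "((\<lambda>n. (norm (g n))\<^sup>2) has_sum a) hbasis"
    by (rule trace_class_rep[OF assms])
  have "summable (fredholm_minor A)"
    by (rule summable_comparison_test'[OF sums_summable[OF exp_sums_real], of 0])
      (rule norm_fredholm_minor_le[OF rep])
  then show ?thesis
    unfolding fredholm_adj_def by (rule summable_sums)
qed

lemma ext_trace_sums:
  fixes A :: "'a::complex_hilbert_space \<Rightarrow>\<^sub>L 'a"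
  assumes "trace_class A"
  shows "(\<lambda>k. ext_trace k A) sums fredholm_det A"
proof -
  obtain g h :: "'a \<Rightarrow> 'a" and a :: real where rep: "nuclear_rep hbasis g h A" "((\<lambda>n. (norm (g n))\<^sup>2) has_sum a) hbasis"
    by (rule trace_class_rep[OF assms])
  have "summable (\<lambda>k. ext_trace k A)"
    by (rule summable_comparison_test'[OF sums_summable[OF exp_sums_real], of 0])
      (rule ext_trace_le[OF rep])
  then show ?thesis
    unfolding fredholm_det_def by (rule summable_sums)
qed

lemma ext_trace_0_trace_class: "trace_class A \<Longrightarrow> ext_trace 0 A = 1"
  by (erule trace_class_rep) (rule ext_trace_0)

lemma ext_trace_Suc_trace_class:
  "trace_class A \<Longrightarrow> of_nat (Suc k) * ext_trace (Suc k) A = op_trace (A o\<^sub>L fredholm_minor A k)"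
  by (erule trace_class_rep) (rule ext_trace_minor)

lemma fredholm_adj_bounded_ops:
  assumes "trace_class A"
  shows "fredholm_adj A \<in> bounded_ops"
  unfolding fredholm_adj_def using assms
  by (intro bounded_ops_suminf fredholm_minor_bounded_ops trace_class_bounded_ops sums_summable[OF fredholm_minor_sums])

lemma
  assumes tc: "trace_class A"
  shows fredholm_adj_right: "(id_blinfun + A) o\<^sub>L fredholm_adj A = fredholm_det A *\<^sub>C id_blinfun"
    and fredholm_adj_left: "fredholm_adj A o\<^sub>L (id_blinfun + A) = fredholm_det A *\<^sub>C id_blinfun"
proof -
  have bl: "bounded_linear (\<lambda>Z. A o\<^sub>L Z)" "bounded_linear (\<lambda>Z. Z o\<^sub>L A)"
    using bounded_bilinear_blinfun_compose
    by (auto intro: bounded_bilinear.bounded_linear_right bounded_bilinear.bounded_linear_left)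
  have AD: "(\<lambda>k. A o\<^sub>L fredholm_minor A k) sums (A o\<^sub>L fredholm_adj A)"
    by (rule bounded_linear.sums[OF bl(1) fredholm_minor_sums[OF tc]])
  have DA: "(\<lambda>k. fredholm_minor A k o\<^sub>L A) sums (fredholm_adj A o\<^sub>L A)"
    by (rule bounded_linear.sums[OF bl(2) fredholm_minor_sums[OF tc]])
  have comm: "fredholm_adj A o\<^sub>L A = A o\<^sub>L fredholm_adj A"
    using AD DA fredholm_minor_commute[OF trace_class_bounded_ops[OF tc]] sums_unique2 by simp
  have "(\<lambda>k. ext_trace k A *\<^sub>C id_blinfun :: 'a \<Rightarrow>\<^sub>L 'a) sums (fredholm_det A *\<^sub>C id_blinfun)"
    by (rule bounded_linear.sums[OF scaleC.bounded_linear_left ext_trace_sums[OF tc]])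
  then have "(\<lambda>k. ext_trace (Suc k) A *\<^sub>C id_blinfun :: 'a \<Rightarrow>\<^sub>L 'a) sums (fredholm_det A *\<^sub>C id_blinfun - ext_trace 0 A *\<^sub>C id_blinfun)"
    by (rule sums_shift)
  moreover have "(\<lambda>k. fredholm_minor A (Suc k)) sums (fredholm_adj A - id_blinfun)"
    using sums_shift[OF fredholm_minor_sums[OF tc]] by (simp only: fredholm_minor.simps(1))
  \<comment> \<open>The recursion for the minors is summed over all degrees; the shift drops the
    terms of degree zero, which are the identity on both sides.\<close>
  then have "(\<lambda>k. fredholm_minor A (Suc k) + (A o\<^sub>L fredholm_minor A k)) sums (fredholm_adj A - id_blinfun + (A o\<^sub>L fredholm_adj A))"
    by (rule sums_add[OF _ AD])
  then have "(\<lambda>k. ext_trace (Suc k) A *\<^sub>C id_blinfun :: 'a \<Rightarrow>\<^sub>L 'a) sums (fredholm_adj A - id_blinfun + (A o\<^sub>L fredholm_adj A))"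
    by simp
  ultimately have "fredholm_adj A - id_blinfun + (A o\<^sub>L fredholm_adj A) = fredholm_det A *\<^sub>C id_blinfun - id_blinfun"
    using sums_unique2[of "\<lambda>k. ext_trace (Suc k) A *\<^sub>C (id_blinfun :: 'a \<Rightarrow>\<^sub>L 'a)"]
    by (simp add: ext_trace_0_trace_class[OF tc])
  then have eq: "fredholm_adj A + (A o\<^sub>L fredholm_adj A) = fredholm_det A *\<^sub>C id_blinfun"
    by (simp add: algebra_simps)
  have "(id_blinfun + A) o\<^sub>L fredholm_adj A = fredholm_adj A + (A o\<^sub>L fredholm_adj A)"
    by (rule blinfun_eqI) (simp add: blinfun.add_left)
  then show "(id_blinfun + A) o\<^sub>L fredholm_adj A = fredholm_det A *\<^sub>C id_blinfun"
    using eq by simp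
  have "fredholm_adj A o\<^sub>L (id_blinfun + A) = fredholm_adj A + (fredholm_adj A o\<^sub>L A)"
    by (rule blinfun_eqI) (simp add: blinfun.add_left blinfun.add_right)
  then show "fredholm_adj A o\<^sub>L (id_blinfun + A) = fredholm_det A *\<^sub>C id_blinfun"
    using eq comm by simp
qed

lemma fredholm_det_nonzero_inverse:
  assumes tc: "trace_class A" and nz: "fredholm_det A \<noteq> 0"
  shows "is_op_inverse (id_blinfun + A) ((1 / fredholm_det A) *\<^sub>C fredholm_adj A)"
proof -
  have 1: "blinfun_apply (fredholm_adj A) x + blinfun_apply A (blinfun_apply (fredholm_adj A) x) = fredholm_det A *\<^sub>C x" for x
    using arg_cong[OF fredholm_adj_right[OF tc], of "\<lambda>T. blinfun_apply T x"]
    by (simp add: blinfun.add_left scaleC_blinfun.rep_eq)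
  have 2: "blinfun_apply (fredholm_adj A) x + blinfun_apply (fredholm_adj A) (blinfun_apply A x) = fredholm_det A *\<^sub>C x" for x
    using arg_cong[OF fredholm_adj_left[OF tc], of "\<lambda>T. blinfun_apply T x"]
    by (simp add: blinfun.add_left blinfun.add_right scaleC_blinfun.rep_eq)
  have A: "A \<in> bounded_ops"
    using tc by (rule trace_class_bounded_ops)
  show ?thesis
    unfolding is_op_inverse_def blinfun_eq_iff
    using nz fredholm_adj_bounded_ops[OF tc]
    by (auto simp: scaleC_blinfun.rep_eq blinfun.add_left blinfun.add_right bounded_opsD[OF A] 1 2 scaleC_scaleC
        simp flip: scaleC_add_right)
qed

subsection \<open>Traces of products\<close>

lemma op_trace_scaleC: "op_trace (c *\<^sub>C T) = c * op_trace T"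
  by (simp add: op_trace_def trace_on_def scaleC_blinfun.rep_eq cinner_scaleC_right infsum_cmult_right')

lemma blinfun_compose_scaleC_left: "(c *\<^sub>C S) o\<^sub>L T = c *\<^sub>C (S o\<^sub>L T)"
  by (rule blinfun_eqI) (simp add: scaleC_blinfun.rep_eq)

lemma blinfun_compose_scaleC_right: "S \<in> bounded_ops \<Longrightarrow> S o\<^sub>L (c *\<^sub>C T) = c *\<^sub>C (S o\<^sub>L T)"
  by (rule blinfun_eqI) (simp add: scaleC_blinfun.rep_eq bounded_opsD)

text \<open>A nuclear representation enters because an infinite sum is additive only for summable
  families.\<close>

lemma op_trace_compose_diff:
  fixes A :: "'a::complex_hilbert_space \<Rightarrow>\<^sub>L 'a"
  assumes tc: "trace_class A" and B: "B \<in> bounded_ops" "C \<in> bounded_ops"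
  shows "op_trace (A o\<^sub>L (B - C)) = op_trace (A o\<^sub>L B) - op_trace (A o\<^sub>L C)"
proof -
  obtain g h :: "'a \<Rightarrow> 'a" and a :: real where rep: "nuclear_rep hbasis g h A" "((\<lambda>n. (norm (g n))\<^sup>2) has_sum a) hbasis"
    by (rule trace_class_rep[OF tc])
  have "((\<lambda>n. cinner (g n) (blinfun_apply B (h n)) + (- 1) * cinner (g n) (blinfun_apply C (h n)))
      has_sum (op_trace (A o\<^sub>L B) + (- 1) * op_trace (A o\<^sub>L C))) hbasis"
    by (intro has_sum_add has_sum_cmult_right nuclear_rep_trace[OF rep(1)] B)
  then have "((\<lambda>n. cinner (g n) (blinfun_apply (B - C) (h n))) has_sum (op_trace (A o\<^sub>L B) - op_trace (A o\<^sub>L C))) hbasis"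
    by (simp add: blinfun.diff_left cinner.diff_right)
  then show ?thesis
    using nuclear_rep_trace[OF rep(1), of "B - C"] B has_sum_unique by blast
qed

lemma op_trace_compose_le:
  fixes A :: "'a::complex_hilbert_space \<Rightarrow>\<^sub>L 'a"
  assumes tc: "trace_class A" and B: "B \<in> bounded_ops"
  shows "cmod (op_trace (A o\<^sub>L B)) \<le> trace_norm A * norm B"
proof -
  obtain g h :: "'a \<Rightarrow> 'a" where rep: "nuclear_rep hbasis g h A" "((\<lambda>n. (norm (g n))\<^sup>2) has_sum trace_norm A) hbasis"
    by (rule trace_class_nuclear_rep[OF tc])
  show ?thesis
  proof (rule norm_infsum_le[OF nuclear_rep_trace[OF rep(1) B] has_sum_cmult_left[OF rep(2)]])
    fix n assume n: "n \<in> (hbasis :: 'a set)"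
    have "cmod (cinner (g n) (blinfun_apply B (h n))) \<le> norm (g n) * (norm B * norm (h n))"
      using norm_cinner_le norm_blinfun by (meson mult_left_mono norm_ge_zero order_trans)
    then show "cmod (cinner (g n) (blinfun_apply B (h n))) \<le> (norm (g n))\<^sup>2 * norm B"
      using nuclear_repD(1)[OF rep(1) n] by (simp add: power2_eq_square mult_ac)
  qed
qed

lemma op_trace_compose_tendsto:
  assumes tc: "trace_class A" and F: "(F \<longlongrightarrow> L) net" "\<And>x. F x \<in> bounded_ops" "L \<in> bounded_ops"
  shows "((\<lambda>x. op_trace (A o\<^sub>L F x)) \<longlongrightarrow> op_trace (A o\<^sub>L L)) net"
proof -
  define a where "a = trace_norm A"
  have "((\<lambda>x. a * norm (F x - L)) \<longlongrightarrow> a * norm (L - L)) net"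
    by (intro tendsto_intros F(1))
  then have lim: "((\<lambda>x. a * norm (F x - L)) \<longlongrightarrow> 0) net"
    by simp
  have "cmod (op_trace (A o\<^sub>L F x) - op_trace (A o\<^sub>L L)) \<le> a * norm (F x - L)" for x
    using op_trace_compose_le[OF tc, of "F x - L"] op_trace_compose_diff[OF tc F(2)[of x] F(3)] F by (simp add: bounded_ops_diff a_def)
  then have "((\<lambda>x. op_trace (A o\<^sub>L F x) - op_trace (A o\<^sub>L L)) \<longlongrightarrow> 0) net"
    by (intro tendsto_0_le[OF lim, where K = 1] always_eventually) (auto intro: order_trans[OF _ abs_ge_self])
  then show ?thesis
    by (simp add: LIM_zero_iff)
qed

lemma op_trace_compose_sums:
  assumes tc: "trace_class A" and F: "F sums S" "\<And>k. F k \<in> bounded_ops"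
  shows "(\<lambda>k. op_trace (A o\<^sub>L F k)) sums op_trace (A o\<^sub>L S)"
proof -
  have b: "(\<Sum>k<n. F k) \<in> bounded_ops" for n
    by (induction n) (auto simp: F(2))
  have fin: "op_trace (A o\<^sub>L (\<Sum>k<n. F k)) = (\<Sum>k<n. op_trace (A o\<^sub>L F k))" for n
  proof (induction n)
    case 0
    have "op_trace (0 :: 'a \<Rightarrow>\<^sub>L 'a) = 0"
      by (simp add: op_trace_def trace_on_def cinner.zero_right)
    then show ?case
      by simp
  next
    case (Suc n)
    have "op_trace (A o\<^sub>L F n) = op_trace (A o\<^sub>L ((\<Sum>k<Suc n. F k) - (\<Sum>k<n. F k)))"
      by simp
    also have "\<dots> = op_trace (A o\<^sub>L (\<Sum>k<Suc n. F k)) - op_trace (A o\<^sub>L (\<Sum>k<n. F k))"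
      by (rule op_trace_compose_diff[OF tc b b])
    finally show ?case
      using Suc by simp
  qed
  have "S \<in> bounded_ops"
    by (rule bounded_ops_lim[OF F(1)[unfolded sums_def]]) (simp_all add: b)
  then have "(\<lambda>n. op_trace (A o\<^sub>L (\<Sum>k<n. F k))) \<longlonglongrightarrow> op_trace (A o\<^sub>L S)"
    using F(1) b unfolding sums_def by (intro op_trace_compose_tendsto[OF tc])
  then show ?thesis
    unfolding sums_def fin .
qed

subsection \<open>Dependence on a complex factor\<close>

text \<open>Homogeneity is derived from the two recursions together: the trace identity passes it
  from a minor to the next coefficient, and the recursion of the minors from there to the next
  minor.\<close>

lemma
  assumes tc: "trace_class A"
  shows ext_trace_scaleC: "ext_trace k (c *\<^sub>C A) = c ^ k * ext_trace k A"
    and fredholm_minor_scaleC: "fredholm_minor (c *\<^sub>C A) k = c ^ k *\<^sub>C fredholm_minor A k"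
proof -
  note tc' = trace_class_scaleC[OF tc, of c]
  have A: "A \<in> bounded_ops"
    using tc by (rule trace_class_bounded_ops)
  have "ext_trace k (c *\<^sub>C A) = c ^ k * ext_trace k A \<and> fredholm_minor (c *\<^sub>C A) k = c ^ k *\<^sub>C fredholm_minor A k"
  proof (induction k)
    case 0
    then show ?case
      using ext_trace_0_trace_class[OF tc] ext_trace_0_trace_class[OF tc'] by simp
  next
    case (Suc k)
    have comp: "(c *\<^sub>C A) o\<^sub>L fredholm_minor (c *\<^sub>C A) k = c ^ Suc k *\<^sub>C (A o\<^sub>L fredholm_minor A k)"
      using Suc by (simp add: blinfun_compose_scaleC_left blinfun_compose_scaleC_right[OF A] scaleC_scaleC)
    have "of_nat (Suc k) * ext_trace (Suc k) (c *\<^sub>C A) = of_nat (Suc k) * (c ^ Suc k * ext_trace (Suc k) A)"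
      unfolding ext_trace_Suc_trace_class[OF tc'] comp op_trace_scaleC ext_trace_Suc_trace_class[OF tc, symmetric]
      by (simp only: mult_ac)
    then have e: "ext_trace (Suc k) (c *\<^sub>C A) = c ^ Suc k * ext_trace (Suc k) A"
      by (simp only: mult_cancel_left of_nat_eq_0_iff) simp
    then show ?case
      using comp by (simp add: scaleC_scaleC cvec.scale_right_diff_distrib del: power_Suc)
  qed
  then show "ext_trace k (c *\<^sub>C A) = c ^ k * ext_trace k A"
    "fredholm_minor (c *\<^sub>C A) k = c ^ k *\<^sub>C fredholm_minor A k"
    by auto
qed

lemma fredholm_det_scaleC_has_derivative:
  assumes tc: "trace_class A"
  shows "((\<lambda>\<xi>. fredholm_det (\<xi> *\<^sub>C A)) has_field_derivative op_trace (A o\<^sub>L fredholm_adj (\<xi> *\<^sub>C A))) (at \<xi>)"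
proof -
  have A: "A \<in> bounded_ops"
    using tc by (rule trace_class_bounded_ops)
  have sums: "(\<lambda>k. ext_trace k A * \<xi> ^ k) sums fredholm_det (\<xi> *\<^sub>C A)" for \<xi>
    using ext_trace_sums[OF trace_class_scaleC[OF tc, of \<xi>]] by (simp add: ext_trace_scaleC[OF tc] mult.commute)
  have "(\<lambda>k. op_trace (A o\<^sub>L fredholm_minor (\<xi> *\<^sub>C A) k)) sums op_trace (A o\<^sub>L fredholm_adj (\<xi> *\<^sub>C A))"
    by (intro op_trace_compose_sums tc fredholm_minor_sums trace_class_scaleC fredholm_minor_bounded_ops bounded_ops_scaleC A)
  \<comment> \<open>The differentiated power series has coefficients \<open>Suc k\<close> times the
    next exterior trace, which \<open>ext_trace_Suc_trace_class\<close> turns into traces of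
    minors.\<close>
  moreover have "op_trace (A o\<^sub>L fredholm_minor (\<xi> *\<^sub>C A) k) = diffs (\<lambda>k. ext_trace k A) k * \<xi> ^ k" for k
    unfolding diffs_def ext_trace_Suc_trace_class[OF tc]
    by (simp add: fredholm_minor_scaleC[OF tc] blinfun_compose_scaleC_right[OF A] op_trace_scaleC)
  ultimately have "(\<Sum>k. diffs (\<lambda>k. ext_trace k A) k * \<xi> ^ k) = op_trace (A o\<^sub>L fredholm_adj (\<xi> *\<^sub>C A))"
    by (simp add: sums_iff)
  moreover have "((\<lambda>\<xi>. \<Sum>k. ext_trace k A * \<xi> ^ k) has_field_derivative (\<Sum>k. diffs (\<lambda>k. ext_trace k A) k * \<xi> ^ k)) (at \<xi>)"
    by (rule termdiffs_strong_converges_everywhere) (rule sums_summable[OF sums])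
  moreover have "(\<lambda>\<xi>. \<Sum>k. ext_trace k A * \<xi> ^ k) = (\<lambda>\<xi>. fredholm_det (\<xi> *\<^sub>C A))"
    using sums by (simp add: sums_iff fun_eq_iff)
  ultimately show ?thesis
    by simp
qed

subsection \<open>Perturbations\<close>

text \<open>The tuples over \<open>N \<union> N'\<close> with exactly one entry in \<open>N'\<close> contribute the first-order part of a
  symmetric sum.\<close>

lemma tuples_single_exchange:
  fixes G :: "'i list \<Rightarrow> 'b::real_normed_field"
  assumes disj: "N \<inter> N' = {}"
    and sym: "\<And>ns i. ns \<in> tuples (Suc m) (N \<union> N') \<Longrightarrow> i < Suc m \<Longrightarrow> G (permute_list (Transposition.transpose i m) ns) = G ns"
    and s: "((\<lambda>(n, ns). G (ns @ [n])) has_sum s) (N' \<times> tuples m N)"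
  defines "T \<equiv> \<lambda>i. {ns \<in> tuples (Suc m) (N \<union> N'). ns ! i \<in> N' \<and> (\<forall>j<Suc m. j \<noteq> i \<longrightarrow> ns ! j \<in> N)}"
  shows "(G has_sum (of_nat (Suc m) * s)) (\<Union>i<Suc m. T i)"
proof -
  have bij: "bij_betw (\<lambda>(n, ns). ns @ [n]) (N' \<times> tuples m N) (T m)"
  proof (rule bij_betwI[where g = "\<lambda>ns. (last ns, butlast ns)"])
    show "(\<lambda>(n, ns). ns @ [n]) \<in> N' \<times> tuples m N \<rightarrow> T m"
      by (auto simp: T_def tuples_def nth_append subset_iff)
    show "(\<lambda>ns. (last ns, butlast ns)) \<in> T m \<rightarrow> N' \<times> tuples m N"
    proof
      fix ns assume ns: "ns \<in> T m"
      then have l: "length ns = Suc m"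
        by (simp add: T_def tuples_def)
      have "last ns = ns ! m"
        using l last_conv_nth[of ns] by (cases ns) auto
      moreover have "set (butlast ns) \<subseteq> N"
        using ns l by (auto simp: T_def in_set_conv_nth nth_butlast)
      ultimately show "(last ns, butlast ns) \<in> N' \<times> tuples m N"
        using ns l by (auto simp: T_def tuples_def)
    qed
    show "(case (last y, butlast y) of (n, ns) \<Rightarrow> ns @ [n]) = y" if "y \<in> T m" for y
    proof -
      have "y \<noteq> []"
        using that by (auto simp: T_def tuples_def)
      then show ?thesis by simp
    qed
  qed auto
  have Tm: "(G has_sum s) (T m)"
    using has_sum_reindex_bij_betw[OF bij, of G] s by (simp add: case_prod_unfold)
  have T: "(G has_sum s) (T i)" if i: "i < Suc m" for i
  proof -
    let ?t = "Transposition.transpose i m"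
    have t: "?t permutes {..<Suc m}"
      using i by (intro permutes_swap_id) auto
    have tt: "permute_list ?t (permute_list ?t ns) = ns" if "length ns = Suc m" for ns :: "'i list"
      using permute_list_compose[of ?t ns ?t] t that by simp
    have nth: "permute_list ?t ns ! j = ns ! ?t j" if "length ns = Suc m" "j < Suc m" for ns :: "'i list" and j
      using t that by (simp add: permute_list_nth)
    have "bij_betw (permute_list ?t) (T i) (T m)"
    proof (rule bij_betwI[where g = "permute_list ?t"])
      show "permute_list ?t \<in> T i \<rightarrow> T m"
        using t i by (auto simp: T_def tuples_def nth Transposition.transpose_def)
      show "permute_list ?t \<in> T m \<rightarrow> T i"
        using t i by (auto simp: T_def tuples_def nth Transposition.transpose_def)
    qed (auto simp: T_def tuples_def tt)
    then have "((\<lambda>ns. G (permute_list ?t ns)) has_sum s) (T i)"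
      using has_sum_reindex_bij_betw[of "permute_list ?t" "T i" "T m" G] Tm by blast
    then show ?thesis
      by (rule has_sum_cong[THEN iffD1, rotated]) (use sym i in \<open>auto simp: T_def\<close>)
  qed
  have "(G has_sum (\<Sum>i<Suc m. s)) (\<Union>i<Suc m. T i)"
  proof (rule sum_has_sum)
    fix i j assume "i \<in> {..<Suc m}" "j \<in> {..<Suc m}" "i \<noteq> j"
    then show "T i \<inter> T j = {}"
      using disj by (force simp: T_def)
  qed (use T in auto)
  then show ?thesis
    by simp
qed

text \<open>After removing the tuples without entries in \<open>N'\<close> and those with exactly
  one, only tuples with at least two remain. Their total weight is found by the same removal for
  \<open>w\<close> and is the second-order Taylor remainder of the power at
  \<open>a\<close>.\<close>

lemma tuples_perturbation:
  fixes G :: "'i list \<Rightarrow> complex" and w :: "'i \<Rightarrow> real"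
  assumes disj: "N \<inter> N' = {}"
    and sym: "\<And>ns i. ns \<in> tuples (Suc m) (N \<union> N') \<Longrightarrow> i < Suc m \<Longrightarrow> G (permute_list (Transposition.transpose i m) ns) = G ns"
    and s: "((\<lambda>(n, ns). G (ns @ [n])) has_sum s) (N' \<times> tuples m N)"
    and t: "(G has_sum t) (tuples (Suc m) (N \<union> N'))" and t0: "(G has_sum t0) (tuples (Suc m) N)"
    and w: "(w has_sum a) N" "(w has_sum e) N'" "\<And>n. 0 \<le> w n"
    and bound: "\<And>ns. ns \<in> tuples (Suc m) (N \<union> N') \<Longrightarrow> cmod (G ns) \<le> prod_list (map w ns)"
  shows "cmod (t - t0 - of_nat (Suc m) * s) \<le> (a + e) ^ Suc m - a ^ Suc m - of_nat (Suc m) * (e * a ^ m)"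
proof -
  let ?W = "\<lambda>ns. prod_list (map w ns)"
  let ?M = "tuples (Suc m) (N \<union> N')"
  define U where "U = (\<Union>i<Suc m. {ns \<in> ?M. ns ! i \<in> N' \<and> (\<forall>j<Suc m. j \<noteq> i \<longrightarrow> ns ! j \<in> N)})"
  have U: "(G has_sum (of_nat (Suc m) * s)) U"
    unfolding U_def by (rule tuples_single_exchange[OF disj sym s])
  have "((\<lambda>(n, ns). w n * ?W ns) has_sum e * a ^ m) (N' \<times> tuples m N)"
    by (rule has_sum_product_nonneg[OF w(2) has_sum_tuples_power[OF w(1,3)]]) (auto intro!: prod_list_nonneg w)
  then have "((\<lambda>(n, ns). ?W (ns @ [n])) has_sum e * a ^ m) (N' \<times> tuples m N)"
    by (simp add: mult.commute)
  then have WU: "(?W has_sum (of_nat (Suc m) * (e * a ^ m))) U"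
    unfolding U_def
    by (rule tuples_single_exchange[OF disj, rotated])
      (auto intro!: prod_list_map_permute permutes_swap_id simp: tuples_def)
  have "(w has_sum (a + e)) (N \<union> N')"
    by (rule has_sum_Un_disjoint[OF w(1,2) disj])
  note WM = has_sum_tuples_power[OF this w(3), of "Suc m"]
  note WN = has_sum_tuples_power[OF w(1) w(3), of "Suc m"]
  have sub: "tuples (Suc m) N \<subseteq> ?M" "U \<subseteq> ?M - tuples (Suc m) N"
  proof -
    show "tuples (Suc m) N \<subseteq> ?M"
      by (auto simp: tuples_def)
    have "ns \<notin> tuples (Suc m) N" if "ns \<in> U" for ns
    proof -
      from that obtain i where "i < Suc m" "ns ! i \<in> N'" "length ns = Suc m"
        by (auto simp: U_def tuples_def)
      then have "ns ! i \<in> set ns" "ns ! i \<notin> N"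
        using disj by auto
      then show ?thesis
        by (auto simp: tuples_def)
    qed
    then show "U \<subseteq> ?M - tuples (Suc m) N"
      by (auto simp: U_def)
  qed
  have "(G has_sum (t - t0 - of_nat (Suc m) * s)) (?M - tuples (Suc m) N - U)"
    by (intro has_sum_Diff t t0 U sub)
  moreover have "(?W has_sum ((a + e) ^ Suc m - a ^ Suc m - of_nat (Suc m) * (e * a ^ m))) (?M - tuples (Suc m) N - U)"
    by (intro has_sum_Diff WM WN WU sub)
  ultimately show ?thesis
    by (rule norm_infsum_le) (use bound in auto)
qed

lemma wedge_exchange_symmetric:
  assumes "length ns = Suc m" "i < Suc m"
  shows "wedge (map h (permute_list (Transposition.transpose i m) ns)) (map g (permute_list (Transposition.transpose i m) ns))
    = wedge (map h ns) (map g ns)"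
proof -
  let ?t = "Transposition.transpose i m"
  have t: "?t permutes {..<length ns}"
    using assms by (intro permutes_swap_id) auto
  show ?thesis
    using wedge_permute_both[of "map g ns" "map h ns" ?t] t by (simp add: permute_list_map)
qed

text \<open>One pair \<open>g\<close>, \<open>h\<close> serves both operators over disjoint index
  sets, so that \<open>A + E\<close> is represented over the union and Fredholm's series for
  \<open>A\<close> is a part of that for \<open>A + E\<close>.\<close>

context
  fixes A E :: "'a::complex_hilbert_space \<Rightarrow>\<^sub>L 'a" and N N' :: "'i set" and g h :: "'i \<Rightarrow> 'a" and a e :: real
  assumes disj: "N \<inter> N' = {}"
    and A: "nuclear_rep N g h A" and E: "nuclear_rep N' g h E"
    and a: "((\<lambda>n. (norm (g n))\<^sup>2) has_sum a) N" and e: "((\<lambda>n. (norm (g n))\<^sup>2) has_sum e) N'"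
begin

lemma nuclear_rep_add: "nuclear_rep (N \<union> N') g h (A + E)"
  unfolding nuclear_rep_def
proof (intro conjI allI ballI)
  show "norm (g n) = norm (h n)" if "n \<in> N \<union> N'" for n
    using that nuclear_repD(1)[OF A, of n] nuclear_repD(1)[OF E, of n] by auto
  show "(\<lambda>n. (norm (g n))\<^sup>2) summable_on N \<union> N'"
    using has_sum_Un_disjoint[OF a e disj] by (auto simp: summable_on_def)
  show "((\<lambda>n. cinner (g n) x *\<^sub>C h n) has_sum blinfun_apply (A + E) x) (N \<union> N')" for x
    unfolding blinfun.add_left by (intro has_sum_Un_disjoint nuclear_repD(3)[OF A] nuclear_repD(3)[OF E] disj)
qed

lemma op_trace_add_compose:
  assumes "B \<in> bounded_ops"
  shows "op_trace ((A + E) o\<^sub>L B) = op_trace (A o\<^sub>L B) + op_trace (E o\<^sub>L B)"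
  using has_sum_unique[OF nuclear_rep_trace[OF nuclear_rep_add assms]
      has_sum_Un_disjoint[OF nuclear_rep_trace[OF A assms] nuclear_rep_trace[OF E assms] disj]] .

text \<open>In a tuple with a single index from the representation of \<open>E\<close>, moved to the
  end, the other indices sum to a minor of \<open>A\<close>; this makes the linear part a
  trace.\<close>

lemma ext_trace_perturbation:
  "cmod (ext_trace (Suc m) (A + E) - ext_trace (Suc m) A - op_trace (E o\<^sub>L fredholm_minor A m))
    \<le> ((a + e) ^ Suc m - a ^ Suc m - of_nat (Suc m) * (e * a ^ m)) / fact (Suc m)"
proof -
  let ?G = "\<lambda>ns. wedge (map h ns) (map g ns)"
  have s: "((\<lambda>(n, ns). ?G (ns @ [n])) has_sum (fact m * op_trace (E o\<^sub>L fredholm_minor A m))) (N' \<times> tuples m N)"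
  proof (rule has_sum_SigmaI)
    show "((\<lambda>ns. case (n, ns) of (n, ns) \<Rightarrow> ?G (ns @ [n])) has_sum
        fact m * cinner (g n) (blinfun_apply (fredholm_minor A m) (h n))) (tuples m N)" for n
      using nuclear_rep_minor[OF A, of "h n" "g n" m] by simp
    show "((\<lambda>n. fact m * cinner (g n) (blinfun_apply (fredholm_minor A m) (h n))) has_sum
        fact m * op_trace (E o\<^sub>L fredholm_minor A m)) N'"
      by (intro has_sum_cmult_right nuclear_rep_trace[OF E] fredholm_minor_bounded_ops nuclear_rep_bounded_ops[OF A])
    have "(\<lambda>(n, ns). ?G (ns @ [n])) summable_on (N \<union> N') \<times> tuples m (N \<union> N')"
      using has_sum_imp_summable[OF nuclear_rep_ext_trace[OF nuclear_rep_add, of "Suc m"]]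
      by (simp only: summable_on_tuples_Suc)
    then show "(\<lambda>(n, ns). ?G (ns @ [n])) summable_on N' \<times> tuples m N"
      by (rule summable_on_subset) (auto simp: tuples_def)
  qed
  have "cmod (fact (Suc m) * ext_trace (Suc m) (A + E) - fact (Suc m) * ext_trace (Suc m) A
      - of_nat (Suc m) * (fact m * op_trace (E o\<^sub>L fredholm_minor A m)))
      \<le> (a + e) ^ Suc m - a ^ Suc m - of_nat (Suc m) * (e * a ^ m)"
  proof (rule tuples_perturbation[where G = ?G, OF disj _ s nuclear_rep_ext_trace[OF nuclear_rep_add] nuclear_rep_ext_trace[OF A] a e])
    fix ns assume ns: "ns \<in> tuples (Suc m) (N \<union> N')"
    show "?G (permute_list (Transposition.transpose i m) ns) = ?G ns" if "i < Suc m" for i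
      using ns that by (intro wedge_exchange_symmetric) (auto simp: tuples_def)
    show "cmod (?G ns) \<le> prod_list (map (\<lambda>n. (norm (g n))\<^sup>2) ns)"
      using hadamard[of "map h ns" "map g ns"] nuclear_rep_tuple_norm[OF nuclear_rep_add ns]
      by (simp add: o_def prod_list_map_power2)
  qed simp_all
  also have "fact (Suc m) * ext_trace (Suc m) (A + E) - fact (Suc m) * ext_trace (Suc m) A
      - of_nat (Suc m) * (fact m * op_trace (E o\<^sub>L fredholm_minor A m))
      = fact (Suc m) * (ext_trace (Suc m) (A + E) - ext_trace (Suc m) A - op_trace (E o\<^sub>L fredholm_minor A m))"
    by (simp add: algebra_simps)
  finally have "fact (Suc m) * cmod (ext_trace (Suc m) (A + E) - ext_trace (Suc m) A - op_trace (E o\<^sub>L fredholm_minor A m))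
      \<le> (a + e) ^ Suc m - a ^ Suc m - of_nat (Suc m) * (e * a ^ m)"
    unfolding norm_mult norm_fact .
  then show ?thesis
    by (simp add: pos_le_divide_eq mult.commute del: fact_Suc power_Suc)
qed

text \<open>The bordered series of the two operators differ exactly by the tuples that meet
  \<open>N'\<close>, whose weights sum to the difference of the powers.\<close>

lemma fredholm_minor_perturbation:
  "norm (fredholm_minor (A + E) k - fredholm_minor A k) \<le> ((a + e) ^ k - a ^ k) / fact k"
proof (rule norm_blinfun_le_cinner)
  have "0 \<le> a" "0 \<le> e"
    by (rule has_sum_nonneg[OF a], simp) (rule has_sum_nonneg[OF e], simp)
  then show "0 \<le> ((a + e) ^ k - a ^ k) / fact k"
    by (simp add: power_mono)
  fix x y :: 'a assume unit: "norm x = 1" "norm y = 1"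
  let ?G = "\<lambda>ns. wedge (map h ns @ [y]) (map g ns @ [x])"
  let ?W = "\<lambda>ns. prod_list (map (\<lambda>n. (norm (g n))\<^sup>2) ns)"
  have sub: "tuples k N \<subseteq> tuples k (N \<union> N')"
    by (auto simp: tuples_def)
  have "(?G has_sum (fact k * cinner x (blinfun_apply (fredholm_minor (A + E) k) y)
      - fact k * cinner x (blinfun_apply (fredholm_minor A k) y))) (tuples k (N \<union> N') - tuples k N)"
    by (intro has_sum_Diff nuclear_rep_minor[OF nuclear_rep_add] nuclear_rep_minor[OF A] sub)
  moreover have "(?W has_sum ((a + e) ^ k - a ^ k)) (tuples k (N \<union> N') - tuples k N)"
    by (intro has_sum_Diff has_sum_tuples_power a has_sum_Un_disjoint[OF a e disj] sub) simp_all
  ultimately have "cmod (fact k * cinner x (blinfun_apply (fredholm_minor (A + E) k) y)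
      - fact k * cinner x (blinfun_apply (fredholm_minor A k) y)) \<le> (a + e) ^ k - a ^ k"
  proof (rule norm_infsum_le)
    fix ns assume "ns \<in> tuples k (N \<union> N') - tuples k N"
    then show "cmod (?G ns) \<le> ?W ns"
      using hadamard[of "map h ns @ [y]" "map g ns @ [x]"] nuclear_rep_tuple_norm[OF nuclear_rep_add, of ns k] unit
      by (simp add: o_def prod_list_map_power2)
  qed
  moreover have "fact k * cinner x (blinfun_apply (fredholm_minor (A + E) k) y)
      - fact k * cinner x (blinfun_apply (fredholm_minor A k) y)
      = fact k * cinner x (blinfun_apply (fredholm_minor (A + E) k - fredholm_minor A k) y)"
    by (simp add: blinfun.diff_left cinner.diff_right algebra_simps)
  ultimately have "fact k * cmod (cinner x (blinfun_apply (fredholm_minor (A + E) k - fredholm_minor A k) y)) \<le> (a + e) ^ k - a ^ k"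
    by (simp only: norm_mult norm_fact)
  then show "cmod (cinner x (blinfun_apply (fredholm_minor (A + E) k - fredholm_minor A k) y)) \<le> ((a + e) ^ k - a ^ k) / fact k"
    by (simp add: pos_le_divide_eq mult.commute)
qed

text \<open>First-order expansion of the determinant. The bounds in the single degrees add up to the
  second-order Taylor remainder of the exponential at \<open>a\<close>.\<close>

lemma fredholm_det_perturbation:
  "cmod (fredholm_det (A + E) - fredholm_det A - op_trace (E o\<^sub>L fredholm_adj A)) \<le> exp (a + e) - exp a - e * exp a"
proof -
  note tcA = nuclear_rep_trace_class[OF A] and tcE = nuclear_rep_trace_class[OF E]
    and tcAE = nuclear_rep_trace_class[OF nuclear_rep_add]
  have shift: "(\<lambda>k. ext_trace (Suc k) T) sums (fredholm_det T - 1)" if "trace_class T" for T :: "'a \<Rightarrow>\<^sub>L 'a"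
    using sums_shift[OF ext_trace_sums[OF that]] ext_trace_0_trace_class[OF that] by simp
  have "(\<lambda>k. ext_trace (Suc k) (A + E) - ext_trace (Suc k) A - op_trace (E o\<^sub>L fredholm_minor A k)) sums
      ((fredholm_det (A + E) - 1) - (fredholm_det A - 1) - op_trace (E o\<^sub>L fredholm_adj A))"
    by (intro sums_diff shift tcA tcAE op_trace_compose_sums[OF tcE] fredholm_minor_sums fredholm_minor_bounded_ops
        nuclear_rep_bounded_ops[OF A])
  then have 1: "(\<lambda>k. ext_trace (Suc k) (A + E) - ext_trace (Suc k) A - op_trace (E o\<^sub>L fredholm_minor A k)) sums
      (fredholm_det (A + E) - fredholm_det A - op_trace (E o\<^sub>L fredholm_adj A))"
    by simp
  have shift_exp: "(\<lambda>k. b ^ Suc k / fact (Suc k)) sums (exp b - 1)" for b :: real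
    using sums_shift[OF exp_sums_real[of b]] by (simp del: fact_Suc power_Suc)
  have "(\<lambda>k. (a + e) ^ Suc k / fact (Suc k) - a ^ Suc k / fact (Suc k) - e * (a ^ k / fact k)) sums
      ((exp (a + e) - 1) - (exp a - 1) - e * exp a)"
    by (intro sums_diff shift_exp sums_mult exp_sums_real)
  moreover have "(a + e) ^ Suc k / fact (Suc k) - a ^ Suc k / fact (Suc k) - e * (a ^ k / fact k)
      = ((a + e) ^ Suc k - a ^ Suc k - of_nat (Suc k) * (e * a ^ k)) / fact (Suc k)" for k
    by (simp add: diff_divide_distrib del: power_Suc)
  ultimately have 2: "(\<lambda>k. ((a + e) ^ Suc k - a ^ Suc k - of_nat (Suc k) * (e * a ^ k)) / fact (Suc k)) sums
      (exp (a + e) - exp a - e * exp a)"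
    by simp
  show ?thesis
    by (rule norm_sums_le[OF 1 2 ext_trace_perturbation])
qed

lemma fredholm_adj_perturbation:
  "norm (fredholm_adj (A + E) - fredholm_adj A) \<le> exp (a + e) - exp a"
proof -
  have 1: "(\<lambda>k. fredholm_minor (A + E) k - fredholm_minor A k) sums (fredholm_adj (A + E) - fredholm_adj A)"
    by (intro sums_diff fredholm_minor_sums nuclear_rep_trace_class[OF A] nuclear_rep_trace_class[OF nuclear_rep_add])
  have 2: "(\<lambda>k. ((a + e) ^ k - a ^ k) / fact k) sums (exp (a + e) - exp a)"
    unfolding diff_divide_distrib by (intro sums_diff exp_sums_real)
  show ?thesis
    by (rule norm_sums_le[OF 1 2 fredholm_minor_perturbation])
qed

end


subsection \<open>The trace norm\<close>

lemma nuclear_rep_image: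
  assumes rep: "nuclear_rep N g h A" and inj: "inj_on i N"
    and eq: "\<And>n. n \<in> N \<Longrightarrow> g' (i n) = g n" "\<And>n. n \<in> N \<Longrightarrow> h' (i n) = h n"
  shows "nuclear_rep (i ` N) g' h' A"
  unfolding nuclear_rep_def
proof (intro conjI allI)
  show "(\<lambda>n. (norm (g' n))\<^sup>2) summable_on i ` N"
    unfolding summable_on_reindex[OF inj] using nuclear_repD(2)[OF rep]
    by (rule summable_on_cong[THEN iffD1, rotated]) (simp add: eq)
  show "((\<lambda>n. cinner (g' n) x *\<^sub>C h' n) has_sum blinfun_apply A x) (i ` N)" for x
    unfolding has_sum_reindex[OF inj] using nuclear_repD(3)[OF rep, of x]
    by (rule has_sum_cong[THEN iffD1, rotated]) (simp add: eq)
qed (use nuclear_repD(1)[OF rep] eq in auto)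

text \<open>The sum type makes two copies of the basis disjoint, as the preceding perturbation
  results require.\<close>

lemma trace_class_two_reps:
  fixes A E :: "'a::complex_hilbert_space \<Rightarrow>\<^sub>L 'a"
  assumes "trace_class A" "trace_class E"
  obtains N N' and g h :: "'a + 'a \<Rightarrow> 'a" where "N \<inter> N' = {}"
    "nuclear_rep N g h A" "nuclear_rep N' g h E"
    "((\<lambda>n. (norm (g n))\<^sup>2) has_sum trace_norm A) N" "((\<lambda>n. (norm (g n))\<^sup>2) has_sum trace_norm E) N'"
proof -
  obtain g1 h1 :: "'a \<Rightarrow> 'a" where 1: "nuclear_rep hbasis g1 h1 A" "((\<lambda>n. (norm (g1 n))\<^sup>2) has_sum trace_norm A) hbasis"
    by (rule trace_class_nuclear_rep[OF assms(1)])
  obtain g2 h2 :: "'a \<Rightarrow> 'a" where 2: "nuclear_rep hbasis g2 h2 E" "((\<lambda>n. (norm (g2 n))\<^sup>2) has_sum trace_norm E) hbasis"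
    by (rule trace_class_nuclear_rep[OF assms(2)])
  show ?thesis
  proof (rule that[of "Inl ` hbasis" "Inr ` hbasis" "case_sum g1 g2" "case_sum h1 h2"])
    show "nuclear_rep (Inl ` hbasis) (case_sum g1 g2) (case_sum h1 h2) A"
      by (rule nuclear_rep_image[OF 1(1)]) auto
    show "nuclear_rep (Inr ` hbasis) (case_sum g1 g2) (case_sum h1 h2) E"
      by (rule nuclear_rep_image[OF 2(1)]) auto
    show "((\<lambda>n. (norm (case_sum g1 g2 n))\<^sup>2) has_sum trace_norm A) (Inl ` hbasis)"
      using 1(2) by (subst has_sum_reindex) (auto simp: o_def)
    show "((\<lambda>n. (norm (case_sum g1 g2 n))\<^sup>2) has_sum trace_norm E) (Inr ` hbasis)"
      using 2(2) by (subst has_sum_reindex) (auto simp: o_def)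
  qed auto
qed

text \<open>The weights can be taken to sum to the trace norms exactly. The triangle inequality is
  \<open>nuclear_rep_trace_norm_le\<close> for the joined representation.\<close>

lemma
  assumes A: "trace_class A" and E: "trace_class E"
  shows trace_class_add: "trace_class (A + E)"
    and trace_norm_triangle: "trace_norm (A + E) \<le> trace_norm A + trace_norm E"
    and op_trace_add_compose_trace_class:
      "B \<in> bounded_ops \<Longrightarrow> op_trace ((A + E) o\<^sub>L B) = op_trace (A o\<^sub>L B) + op_trace (E o\<^sub>L B)"
    and fredholm_det_perturbation_trace_norm:
      "cmod (fredholm_det (A + E) - fredholm_det A - op_trace (E o\<^sub>L fredholm_adj A))
        \<le> exp (trace_norm A + trace_norm E) - exp (trace_norm A) - trace_norm E * exp (trace_norm A)"
    and fredholm_adj_perturbation_trace_norm: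
      "norm (fredholm_adj (A + E) - fredholm_adj A) \<le> exp (trace_norm A + trace_norm E) - exp (trace_norm A)"
proof -
  obtain N N' and g h :: "'a + 'a \<Rightarrow> 'a" where *: "N \<inter> N' = {}"
    "nuclear_rep N g h A" "nuclear_rep N' g h E"
    "((\<lambda>n. (norm (g n))\<^sup>2) has_sum trace_norm A) N" "((\<lambda>n. (norm (g n))\<^sup>2) has_sum trace_norm E) N'"
    by (rule trace_class_two_reps[OF A E])
  show "trace_class (A + E)"
    by (rule nuclear_rep_trace_class[OF nuclear_rep_add[OF *]])
  show "trace_norm (A + E) \<le> trace_norm A + trace_norm E"
    using nuclear_rep_trace_norm_le[OF nuclear_rep_add[OF *]] infsumI[OF has_sum_Un_disjoint[OF *(4,5,1)]] by simp
  show "B \<in> bounded_ops \<Longrightarrow> op_trace ((A + E) o\<^sub>L B) = op_trace (A o\<^sub>L B) + op_trace (E o\<^sub>L B)"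
    by (rule op_trace_add_compose[OF *])
  show "cmod (fredholm_det (A + E) - fredholm_det A - op_trace (E o\<^sub>L fredholm_adj A))
        \<le> exp (trace_norm A + trace_norm E) - exp (trace_norm A) - trace_norm E * exp (trace_norm A)"
    by (rule fredholm_det_perturbation[OF *])
  show "norm (fredholm_adj (A + E) - fredholm_adj A) \<le> exp (trace_norm A + trace_norm E) - exp (trace_norm A)"
    by (rule fredholm_adj_perturbation[OF *])
qed

lemma trace_norm_nonneg:
  fixes A :: "'a::complex_hilbert_space \<Rightarrow>\<^sub>L 'a"
  assumes "trace_class A"
  shows "0 \<le> trace_norm A"
proof -
  obtain g h :: "'a \<Rightarrow> 'a" where "((\<lambda>n. (norm (g n))\<^sup>2) has_sum trace_norm A) hbasis"
    by (rule trace_class_nuclear_rep[OF assms])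
  then show ?thesis
    by (rule has_sum_nonneg) simp
qed

lemma trace_norm_scaleC: "trace_class A \<Longrightarrow> trace_norm (c *\<^sub>C A) = cmod c * trace_norm A"
  by (simp add: trace_norm_def op_abs_scaleC[OF trace_class_bounded_ops] scaleR_scaleC op_trace_scaleC)

section \<open>The zero operator and the zero space\<close>

lemma trace_class_0 [simp]: "trace_class 0"
proof -
  have "nuclear_rep {} (\<lambda>_::unit. 0) (\<lambda>_. 0) (0 :: 'a \<Rightarrow>\<^sub>L 'a)"
    by (simp add: nuclear_rep_def)
  then show ?thesis
    by (rule nuclear_rep_trace_class)
qed

lemma fredholm_det_0: "fredholm_det (0 :: 'a::complex_hilbert_space \<Rightarrow>\<^sub>L 'a) = 1"
proof -
  \<comment> \<open>Homogeneity with factor 0 kills every positive degree, while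
    \<open>0 ^ 0 = 1\<close> keeps degree zero.\<close>
  have "(\<lambda>k. ext_trace k (0 :: 'a \<Rightarrow>\<^sub>L 'a) * 0 ^ k) sums ext_trace 0 (0 :: 'a \<Rightarrow>\<^sub>L 'a)"
    by (rule powser_sums_zero)
  moreover have "ext_trace k (0 :: 'a \<Rightarrow>\<^sub>L 'a) * 0 ^ k = ext_trace k (0 :: 'a \<Rightarrow>\<^sub>L 'a)" for k
    using ext_trace_scaleC[OF trace_class_0, of k 0] by (simp add: mult.commute)
  ultimately have "(\<lambda>k. ext_trace k (0 :: 'a \<Rightarrow>\<^sub>L 'a)) sums 1"
    by (simp add: ext_trace_0_trace_class)
  then show ?thesis
    using ext_trace_sums[OF trace_class_0] sums_unique2 by blast
qed

lemma fredholm_adj_0: "fredholm_adj (0 :: 'a::complex_hilbert_space \<Rightarrow>\<^sub>L 'a) = id_blinfun"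
proof -
  have "fredholm_adj (0 :: 'a \<Rightarrow>\<^sub>L 'a) o\<^sub>L id_blinfun = id_blinfun"
    using fredholm_adj_left[OF trace_class_0, where 'a = 'a] by (simp add: fredholm_det_0)
  moreover have "fredholm_adj (0 :: 'a \<Rightarrow>\<^sub>L 'a) o\<^sub>L id_blinfun = fredholm_adj 0"
    by (rule blinfun_eqI) simp
  ultimately show ?thesis
    by simp
qed

text \<open>In the zero space the zero operator is invertible; this is why the determinant of an
  invertible operator is not excluded from vanishing by \<open>1 / 0 = 0\<close> alone.\<close>

lemma fredholm_det_nonzero_if_inverse:
  fixes A :: "'a::complex_hilbert_space \<Rightarrow>\<^sub>L 'a"
  assumes inv: "op_invertible (id_blinfun + A)"
    and eq: "op_inverse (id_blinfun + A) = (1 / fredholm_det A) *\<^sub>C D"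
  shows "fredholm_det A \<noteq> 0"
proof
  assume "fredholm_det A = 0"
  then have "op_inverse (id_blinfun + A) = 0"
    using eq by simp
  then have "id_blinfun = (0 :: 'a \<Rightarrow>\<^sub>L 'a)"
    using is_op_inverse_op_inverse[OF inv] by (simp add: is_op_inverse_def)
  then have "x = 0" for x :: 'a
    by (metis blinfun_apply_id_blinfun zero_blinfun.rep_eq)
  then have "A = 0"
    by (intro blinfun_eqI) metis
  then show False
    using \<open>fredholm_det A = 0\<close> fredholm_det_0[where 'a = 'a] by simp
qed

text \<open>The error of the difference quotient has two parts: the nonlinear remainder of the
  determinant, of second order in the trace norm of \<open>E w\<close>, and the trace of
  \<open>R w\<close> against the adjugate, bounded by the trace norm of \<open>R w\<close>. The
  latter is where trace-norm convergence is used.\<close>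

lemma fredholm_has_derivative_trace_norm:
  fixes f :: "complex \<Rightarrow> 'a::complex_hilbert_space \<Rightarrow>\<^sub>L 'a"
  assumes tc: "\<forall>\<^sub>F w in at z. trace_class (f w)" and tcz: "trace_class (f z)" and tcF: "trace_class F"
    and lim: "((\<lambda>w. trace_norm ((1 / (w - z)) *\<^sub>C (f w - f z) - F)) \<longlongrightarrow> 0) (at z)"
  shows "((\<lambda>w. fredholm_det (f w)) has_field_derivative op_trace (F o\<^sub>L fredholm_adj (f z))) (at z)"
    and "((\<lambda>w. fredholm_adj (f w)) \<longlongrightarrow> fredholm_adj (f z)) (at z)"
proof -
  define R where "R w = (1 / (w - z)) *\<^sub>C (f w - f z) - F" for w
  define E where "E w = f w - f z" for w
  define a \<rho> \<epsilon> where "a = trace_norm (f z)" and "\<rho> w = trace_norm (R w)" and "\<epsilon> w = trace_norm (E w)" for w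
  define \<phi> where "\<phi> = trace_norm F"
  have minus: "trace_class (- T)" if "trace_class T" for T :: "'a \<Rightarrow>\<^sub>L 'a"
    using trace_class_scaleC[OF that, of "- 1"] by (simp add: cvec.scale_minus_left)
  have tcE: "trace_class (E w)" if "trace_class (f w)" for w
    using trace_class_add[OF that minus[OF tcz]] by (simp add: E_def)
  have tcR: "trace_class (R w)" if "trace_class (f w)" for w
    using trace_class_add[OF trace_class_scaleC[OF tcE[OF that]] minus[OF tcF]] by (simp add: R_def E_def)
  \<comment> \<open>Written this way, the trace norm of \<open>E w\<close> is of the order of
    \<open>w - z\<close>; one factor of the quadratic remainder absorbs the division by
    \<open>w - z\<close>, the other tends to zero.\<close>
  have ER: "E w = (w - z) *\<^sub>C (R w + F)" if "w \<noteq> z" for w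
    using that by (simp add: R_def E_def scaleC_scaleC)
  have \<epsilon>_le: "\<epsilon> w \<le> cmod (w - z) * (\<rho> w + \<phi>)" if "trace_class (f w)" "w \<noteq> z" for w
    unfolding \<epsilon>_def \<rho>_def \<phi>_def ER[OF that(2)]
    using trace_norm_triangle[OF tcR[OF that(1)] tcF]
    by (simp add: trace_norm_scaleC trace_class_add tcR that tcF mult_left_mono)
  have \<rho>0: "(\<rho> \<longlongrightarrow> 0) (at z)"
    using lim unfolding \<rho>_def R_def .
  have good: "\<forall>\<^sub>F w in at z. trace_class (f w) \<and> w \<noteq> z"
    using tc eventually_at_ball'[of 1 z UNIV] by (auto elim: eventually_elim2 simp: eventually_at_filter)
  have \<epsilon>_nonneg: "0 \<le> \<epsilon> w" if "trace_class (f w)" for w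
    unfolding \<epsilon>_def by (rule trace_norm_nonneg[OF tcE[OF that]])
  have "((\<lambda>w. cmod (w - z) * (\<rho> w + \<phi>)) \<longlongrightarrow> cmod (z - z) * (0 + \<phi>)) (at z)"
    by (intro tendsto_intros \<rho>0)
  then have \<epsilon>0: "(\<epsilon> \<longlongrightarrow> 0) (at z)"
    using good by (intro real_tendsto_sandwich[of "\<lambda>_. 0" \<epsilon> "at z" "\<lambda>w. cmod (w - z) * (\<rho> w + \<phi>)" 0])
      (auto elim!: eventually_mono intro: \<epsilon>_nonneg \<epsilon>_le)
  have fE: "f w = f z + E w" for w
    by (simp add: E_def)
  show "((\<lambda>w. fredholm_adj (f w)) \<longlongrightarrow> fredholm_adj (f z)) (at z)"
  proof (rule LIM_zero_cancel, rule Lim_null_comparison)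
    show "\<forall>\<^sub>F w in at z. norm (fredholm_adj (f w) - fredholm_adj (f z)) \<le> exp (a + \<epsilon> w) - exp a"
      using good
    proof (rule eventually_mono)
      fix w assume "trace_class (f w) \<and> w \<noteq> z"
      then show "norm (fredholm_adj (f w) - fredholm_adj (f z)) \<le> exp (a + \<epsilon> w) - exp a"
        using fredholm_adj_perturbation_trace_norm[OF tcz tcE[of w]] fE[of w] by (simp add: a_def \<epsilon>_def)
    qed
    have "((\<lambda>w. exp (a + \<epsilon> w) - exp a) \<longlongrightarrow> exp (a + 0) - exp a) (at z)"
      by (intro tendsto_intros \<epsilon>0)
    then show "((\<lambda>w. exp (a + \<epsilon> w) - exp a) \<longlongrightarrow> 0) (at z)"
      by simp
  qed
  let ?D = "fredholm_adj (f z)"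
  have D: "?D \<in> bounded_ops"
    by (rule fredholm_adj_bounded_ops[OF tcz])
  show "((\<lambda>w. fredholm_det (f w)) has_field_derivative op_trace (F o\<^sub>L ?D)) (at z)"
    unfolding has_field_derivative_iff
  proof (rule LIM_zero_cancel, rule Lim_null_comparison)
    have "((\<lambda>w. exp a * (\<epsilon> w * (\<rho> w + \<phi>)) + \<rho> w * norm ?D) \<longlongrightarrow> exp a * (0 * (0 + \<phi>)) + 0 * norm ?D) (at z)"
      by (intro tendsto_intros \<epsilon>0 \<rho>0)
    then show "((\<lambda>w. exp a * (\<epsilon> w * (\<rho> w + \<phi>)) + \<rho> w * norm ?D) \<longlongrightarrow> 0) (at z)"
      by simp
    have "\<forall>\<^sub>F w in at z. \<epsilon> w < 1"
      using order_tendstoD(2)[OF \<epsilon>0, of 1] by simp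
    with good show "\<forall>\<^sub>F w in at z. norm ((fredholm_det (f w) - fredholm_det (f z)) / (w - z) - op_trace (F o\<^sub>L ?D))
        \<le> exp a * (\<epsilon> w * (\<rho> w + \<phi>)) + \<rho> w * norm ?D"
    proof (rule eventually_elim2)
      fix w assume "trace_class (f w) \<and> w \<noteq> z" and \<epsilon>1: "\<epsilon> w < 1"
      then have w: "trace_class (f w)" "w \<noteq> z" by auto
      have TE: "op_trace (E w o\<^sub>L ?D) = (w - z) * (op_trace (R w o\<^sub>L ?D) + op_trace (F o\<^sub>L ?D))"
        unfolding ER[OF w(2)] blinfun_compose_scaleC_left op_trace_scaleC
        by (simp add: op_trace_add_compose_trace_class[OF tcR[OF w(1)] tcF D])
      define \<delta> where "\<delta> = fredholm_det (f w) - fredholm_det (f z) - op_trace (E w o\<^sub>L ?D)"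
      have "cmod \<delta> \<le> exp (a + \<epsilon> w) - exp a - \<epsilon> w * exp a"
        using fredholm_det_perturbation_trace_norm[OF tcz tcE[OF w(1)]] fE[of w] by (simp add: \<delta>_def a_def \<epsilon>_def)
      also have "\<dots> = exp a * (exp (\<epsilon> w) - 1 - \<epsilon> w)"
        by (simp add: exp_add algebra_simps)
      \<comment> \<open>The quadratic bound on the remainder of the exponential holds on the unit
        interval, hence the restriction to \<open>\<epsilon> w < 1\<close>.\<close>
      also have "\<dots> \<le> exp a * (\<epsilon> w)\<^sup>2"
        using exp_bound[of "\<epsilon> w"] \<epsilon>_nonneg[OF w(1)] \<epsilon>1 by (intro mult_left_mono) auto
      also have "\<dots> \<le> exp a * (\<epsilon> w * (cmod (w - z) * (\<rho> w + \<phi>)))"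
        unfolding power2_eq_square by (intro mult_left_mono \<epsilon>_le w \<epsilon>_nonneg) auto
      finally have "cmod \<delta> / cmod (w - z) \<le> exp a * (\<epsilon> w * (\<rho> w + \<phi>))"
        using w by (simp add: field_simps)
      moreover have "(fredholm_det (f w) - fredholm_det (f z)) / (w - z) - op_trace (F o\<^sub>L ?D)
          = \<delta> / (w - z) + op_trace (R w o\<^sub>L ?D)"
        using w by (simp add: \<delta>_def TE field_simps)
      moreover have "cmod (op_trace (R w o\<^sub>L ?D)) \<le> \<rho> w * norm ?D"
        unfolding \<rho>_def by (rule op_trace_compose_le[OF tcR[OF w(1)] D])
      ultimately show "norm ((fredholm_det (f w) - fredholm_det (f z)) / (w - z) - op_trace (F o\<^sub>L ?D))
          \<le> exp a * (\<epsilon> w * (\<rho> w + \<phi>)) + \<rho> w * norm ?D"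
        using norm_triangle_ineq[of "\<delta> / (w - z)" "op_trace (R w o\<^sub>L ?D)"] by (simp add: norm_divide)
    qed
  qed
qed

section \<open>Derivatives of operator-valued functions\<close>

lemma has_op_derivative_unique:
  assumes "has_op_derivative F F1 z" "has_op_derivative F F2 z"
  shows "F1 = F2"
proof -
  have "(\<lambda>h. h *\<^sub>C F1) = (\<lambda>h. h *\<^sub>C F2)"
    using assms unfolding has_op_derivative_def by (rule has_derivative_unique)
  then show ?thesis
    by (metis cvec.scale_one)
qed

lemma has_op_derivative_isCont: "has_op_derivative F F' z \<Longrightarrow> isCont F z"
  unfolding has_op_derivative_def by (rule has_derivative_continuous)

lemma has_op_derivative_transform:
  assumes "has_op_derivative F F' z" "open S" "z \<in> S" "\<And>w. w \<in> S \<Longrightarrow> F w = G w"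
  shows "has_op_derivative G F' z"
  unfolding has_op_derivative_def
  by (rule has_derivative_transform_within_open[OF assms(1)[unfolded has_op_derivative_def] assms(2,3)]) (rule assms(4))

lemma has_op_derivative_const: "has_op_derivative (\<lambda>_. T) 0 z"
  by (simp add: has_op_derivative_def)

lemma has_op_derivative_scaleC:
  assumes "(d has_field_derivative d') (at z)"
  shows "has_op_derivative (\<lambda>w. d w *\<^sub>C T) (d' *\<^sub>C T) z"
  unfolding has_op_derivative_def
  using bounded_linear.has_derivative[OF scaleC.bounded_linear_left[of T] assms[unfolded has_field_derivative_def]]
  by (simp add: scaleC_scaleC mult.commute)

lemma has_op_derivative_id_add: "has_op_derivative f f' z \<Longrightarrow> has_op_derivative (\<lambda>w. id_blinfun + f w) f' z"
  unfolding has_op_derivative_def by (auto intro!: derivative_eq_intros)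

lemma has_op_derivative_compose:
  assumes C: "has_op_derivative C C' z" and D: "has_op_derivative D D' z" and b: "C z \<in> bounded_ops"
  shows "has_op_derivative (\<lambda>w. C w o\<^sub>L D w) ((C z o\<^sub>L D') + (C' o\<^sub>L D z)) z"
  unfolding has_op_derivative_def
  using bounded_bilinear.FDERIV[OF bounded_bilinear_blinfun_compose C[unfolded has_op_derivative_def] D[unfolded has_op_derivative_def]]
  by (simp add: blinfun_compose_scaleC_left blinfun_compose_scaleC_right[OF b] scaleC_add_right)

lemma has_op_derivative_cinner:
  assumes "has_op_derivative F F' z"
  shows "((\<lambda>w. cinner x (blinfun_apply (F w) y)) has_field_derivative cinner x (blinfun_apply F' y)) (at z)"
proof -
  have "bounded_linear (\<lambda>T. cinner x (blinfun_apply T y))"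
    by (intro bounded_linear_compose[OF cinner.bounded_linear_right] blinfun.bounded_linear_left)
  from bounded_linear.has_derivative[OF this assms[unfolded has_op_derivative_def]]
  show ?thesis
    by (simp add: has_field_derivative_def scaleC_blinfun.rep_eq cinner_scaleC_right mult_commute_abs)
qed

text \<open>Differentiating \<open>(I + f) D = d I\<close>.\<close>

lemma has_op_derivative_adjugate:
  assumes S: "open S" "z \<in> S" and eq: "\<And>w. w \<in> S \<Longrightarrow> (id_blinfun + f w) o\<^sub>L D w = d w *\<^sub>C id_blinfun"
    and left: "D z o\<^sub>L (id_blinfun + f z) = d z *\<^sub>C id_blinfun" and nz: "d z \<noteq> 0"
    and b: "f z \<in> bounded_ops" "D z \<in> bounded_ops"
    and f: "has_op_derivative f f' z" and D: "has_op_derivative D D' z" and d: "(d has_field_derivative d') (at z)"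
  shows "has_op_derivative D ((1 / d z) *\<^sub>C (D z o\<^sub>L (d' *\<^sub>C id_blinfun - (f' o\<^sub>L D z)))) z"
proof -
  let ?C = "id_blinfun + f z"
  have "has_op_derivative (\<lambda>w. d w *\<^sub>C id_blinfun) ((?C o\<^sub>L D') + (f' o\<^sub>L D z)) z"
    by (rule has_op_derivative_transform[OF has_op_derivative_compose[OF has_op_derivative_id_add[OF f] D] S eq])
      (use b in auto)
  then have "(?C o\<^sub>L D') + (f' o\<^sub>L D z) = d' *\<^sub>C id_blinfun"
    using has_op_derivative_scaleC[OF d] has_op_derivative_unique by blast
  then have "d' *\<^sub>C id_blinfun - (f' o\<^sub>L D z) = ?C o\<^sub>L D'"
    by (simp add: algebra_simps)
  then have "D z o\<^sub>L (d' *\<^sub>C id_blinfun - (f' o\<^sub>L D z)) = (D z o\<^sub>L ?C) o\<^sub>L D'"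
    by (auto intro: blinfun_eqI)
  also have "\<dots> = d z *\<^sub>C D'"
    by (rule blinfun_eqI) (simp add: left scaleC_blinfun.rep_eq)
  finally have "(1 / d z) *\<^sub>C (D z o\<^sub>L (d' *\<^sub>C id_blinfun - (f' o\<^sub>L D z))) = D'"
    using nz by (simp add: scaleC_scaleC)
  then show ?thesis
    using D by simp
qed

section \<open>Derivatives along paths and of inverses\<close>

lemma has_op_derivative_path:
  assumes F: "has_op_derivative F F' (g t)" and g: "(g has_vector_derivative v) (at t within S)"
  shows "((\<lambda>t. F (g t)) has_vector_derivative v *\<^sub>C F') (at t within S)"
proof -
  have "((\<lambda>t. F (g t)) has_derivative (\<lambda>h. (h *\<^sub>R v) *\<^sub>C F')) (at t within S)"
    using has_derivative_compose[OF g[unfolded has_vector_derivative_def] F[unfolded has_op_derivative_def]] .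
  then show ?thesis
    by (simp add: has_vector_derivative_def scaleC.scaleR_left)
qed

lemma has_vector_derivative_quotient:
  fixes f :: "real \<Rightarrow> 'b::real_normed_vector"
  shows "(f has_vector_derivative D) (at t within S) \<longleftrightarrow>
    ((\<lambda>s. (1 / (s - t)) *\<^sub>R (f s - f t)) \<longlongrightarrow> D) (at t within S)"
proof -
  have "norm ((1 / norm (s - t)) *\<^sub>R (f s - (f t + (s - t) *\<^sub>R D))) = norm ((1 / (s - t)) *\<^sub>R (f s - f t) - D)"
    if "s \<noteq> t" for s
  proof -
    have "(1 / (s - t)) *\<^sub>R (f s - f t) - D = (1 / (s - t)) *\<^sub>R (f s - (f t + (s - t) *\<^sub>R D))"
      using that by (simp add: scaleR_diff_right scaleR_add_right)
    then show ?thesis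
      by simp
  qed
  then have "\<forall>\<^sub>F s in at t within S. norm ((1 / norm (s - t)) *\<^sub>R (f s - (f t + (s - t) *\<^sub>R D)))
      = norm ((1 / (s - t)) *\<^sub>R (f s - f t) - D)"
    by (simp add: eventually_at_filter)
  then have "((\<lambda>s. norm ((1 / norm (s - t)) *\<^sub>R (f s - (f t + (s - t) *\<^sub>R D)))) \<longlongrightarrow> 0) (at t within S)
      \<longleftrightarrow> ((\<lambda>s. norm ((1 / (s - t)) *\<^sub>R (f s - f t) - D)) \<longlongrightarrow> 0) (at t within S)"
    by (rule tendsto_cong)
  then show ?thesis
    unfolding has_vector_derivative_def has_derivative_within tendsto_norm_zero_iff
    by (simp add: bounded_linear_scaleR_left LIM_zero_iff)
qed

text \<open>Everything follows from the resolvent identity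
  \<open>K s - K t = - K s (\<Delta> s - \<Delta> t) K t\<close>; continuity comes first, because
  \<open>K s\<close> stands on its right-hand side.\<close>

lemma
  fixes \<Delta> K :: "real \<Rightarrow> 'a::real_normed_vector \<Rightarrow>\<^sub>L 'a"
  assumes inv: "\<And>s. s \<in> J \<Longrightarrow> K s o\<^sub>L \<Delta> s = id_blinfun" "\<And>s. s \<in> J \<Longrightarrow> \<Delta> s o\<^sub>L K s = id_blinfun" and t: "t \<in> J"
  shows inverse_tendsto: "(\<Delta> \<longlongrightarrow> \<Delta> t) (at t within J) \<Longrightarrow> (K \<longlongrightarrow> K t) (at t within J)"
    and inverse_has_vector_derivative: "(\<Delta> has_vector_derivative \<Delta>') (at t within J) \<Longrightarrow>
      (K has_vector_derivative - (K t o\<^sub>L \<Delta>' o\<^sub>L K t)) (at t within J)"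
proof -
  have 1: "blinfun_apply (K s) (blinfun_apply (\<Delta> s) x) = x" "blinfun_apply (\<Delta> s) (blinfun_apply (K s) x) = x"
    if "s \<in> J" for s x
    using arg_cong[OF inv(1)[OF that], of "\<lambda>T. blinfun_apply T x"] arg_cong[OF inv(2)[OF that], of "\<lambda>T. blinfun_apply T x"]
    by simp_all
  have diff: "K s - K t = - (K s o\<^sub>L (\<Delta> s - \<Delta> t) o\<^sub>L K t)" if "s \<in> J" for s
    by (rule blinfun_eqI) (simp add: blinfun.bilinear_simps 1 that t)
  have ev_J: "\<forall>\<^sub>F s in at t within J. s \<in> J"
    by (simp add: eventually_at_filter)
  have cont: "(K \<longlongrightarrow> K t) (at t within J)" if \<Delta>: "(\<Delta> \<longlongrightarrow> \<Delta> t) (at t within J)"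
  proof (rule LIM_zero_cancel, rule Lim_null_comparison)
    have "((\<lambda>s. 2 * (norm (K t))\<^sup>2 * norm (\<Delta> s - \<Delta> t)) \<longlongrightarrow> 2 * (norm (K t))\<^sup>2 * norm (\<Delta> t - \<Delta> t)) (at t within J)"
      by (intro tendsto_intros \<Delta>)
    then show "((\<lambda>s. 2 * (norm (K t))\<^sup>2 * norm (\<Delta> s - \<Delta> t)) \<longlongrightarrow> 0) (at t within J)"
      by simp
    have "((\<lambda>s. norm (\<Delta> s - \<Delta> t) * norm (K t)) \<longlongrightarrow> norm (\<Delta> t - \<Delta> t) * norm (K t)) (at t within J)"
      by (intro tendsto_intros \<Delta>)
    \<comment> \<open>Below 1/2 the identity can absorb \<open>norm (K s)\<close> and yields the
      local bound \<open>2 * norm (K t)\<close>.\<close>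
    then have "\<forall>\<^sub>F s in at t within J. norm (\<Delta> s - \<Delta> t) * norm (K t) < 1 / 2"
      by (rule order_tendstoD) simp
    with ev_J show "\<forall>\<^sub>F s in at t within J. norm (K s - K t) \<le> 2 * (norm (K t))\<^sup>2 * norm (\<Delta> s - \<Delta> t)"
    proof (rule eventually_elim2)
      fix s assume s: "s \<in> J" and half: "norm (\<Delta> s - \<Delta> t) * norm (K t) < 1 / 2"
      let ?e = "norm (\<Delta> s - \<Delta> t) * norm (K t)"
      have le: "norm (K s - K t) \<le> norm (K s) * ?e"
      proof -
        have "norm (K s - K t) \<le> norm (K s o\<^sub>L (\<Delta> s - \<Delta> t)) * norm (K t)"
          unfolding diff[OF s] norm_minus_cancel by (rule norm_blinfun_compose)
        also have "\<dots> \<le> (norm (K s) * norm (\<Delta> s - \<Delta> t)) * norm (K t)"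
          by (intro mult_right_mono norm_blinfun_compose) simp
        finally show ?thesis
          by (simp add: mult.assoc)
      qed
      also have "\<dots> \<le> norm (K s) * (1 / 2)"
        using half by (intro mult_left_mono) auto
      finally have "norm (K s) \<le> 2 * norm (K t)"
        using norm_triangle_sub[of "K s" "K t"] by simp
      then have "norm (K s) * ?e \<le> 2 * norm (K t) * ?e"
        by (intro mult_right_mono) auto
      then show "norm (K s - K t) \<le> 2 * (norm (K t))\<^sup>2 * norm (\<Delta> s - \<Delta> t)"
        using le by (simp add: power2_eq_square mult_ac)
    qed
  qed
  then show "(\<Delta> \<longlongrightarrow> \<Delta> t) (at t within J) \<Longrightarrow> (K \<longlongrightarrow> K t) (at t within J)" .
  assume d: "(\<Delta> has_vector_derivative \<Delta>') (at t within J)"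
  then have "(\<Delta> \<longlongrightarrow> \<Delta> t) (at t within J)"
    using has_vector_derivative_continuous continuous_within by blast
  note K = cont[OF this]
  note compose_tendsto = bounded_bilinear.tendsto[OF bounded_bilinear_blinfun_compose]
  have "((\<lambda>s. - (K s o\<^sub>L ((1 / (s - t)) *\<^sub>R (\<Delta> s - \<Delta> t)) o\<^sub>L K t)) \<longlongrightarrow> - (K t o\<^sub>L \<Delta>' o\<^sub>L K t)) (at t within J)"
    by (intro tendsto_minus compose_tendsto K tendsto_const d[unfolded has_vector_derivative_quotient])
  moreover have "- (K s o\<^sub>L ((1 / (s - t)) *\<^sub>R (\<Delta> s - \<Delta> t)) o\<^sub>L K t) = (1 / (s - t)) *\<^sub>R (K s - K t)" if "s \<in> J" for s
    unfolding diff[OF that] by (rule blinfun_eqI) (simp add: blinfun.bilinear_simps)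
  then have "\<forall>\<^sub>F s in at t within J. - (K s o\<^sub>L ((1 / (s - t)) *\<^sub>R (\<Delta> s - \<Delta> t)) o\<^sub>L K t) = (1 / (s - t)) *\<^sub>R (K s - K t)"
    using ev_J by (auto elim: eventually_mono)
  ultimately show "(K has_vector_derivative - (K t o\<^sub>L \<Delta>' o\<^sub>L K t)) (at t within J)"
    unfolding has_vector_derivative_quotient using tendsto_cong by fastforce
qed


section \<open>Analytic families\<close>

lemma zero_space_op_eq:
  fixes S T :: "'a::complex_hilbert_space \<Rightarrow>\<^sub>L 'a"
  assumes "\<And>x::'a. x = 0"
  shows "S = T"
  by (rule blinfun_eqI) (metis assms)

lemma op_analytic_onD:
  assumes "op_analytic_on F S" "z \<in> S"
  shows "F z \<in> bounded_ops" "\<exists>F'. has_op_derivative F F' z"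
proof -
  obtain e where e: "e > 0" "\<forall>w\<in>ball z e. F w \<in> bounded_ops \<and> (\<exists>F'. has_op_derivative F F' w)"
    using assms unfolding op_analytic_on_def by blast
  then have "z \<in> ball z e"
    by simp
  with e show "F z \<in> bounded_ops" "\<exists>F'. has_op_derivative F F' z"
    by blast+
qed

lemma adjugate_eq_if_inverse:
  assumes tc: "trace_class A" and nz: "fredholm_det A \<noteq> 0"
    and eq: "op_invertible (id_blinfun + A) \<Longrightarrow> op_inverse (id_blinfun + A) = (1 / fredholm_det A) *\<^sub>C D"
  shows "D = fredholm_adj A"
proof -
  note inv = fredholm_det_nonzero_inverse[OF tc nz]
  have "(1 / fredholm_det A) *\<^sub>C D = (1 / fredholm_det A) *\<^sub>C fredholm_adj A"
    using op_inverse_eq[OF inv] eq inv by (auto simp: op_invertible_def)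
  then show ?thesis
    using nz by (simp add: cvec.scale_cancel_left)
qed

text \<open>\<open>(I + f) D\<close> equals the determinant times the identity where \<open>I + f\<close> is invertible, hence is a
  multiple \<open>g I\<close> of the identity on all of \<open>\<Omega>\<close> by the identity theorem. Where \<open>g \<noteq> 0\<close>, \<open>I + f\<close> is
  invertible, so \<open>g\<close> vanishes together with the determinant.\<close>

lemma fredholm_det_analytic:
  fixes f D :: "complex \<Rightarrow> ('a::complex_hilbert_space \<Rightarrow>\<^sub>L 'a)"
  assumes \<Omega>: "open \<Omega>" "connected \<Omega>"
    and f: "op_analytic_on f \<Omega>" and tc: "\<And>z. z \<in> \<Omega> \<Longrightarrow> trace_class (f z)"
    and D: "op_analytic_on D \<Omega>"
    and Deq: "\<And>z. z \<in> \<Omega> \<Longrightarrow> op_invertible (id_blinfun + f z) \<Longrightarrow>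
        op_inverse (id_blinfun + f z) = (1 / fredholm_det (f z)) *\<^sub>C D z"
    and z0: "z0 \<in> \<Omega>" "fredholm_det (f z0) \<noteq> 0"
  shows "(\<lambda>z. fredholm_det (f z)) holomorphic_on \<Omega>"
    and "\<And>z. z \<in> \<Omega> \<Longrightarrow> (id_blinfun + f z) o\<^sub>L D z = fredholm_det (f z) *\<^sub>C id_blinfun"
    and "\<And>z. z \<in> \<Omega> \<Longrightarrow> D z o\<^sub>L (id_blinfun + f z) = fredholm_det (f z) *\<^sub>C id_blinfun"
proof -
  let ?d = "\<lambda>z. fredholm_det (f z)" and ?C = "\<lambda>z. id_blinfun + f z"
  have "?d holomorphic_on \<Omega> \<and> (\<forall>z\<in>\<Omega>. ?C z o\<^sub>L D z = ?d z *\<^sub>C id_blinfun \<and> D z o\<^sub>L ?C z = ?d z *\<^sub>C id_blinfun)"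
  \<comment> \<open>The zero space has no unit vector from which to read off the scalar function
    \<open>g\<close>; there all operators coincide and the determinant is constant.\<close>
  proof (cases "\<forall>x::'a. x = 0")
    case True
    then have "f z = 0" for z
      by (intro zero_space_op_eq) blast
    moreover have "?C z o\<^sub>L D z = ?d z *\<^sub>C id_blinfun" "D z o\<^sub>L ?C z = ?d z *\<^sub>C id_blinfun" for z
      using True by (intro zero_space_op_eq; blast)+
    ultimately show ?thesis
      by simp
  next
    case False
    then obtain x0 :: 'a where x0: "x0 \<noteq> 0" by blast
    define u where "u = (1 / norm x0) *\<^sub>R x0"
    have u: "cinner u u = 1"
      using x0 by (simp add: cinner_self u_def)
    define U where "U = {z \<in> \<Omega>. ?d z \<noteq> 0}"
    have nz: "?d z \<noteq> 0" if "z \<in> \<Omega>" "op_invertible (?C z)" for z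
      using fredholm_det_nonzero_if_inverse[OF that(2) Deq[OF that]] .
    \<comment> \<open>Continuity of the determinant is not yet known for a family that is continuous
      in operator norm. Openness comes from that of invertibility, since by \<open>nz\<close> an
      invertible \<open>I + f\<close> has nonzero determinant.\<close>
    have "open U"
      unfolding open_contains_ball
    proof
      fix z assume z: "z \<in> U"
      then obtain R where R: "is_op_inverse (?C z) R"
        using fredholm_det_nonzero_inverse[OF tc, of z] by (auto simp: U_def)
      obtain f' where "has_op_derivative f f' z"
        using op_analytic_onD(2)[OF f, of z] z by (auto simp: U_def)
      then have "isCont f z"
        by (rule has_op_derivative_isCont)
      then have "((\<lambda>w. norm R * norm (?C z - ?C w)) \<longlongrightarrow> norm R * norm (?C z - ?C z)) (at z)"
        unfolding isCont_def by (intro tendsto_intros)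
      then have "\<forall>\<^sub>F w in at z. norm R * norm (?C z - ?C w) < 1"
        by (rule order_tendstoD) simp
      moreover have "\<forall>\<^sub>F w in nhds z. w \<in> \<Omega>"
        using \<Omega> z by (intro eventually_nhds_in_open) (auto simp: U_def)
      ultimately have "\<forall>\<^sub>F w in nhds z. w \<in> \<Omega> \<and> norm R * norm (?C z - ?C w) < 1"
        by (auto simp: eventually_at_filter elim: eventually_elim2)
      then obtain r where r: "r > 0" "\<And>w. dist w z < r \<Longrightarrow> w \<in> \<Omega> \<and> norm R * norm (?C z - ?C w) < 1"
        by (auto simp: eventually_nhds_metric)
      have "w \<in> U" if "w \<in> ball z r" for w
      proof -
        have w: "w \<in> \<Omega>" "norm R * norm (?C z - ?C w) < 1"
          using r(2)[of w] that by (auto simp: dist_commute)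
        have "op_invertible (?C w)"
          using w z op_analytic_onD(1)[OF f] by (intro op_invertible_perturb[OF R]) (auto simp: U_def)
        then show ?thesis
          using nz w by (simp add: U_def)
      qed
      then show "\<exists>e>0. ball z e \<subseteq> U"
        using r(1) by blast
    qed
    have U0: "z0 \<in> U" "U \<subseteq> \<Omega>"
      using z0 by (auto simp: U_def)
    have onU: "?C z o\<^sub>L D z = ?d z *\<^sub>C id_blinfun" "D z o\<^sub>L ?C z = ?d z *\<^sub>C id_blinfun" if "z \<in> U" for z
    proof -
      have z: "z \<in> \<Omega>" "?d z \<noteq> 0"
        using that by (auto simp: U_def)
      have "D z = fredholm_adj (f z)"
        by (rule adjugate_eq_if_inverse[OF tc[OF z(1)] z(2) Deq[OF z(1)]])
      then show "?C z o\<^sub>L D z = ?d z *\<^sub>C id_blinfun" "D z o\<^sub>L ?C z = ?d z *\<^sub>C id_blinfun"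
        using fredholm_adj_right[OF tc[OF z(1)]] fredholm_adj_left[OF tc[OF z(1)]] by simp_all
    qed
    have hol: "(\<lambda>z. cinner x (blinfun_apply (G z) y)) holomorphic_on \<Omega>"
      if "\<And>z. z \<in> \<Omega> \<Longrightarrow> \<exists>G'. has_op_derivative G G' z" for G and x y :: 'a
      using that has_op_derivative_cinner \<Omega>(1) by (fastforce simp: holomorphic_on_open)
    have G1: "\<exists>G'. has_op_derivative (\<lambda>z. ?C z o\<^sub>L D z) G' z" "\<exists>G'. has_op_derivative (\<lambda>z. D z o\<^sub>L ?C z) G' z"
      if z: "z \<in> \<Omega>" for z
    proof -
      obtain f' D' where d: "has_op_derivative f f' z" "has_op_derivative D D' z"
        using op_analytic_onD(2)[OF f z] op_analytic_onD(2)[OF D z] by blast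
      have "?C z \<in> bounded_ops"
        using op_analytic_onD(1)[OF f z] by (intro bounded_ops_add) simp_all
      then show "\<exists>G'. has_op_derivative (\<lambda>z. ?C z o\<^sub>L D z) G' z" "\<exists>G'. has_op_derivative (\<lambda>z. D z o\<^sub>L ?C z) G' z"
        using has_op_derivative_compose[OF has_op_derivative_id_add[OF d(1)] d(2)]
          has_op_derivative_compose[OF d(2) has_op_derivative_id_add[OF d(1)] op_analytic_onD(1)[OF D z]] by blast+
    qed
    define g where "g z = cinner u (blinfun_apply (?C z o\<^sub>L D z) u)" for z
    have g_hol: "g holomorphic_on \<Omega>"
      unfolding g_def by (rule hol[OF G1(1)])
    have gU: "g z = ?d z" if "z \<in> U" for z
      unfolding g_def onU(1)[OF that] by (simp add: scaleC_blinfun.rep_eq cinner_scaleC_right u)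
    \<comment> \<open>Applied to both products of \<open>D\<close> and \<open>I + f\<close>: the
      identity theorem is used for each matrix element, as a scalar holomorphic function.\<close>
    have ident: "G z = g z *\<^sub>C id_blinfun"
      if z: "z \<in> \<Omega>" and G: "\<And>z. z \<in> \<Omega> \<Longrightarrow> \<exists>G'. has_op_derivative G G' z" "\<And>z. z \<in> U \<Longrightarrow> G z = ?d z *\<^sub>C id_blinfun"
      for G :: "complex \<Rightarrow> 'a \<Rightarrow>\<^sub>L 'a" and z
    proof (rule blinfun_eqI, rule cinner_eqI)
      fix x y :: 'a
      have "cinner x (blinfun_apply (G z) y) = g z * cinner x y"
      proof (rule analytic_continuation_open[of U \<Omega> "\<lambda>z. cinner x (blinfun_apply (G z) y)" "\<lambda>z. g z * cinner x y"])
        show "(\<lambda>z. g z * cinner x y) holomorphic_on \<Omega>"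
          by (intro holomorphic_intros g_hol)
        show "cinner x (blinfun_apply (G z) y) = g z * cinner x y" if "z \<in> U" for z
          using that by (simp add: G(2) gU scaleC_blinfun.rep_eq cinner_scaleC_right)
      qed (use \<open>open U\<close> \<Omega> U0 z hol[OF G(1)] in auto)
      then show "cinner x (blinfun_apply (G z) y) = cinner x (blinfun_apply (g z *\<^sub>C id_blinfun) y)"
        by (simp add: scaleC_blinfun.rep_eq cinner_scaleC_right)
    qed
    have CD: "?C z o\<^sub>L D z = g z *\<^sub>C id_blinfun" "D z o\<^sub>L ?C z = g z *\<^sub>C id_blinfun" if "z \<in> \<Omega>" for z
      using ident[OF that G1(1) onU(1)] ident[OF that G1(2) onU(2)] by auto
    have dg: "?d z = g z" if z: "z \<in> \<Omega>" for z
    proof (cases "z \<in> U")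
      case False
      then have d0: "?d z = 0"
        using z by (simp add: U_def)
      have "g z = 0"
      proof (rule ccontr)
        assume "g z \<noteq> 0"
        then have "is_op_inverse (?C z) ((1 / g z) *\<^sub>C D z)"
          using CD[OF z] op_analytic_onD(1)[OF D z] op_analytic_onD(1)[OF f z]
          by (auto simp: is_op_inverse_def blinfun_compose_scaleC_left blinfun_compose_scaleC_right scaleC_scaleC
              bounded_ops_add)
        then show False
          using nz[OF z] d0 by (auto simp: op_invertible_def)
      qed
      then show ?thesis
        using d0 by simp
    qed (simp add: gU)
    have "?d holomorphic_on \<Omega>"
      using g_hol dg holomorphic_cong by metis
    then show ?thesis
      using CD dg by simp
  qed
  then show "?d holomorphic_on \<Omega>"
    "\<And>z. z \<in> \<Omega> \<Longrightarrow> ?C z o\<^sub>L D z = ?d z *\<^sub>C id_blinfun"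
    "\<And>z. z \<in> \<Omega> \<Longrightarrow> D z o\<^sub>L ?C z = ?d z *\<^sub>C id_blinfun"
    by auto
qed

text \<open>For zeros of the determinant, where the equation with the inverse is silent: two
  functions continuous at the point that agree near it agree at it.\<close>

lemma adjugate_eq_at_limit:
  fixes z :: complex
  assumes "isCont D z" "((\<lambda>w. fredholm_adj (f w)) \<longlongrightarrow> fredholm_adj (f z)) (at z)"
    "\<forall>\<^sub>F w in at z. D w = fredholm_adj (f w)"
  shows "D z = fredholm_adj (f z)"
proof (rule tendsto_unique[of "at z" "\<lambda>w. fredholm_adj (f w)"])
  show "((\<lambda>w. fredholm_adj (f w)) \<longlongrightarrow> D z) (at z)"
    using assms(1) tendsto_cong[OF assms(3)] by (simp add: isCont_def)
qed (use assms in auto)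

text \<open>Isolated zeros; this supplies the punctured neighbourhoods for
  \<open>adjugate_eq_at_limit\<close>.\<close>

lemma eventually_nonzero_at:
  assumes "d holomorphic_on \<Omega>" "open \<Omega>" "connected \<Omega>" "z0 \<in> \<Omega>" "d z0 \<noteq> 0" "z \<in> \<Omega>"
  shows "\<forall>\<^sub>F w in at z. w \<in> \<Omega> \<and> d w \<noteq> 0"
proof -
  have "\<forall>\<^sub>F w in at z. d w \<noteq> 0"
  proof (cases "d z = 0")
    case True
    obtain r where r: "0 < r" "ball z r \<subseteq> \<Omega>" "\<And>w. w \<in> ball z r - {z} \<Longrightarrow> d w \<noteq> 0"
      using isolated_zeros[OF assms(1-3,6) True assms(4,5)] by blast
    then show ?thesis
      by (auto simp: eventually_at dist_commute intro!: exI[of _ r])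
  next
    case False
    have "isCont d z"
      using assms holomorphic_on_imp_continuous_on continuous_on_eq_continuous_at by blast
    then show ?thesis
      using False tendsto_imp_eventually_ne unfolding isCont_def by blast
  qed
  moreover have "\<forall>\<^sub>F w in at z. w \<in> \<Omega>"
    using assms by (intro eventually_at_in_open') auto
  ultimately show ?thesis
    by eventually_elim simp
qed

lemma has_op_derivative_param: "has_op_derivative (\<lambda>\<xi>. \<xi> *\<^sub>C A) A \<xi>"
  using has_op_derivative_scaleC[OF DERIV_ident, where T = A] by simp

text \<open>The difference quotient in the parameter equals \<open>A\<close> exactly, so the
  trace-norm condition holds with error zero.\<close>

lemma fredholm_adj_param_tendsto:
  assumes tc: "trace_class A"
  shows "((\<lambda>\<xi>. fredholm_adj (\<xi> *\<^sub>C A)) \<longlongrightarrow> fredholm_adj (\<xi>0 *\<^sub>C A)) (at \<xi>0)"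
proof (rule fredholm_has_derivative_trace_norm(2))
  have "trace_norm (0 :: 'a \<Rightarrow>\<^sub>L 'a) = 0"
    using trace_norm_scaleC[OF trace_class_0, of 0] by simp
  then have "\<forall>\<^sub>F \<xi> in at \<xi>0. trace_norm ((1 / (\<xi> - \<xi>0)) *\<^sub>C (\<xi> *\<^sub>C A - \<xi>0 *\<^sub>C A) - A) = 0"
    by (auto simp: eventually_at_filter scaleC_scaleC simp flip: cvec.scale_left_diff_distrib)
  then show "((\<lambda>\<xi>. trace_norm ((1 / (\<xi> - \<xi>0)) *\<^sub>C (\<xi> *\<^sub>C A - \<xi>0 *\<^sub>C A) - A)) \<longlongrightarrow> 0) (at \<xi>0)"
    by (rule tendsto_eventually)
qed (simp_all add: tc trace_class_scaleC)

lemma valid_path_derivative: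
  assumes "valid_path g"
  obtains S where "finite S" "\<And>t. t \<in> {0..1} - S \<Longrightarrow>
    (g has_vector_derivative vector_derivative g (at t within {0..1})) (at t)"
proof -
  obtain S where S: "finite S" "g C1_differentiable_on {0..1} - S"
    using assms unfolding valid_path_def piecewise_C1_differentiable_on_def by blast
  have "(g has_vector_derivative vector_derivative g (at t within {0..1})) (at t)" if "t \<in> {0..1} - S" for t
  proof -
    have d: "(g has_vector_derivative vector_derivative g (at t)) (at t)"
      using S(2) that by (simp add: C1_differentiable_on_eq vector_derivative_works)
    then have "vector_derivative g (at t within {0..1}) = vector_derivative g (at t)"
      using that by (intro vector_derivative_at_within_ivl) auto
    then show ?thesis
      using d by simp
  qed
  then show ?thesis
    using that[OF S(1)] by blast
qed

section \<open>Uniqueness for the initial value problem\<close>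

text \<open>The derivative of the path may be unbounded, so a Gronwall argument is not available. Instead
  the set of times where \<open>\<Delta>\<close> is \<open>\<delta>\<close> times the inverse of \<open>I + g A\<close> is shown to be open and closed:
  near such a time \<open>\<Delta>\<close> has an inverse \<open>K\<close>, and \<open>\<delta> K - g A\<close> has derivative zero.\<close>

context
  fixes A :: "'a::complex_hilbert_space \<Rightarrow>\<^sub>L 'a" and g :: "real \<Rightarrow> complex"
    and \<delta> :: "real \<Rightarrow> complex" and \<Delta> :: "real \<Rightarrow> 'a \<Rightarrow>\<^sub>L 'a" and v :: "real \<Rightarrow> complex" and S :: "real set"
  assumes tc: "trace_class A" and S: "finite S"
    and g: "continuous_on {0..1} g" "g 0 = 0" "g 1 = 1"
    and cont: "continuous_on {0..1} \<delta>" "continuous_on {0..1} \<Delta>"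
    and nz: "\<And>t. t \<in> {0..1} \<Longrightarrow> \<delta> t \<noteq> 0" and b: "\<And>t. t \<in> {0..1} \<Longrightarrow> \<Delta> t \<in> bounded_ops"
    and init: "\<delta> 0 = 1" "\<Delta> 0 = id_blinfun"
    and dg: "\<And>t. t \<in> {0..1} - S \<Longrightarrow> (g has_vector_derivative v t) (at t within {0..1})"
    and d\<delta>: "\<And>t. t \<in> {0..1} - S \<Longrightarrow>
      (\<delta> has_vector_derivative v t * op_trace (A o\<^sub>L \<Delta> t)) (at t within {0..1})"
    and d\<Delta>: "\<And>t. t \<in> {0..1} - S \<Longrightarrow>
      (\<Delta> has_vector_derivative v t *\<^sub>C (1 / \<delta> t) *\<^sub>C
        (\<Delta> t o\<^sub>L (op_trace (A o\<^sub>L \<Delta> t) *\<^sub>C id_blinfun - (A o\<^sub>L \<Delta> t)))) (at t within {0..1})"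
    and det_nz: "\<And>\<xi>. op_invertible (id_blinfun + \<xi> *\<^sub>C A) \<Longrightarrow> fredholm_det (\<xi> *\<^sub>C A) \<noteq> 0"
begin

text \<open>Both products are required, since a one-sided inverse need not be two-sided in infinite
  dimension.\<close>

definition resolvent_relation :: "real \<Rightarrow> bool"
  where "resolvent_relation t \<longleftrightarrow> \<Delta> t o\<^sub>L (id_blinfun + g t *\<^sub>C A) = \<delta> t *\<^sub>C id_blinfun \<and>
    (id_blinfun + g t *\<^sub>C A) o\<^sub>L \<Delta> t = \<delta> t *\<^sub>C id_blinfun"

lemma A_bounded: "A \<in> bounded_ops"
  using tc by (rule trace_class_bounded_ops)

lemma C_bounded: "id_blinfun + c *\<^sub>C A \<in> bounded_ops"
  by (intro bounded_ops_add bounded_ops_scaleC A_bounded) simp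

lemma resolvent_relation_inverse:
  assumes t: "t \<in> {0..1}" and r: "resolvent_relation t"
  shows "is_op_inverse (\<Delta> t) ((1 / \<delta> t) *\<^sub>C (id_blinfun + g t *\<^sub>C A))"
    and "is_op_inverse (id_blinfun + g t *\<^sub>C A) ((1 / \<delta> t) *\<^sub>C \<Delta> t)"
  using r nz[OF t] b[OF t] C_bounded[of "g t"]
  by (auto simp: is_op_inverse_def resolvent_relation_def blinfun_compose_scaleC_left
      blinfun_compose_scaleC_right scaleC_scaleC)

lemma resolvent_relation_open:
  assumes t1: "t1 \<in> {0..1}" and r1: "resolvent_relation t1"
  shows "\<exists>r>0. \<forall>t\<in>ball t1 r \<inter> {0..1}. resolvent_relation t"
proof -
  define K1 where "K1 = (1 / \<delta> t1) *\<^sub>C (id_blinfun + g t1 *\<^sub>C A)"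
  have K1: "is_op_inverse (\<Delta> t1) K1"
    unfolding K1_def by (rule resolvent_relation_inverse(1)[OF t1 r1])
  have "((\<lambda>t. norm K1 * norm (\<Delta> t1 - \<Delta> t)) \<longlongrightarrow> norm K1 * norm (\<Delta> t1 - \<Delta> t1)) (at t1 within {0..1})"
    using cont(2) t1 unfolding continuous_on_def by (intro tendsto_intros) auto
  then have "\<forall>\<^sub>F t in at t1 within {0..1}. norm K1 * norm (\<Delta> t1 - \<Delta> t) < 1"
    by (rule order_tendstoD) simp
  then obtain r where r: "r > 0" "\<And>t. t \<in> {0..1} \<Longrightarrow> t \<noteq> t1 \<Longrightarrow> dist t t1 < r \<Longrightarrow> norm K1 * norm (\<Delta> t1 - \<Delta> t) < 1"
    unfolding eventually_at by blast
  define J where "J = ball t1 r \<inter> {0..1}"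
  have J: "convex J" "t1 \<in> J" "J \<subseteq> {0..1}"
    using t1 r(1) by (auto simp: J_def intro: convex_Int)
  define K where "K t = op_inverse (\<Delta> t)" for t
  have K: "is_op_inverse (\<Delta> t) (K t)" if t: "t \<in> J" for t
  proof (cases "t = t1")
    case True
    then show ?thesis
      using K1 op_inverse_eq[OF K1] by (simp add: K_def)
  next
    case False
    then have "op_invertible (\<Delta> t)"
      using t r(2)[of t] b t1 by (intro op_invertible_perturb[OF K1]) (auto simp: J_def dist_commute)
    then show ?thesis
      unfolding K_def by (rule is_op_inverse_op_inverse)
  qed
  have KD: "K t o\<^sub>L \<Delta> t = id_blinfun" "\<Delta> t o\<^sub>L K t = id_blinfun" "K t \<in> bounded_ops" if "t \<in> J" for t
    using K[OF that] by (auto simp: is_op_inverse_def)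
  have sub: "at t within J \<le> at t within {0..1}" for t
    using J(3) by (rule at_le)
  define Q where "Q t = \<delta> t *\<^sub>C K t - g t *\<^sub>C A" for t
  have "(K \<longlongrightarrow> K t) (at t within J)" if "t \<in> J" for t
  proof (rule inverse_tendsto[OF KD(1,2) that])
    show "(\<Delta> \<longlongrightarrow> \<Delta> t) (at t within J)"
      using cont(2) that J(3) unfolding continuous_on_def by (intro tendsto_mono[OF sub]) auto
  qed auto
  then have "continuous_on J K"
    by (simp add: continuous_on_def)
  moreover have "continuous_on J \<delta>" "continuous_on J g"
    using cont(1) g(1) J(3) by (auto intro: continuous_on_subset)
  ultimately have Qc: "continuous_on J Q"
    unfolding Q_def
    by (intro continuous_on_diff bounded_bilinear.continuous_on[OF bounded_bilinear_scaleC] continuous_on_const)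
  have Qd: "(Q has_derivative (\<lambda>h. 0)) (at t within J)" if t: "t \<in> J - S" for t
  proof -
    have tS: "t \<in> {0..1} - S" "t \<in> J"
      using t J(3) by auto
    define \<tau> where "\<tau> = op_trace (A o\<^sub>L \<Delta> t)"
    define \<Delta>' where "\<Delta>' = v t *\<^sub>C (1 / \<delta> t) *\<^sub>C (\<Delta> t o\<^sub>L (\<tau> *\<^sub>C id_blinfun - (A o\<^sub>L \<Delta> t)))"
    have 1: "(\<delta> has_vector_derivative v t * \<tau>) (at t within J)"
      using has_vector_derivative_within_subset[OF d\<delta>[OF tS(1)] J(3)] by (simp add: \<tau>_def)
    have 2: "(g has_vector_derivative v t) (at t within J)"
      using has_vector_derivative_within_subset[OF dg[OF tS(1)] J(3)] .
    have "(\<Delta> has_vector_derivative \<Delta>') (at t within J)"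
      using has_vector_derivative_within_subset[OF d\<Delta>[OF tS(1)] J(3)] by (simp add: \<Delta>'_def \<tau>_def)
    with KD(1,2) tS(2) have 3: "(K has_vector_derivative - (K t o\<^sub>L \<Delta>' o\<^sub>L K t)) (at t within J)"
      by (rule inverse_has_vector_derivative)
    have "(Q has_vector_derivative (\<delta> t *\<^sub>C - (K t o\<^sub>L \<Delta>' o\<^sub>L K t) + (v t * \<tau>) *\<^sub>C K t) - (g t *\<^sub>C 0 + v t *\<^sub>C A)) (at t within J)"
      unfolding Q_def
      by (intro has_vector_derivative_diff scaleC.has_vector_derivative 1 2 3 has_vector_derivative_const)
    \<comment> \<open>The equation for \<Delta> was made for this cancellation:
      \<open>K \<Delta>' K\<close> is \<open>v / \<delta>\<close> times \<open>\<tau> K - A\<close>,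
      so after multiplication by \<delta> one part cancels the derivative of \<delta> and the other
      that of \<open>g A\<close>.\<close>
    moreover have "\<delta> t *\<^sub>C - (K t o\<^sub>L \<Delta>' o\<^sub>L K t) + (v t * \<tau>) *\<^sub>C K t - (g t *\<^sub>C 0 + v t *\<^sub>C A) = 0"
    proof (rule blinfun_eqI)
      fix x
      have Kt: "blinfun_apply (K t) (blinfun_apply (\<Delta> t) y) = y" "blinfun_apply (\<Delta> t) (blinfun_apply (K t) y) = y" for y
        using arg_cong[OF KD(1)[OF tS(2)], of "\<lambda>T. blinfun_apply T y"] arg_cong[OF KD(2)[OF tS(2)], of "\<lambda>T. blinfun_apply T y"]
        by simp_all
      have "blinfun_apply (K t) (blinfun_apply \<Delta>' (blinfun_apply (K t) x))
          = (v t * (1 / \<delta> t)) *\<^sub>C (\<tau> *\<^sub>C blinfun_apply (K t) x - blinfun_apply A x)"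
        by (simp add: \<Delta>'_def scaleC_blinfun.rep_eq bounded_opsD[OF KD(3)[OF tS(2)]] Kt blinfun.diff_left scaleC_scaleC)
      then show "blinfun_apply (\<delta> t *\<^sub>C - (K t o\<^sub>L \<Delta>' o\<^sub>L K t) + (v t * \<tau>) *\<^sub>C K t - (g t *\<^sub>C 0 + v t *\<^sub>C A)) x = blinfun_apply 0 x"
        using nz[of t] tS
        by (simp add: blinfun.add_left blinfun.diff_left blinfun.minus_left scaleC_blinfun.rep_eq scaleC_scaleC
            cvec.scale_right_diff_distrib cvec.scale_minus_right)
    qed
    ultimately show ?thesis
      by (simp add: has_vector_derivative_def)
  qed
  have "K t1 = K1"
    unfolding K_def by (rule op_inverse_eq[OF K1])
  then have Q1: "Q t1 = id_blinfun"
    using nz[OF t1] by (simp add: Q_def K1_def scaleC_scaleC)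
  have "resolvent_relation t" if t: "t \<in> J" for t
  proof -
    \<comment> \<open>On the interval \<open>J\<close> a continuous function whose derivative
      vanishes outside a finite set is constant.\<close>
    have "Q t = id_blinfun"
      by (rule has_derivative_zero_unique_strong_convex[OF J(1) S Qc J(2) Q1 Qd t])
    then have C: "id_blinfun + g t *\<^sub>C A = \<delta> t *\<^sub>C K t"
      by (simp add: Q_def algebra_simps)
    show ?thesis
      unfolding resolvent_relation_def C
      using KD[OF t] b t J(3) by (auto simp: blinfun_compose_scaleC_left blinfun_compose_scaleC_right)
  qed
  then show ?thesis
    using r(1) unfolding J_def by blast
qed

lemma resolvent_relation_all:
  assumes "t \<in> {0..1}"
  shows "resolvent_relation t"
proof -
  define T where "T = {t \<in> {0..1}. resolvent_relation t}"
  have "openin (top_of_set {0..1}) T"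
    unfolding openin_contains_ball
  proof (intro conjI ballI)
    fix t assume "t \<in> T"
    then obtain r where "r > 0" "\<forall>s\<in>ball t r \<inter> {0..1}. resolvent_relation s"
      using resolvent_relation_open[of t] by (auto simp: T_def)
    then show "\<exists>e>0. ball t e \<inter> {0..1} \<subseteq> T"
      by (auto simp: T_def)
  qed (auto simp: T_def)
  moreover have "closedin (top_of_set {0..1}) T"
  proof -
    note compose_cont = bounded_bilinear.continuous_on[OF bounded_bilinear_blinfun_compose]
      and scale_cont = bounded_bilinear.continuous_on[OF bounded_bilinear_scaleC]
    have "closedin (top_of_set {0..1}) ({t \<in> {0..1}. (\<Delta> t o\<^sub>L (id_blinfun + g t *\<^sub>C A)) - \<delta> t *\<^sub>C id_blinfun = 0} \<inter>
        {t \<in> {0..1}. ((id_blinfun + g t *\<^sub>C A) o\<^sub>L \<Delta> t) - \<delta> t *\<^sub>C id_blinfun = 0})"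
      by (intro closedin_Int continuous_closedin_preimage_constant continuous_on_diff compose_cont scale_cont
          continuous_on_add continuous_on_const cont g)
    also have "({t \<in> {0..1}. (\<Delta> t o\<^sub>L (id_blinfun + g t *\<^sub>C A)) - \<delta> t *\<^sub>C id_blinfun = 0} \<inter>
        {t \<in> {0..1}. ((id_blinfun + g t *\<^sub>C A) o\<^sub>L \<Delta> t) - \<delta> t *\<^sub>C id_blinfun = 0}) = T"
      by (auto simp: T_def resolvent_relation_def)
    finally show ?thesis .
  qed
  moreover have "0 \<in> T"
    using init g(2) by (auto simp: T_def resolvent_relation_def intro: blinfun_eqI)
  ultimately have "T = {0..1}"
    using connected_Icc[of "0::real" 1] unfolding connected_clopen by blast
  then have "t \<in> T"
    using assms by simp
  then show ?thesis
    by (simp add: T_def)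
qed

text \<open>The resolvent relation fixes only the quotient of \<Delta> by \<delta>. It also makes
  \<open>I + g A\<close> invertible along the path, so the determinant does not vanish there;
  \<delta> and the determinant have the same logarithmic derivative, and their ratio stays
  1.\<close>

lemma fredholm_ivp_unique: "\<delta> 1 = fredholm_det A" "\<Delta> 1 = fredholm_adj A"
proof -
  define q where "q \<xi> = fredholm_det (\<xi> *\<^sub>C A)" for \<xi>
  define q' where "q' \<xi> = op_trace (A o\<^sub>L fredholm_adj (\<xi> *\<^sub>C A))" for \<xi>
  have q: "(q has_field_derivative q' \<xi>) (at \<xi>)" for \<xi>
    unfolding q_def q'_def by (rule fredholm_det_scaleC_has_derivative[OF tc])
  have q_nz: "q (g t) \<noteq> 0" if "t \<in> {0..1}" for t
    unfolding q_def using resolvent_relation_inverse(2)[OF that resolvent_relation_all[OF that]]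
    by (intro det_nz) (auto simp: op_invertible_def)
  have \<Delta>_eq: "\<Delta> t = (\<delta> t / q (g t)) *\<^sub>C fredholm_adj (g t *\<^sub>C A)" if t: "t \<in> {0..1}" for t
  proof -
    have "(1 / \<delta> t) *\<^sub>C \<Delta> t = (1 / q (g t)) *\<^sub>C fredholm_adj (g t *\<^sub>C A)"
      using is_op_inverse_unique[OF resolvent_relation_inverse(2)[OF t resolvent_relation_all[OF t]]
          fredholm_det_nonzero_inverse[OF trace_class_scaleC[OF tc]]] q_nz[OF t] by (simp add: q_def)
    then have "\<delta> t *\<^sub>C (1 / \<delta> t) *\<^sub>C \<Delta> t = \<delta> t *\<^sub>C (1 / q (g t)) *\<^sub>C fredholm_adj (g t *\<^sub>C A)"
      by simp
    then show ?thesis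
      using nz[OF t] by (simp add: scaleC_scaleC)
  qed
  define r where "r t = \<delta> t * inverse (q (g t))" for t
  have inv: "((\<lambda>\<xi>. inverse (q \<xi>)) has_field_derivative - (inverse (q \<xi>) * q' \<xi> * inverse (q \<xi>))) (at \<xi>)"
    if "q \<xi> \<noteq> 0" for \<xi>
    by (rule DERIV_inverse'[OF q that])
  have "r 1 = 1"
  proof (rule has_derivative_zero_unique_strong_interval[OF S, where f = r and y = 1])
    have "continuous_on {0..1} (\<lambda>t. q (g t))"
      using continuous_on_compose2[of UNIV q "{0..1}" g] g(1) q DERIV_continuous_on[of UNIV q q'] by auto
    then show "continuous_on {0..1} r"
      unfolding r_def using q_nz by (intro continuous_intros cont) auto
    show "r 0 = 1"
      by (simp add: r_def init g(2) q_def fredholm_det_0)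
    fix t assume t: "t \<in> {0..1} - S"
    then have t01: "t \<in> {0..1}"
      by simp
    have "((\<lambda>t. inverse (q (g t))) has_vector_derivative v t * - (inverse (q (g t)) * q' (g t) * inverse (q (g t)))) (at t within {0..1})"
      using field_vector_diff_chain_within[OF dg[OF t] has_field_derivative_at_within[OF inv[OF q_nz[OF t01]]]]
      by (simp add: o_def)
    from has_vector_derivative_mult[OF d\<delta>[OF t] this]
    have "(r has_vector_derivative \<delta> t * (v t * - (inverse (q (g t)) * q' (g t) * inverse (q (g t))))
        + v t * op_trace (A o\<^sub>L \<Delta> t) * inverse (q (g t))) (at t within {0..1})"
      unfolding r_def .
    moreover have "op_trace (A o\<^sub>L \<Delta> t) = (\<delta> t / q (g t)) * q' (g t)"
      by (subst \<Delta>_eq[OF t01]) (simp add: blinfun_compose_scaleC_right[OF A_bounded] op_trace_scaleC q'_def)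
    ultimately have "(r has_vector_derivative 0) (at t within {0..1})"
      by (simp add: divide_inverse mult_ac)
    then show "(r has_derivative (\<lambda>h. 0)) (at t within {0..1})"
      by (simp add: has_vector_derivative_def)
  qed auto
  then show d1: "\<delta> 1 = fredholm_det A"
    using q_nz[of 1] g(3) by (simp add: r_def q_def field_simps)
  show "\<Delta> 1 = fredholm_adj A"
    using \<Delta>_eq[of 1] q_nz[of 1] g(3) d1 by (simp add: q_def)
qed

end

text \<open>The determinant may vanish between 0 and 1, and the equation for \<open>D\<xi>\<close>
  divides by it; integration therefore follows paths in the complex plane that avoid its zeros. In
  the uniqueness clause a solution with nonvanishing \<delta> itself keeps the path away from them.
  Analyticity of \<open>f\<close> gives convergence of difference quotients in operator norm, whence
  the trace-norm condition in the trace formula in \<lambda>.\<close>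

theorem mainTheorem2:
  fixes \<Omega> :: "complex set"
    and f f' D :: "complex \<Rightarrow> ('a::complex_hilbert_space \<Rightarrow>\<^sub>L 'a)"
    and d :: "complex \<Rightarrow> complex"
    and z0 :: complex
    and d\<xi> :: "complex \<Rightarrow> complex"
    and D\<xi> :: "complex \<Rightarrow> ('a \<Rightarrow>\<^sub>L 'a)"
  assumes separable: "separable_space (euclidean :: 'a topology)"
    and \<Omega>: "open \<Omega>" "connected \<Omega>"
    and f_analytic: "op_analytic_on f \<Omega>"
    and f_deriv: "\<And>z. z \<in> \<Omega> \<Longrightarrow> has_op_derivative f (f' z) z"
    and f_trace_class: "\<And>z. z \<in> \<Omega> \<Longrightarrow> trace_class (f z)"
    and f'_trace_class: "\<And>z. z \<in> \<Omega> \<Longrightarrow> trace_class (f' z)"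
    and d: "\<And>z. z \<in> \<Omega> \<Longrightarrow> d z = fredholm_det (f z)"
    and D_analytic: "op_analytic_on D \<Omega>"
    and D: "\<And>z. z \<in> \<Omega> \<Longrightarrow> op_invertible (id_blinfun + f z) \<Longrightarrow>
              op_inverse (id_blinfun + f z) = (1 / d z) *\<^sub>C D z"
    and z0: "z0 \<in> \<Omega>" "d z0 \<noteq> 0"
    and d\<xi>: "\<And>\<xi>. d\<xi> \<xi> = fredholm_det (\<xi> *\<^sub>C f z0)"
    and D\<xi>_analytic: "op_analytic_on D\<xi> UNIV"
    and D\<xi>: "\<And>\<xi>. op_invertible (id_blinfun + \<xi> *\<^sub>C f z0) \<Longrightarrow>
              op_inverse (id_blinfun + \<xi> *\<^sub>C f z0) = (1 / d\<xi> \<xi>) *\<^sub>C D\<xi> \<xi>"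
  shows
    "(\<comment> \<open>the functions of the parameter are analytic and of trace class\<close>
      op_analytic_on (\<lambda>\<xi>. \<xi> *\<^sub>C f z0) UNIV \<and>
      op_analytic_on (\<lambda>\<xi>. f z0) UNIV \<and>
      (\<forall>\<xi>. has_op_derivative (\<lambda>\<xi>. \<xi> *\<^sub>C f z0) (f z0) \<xi>) \<and>
      (\<forall>\<xi>. trace_class (\<xi> *\<^sub>C f z0)) \<and> trace_class (f z0)) \<and>
     (\<comment> \<open>differential equations in the parameter\<close>
      (\<forall>\<xi>. (d\<xi> has_field_derivative op_trace (f z0 o\<^sub>L D\<xi> \<xi>)) (at \<xi>)) \<and>
      (\<forall>\<xi>. d\<xi> \<xi> \<noteq> 0 \<longrightarrow>
        has_op_derivative D\<xi>
          ((1 / d\<xi> \<xi>) *\<^sub>C (D\<xi> \<xi> o\<^sub>L (deriv d\<xi> \<xi> *\<^sub>C id_blinfun - (f z0 o\<^sub>L D\<xi> \<xi>)))) \<xi>)) \<and>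
     (d\<xi> 0 = 1 \<and> D\<xi> 0 = id_blinfun) \<and>
     (d\<xi> 1 = d z0 \<and> D\<xi> 1 = D z0) \<and>
     (\<comment> \<open>integrated form: along every path from 0 to 1 avoiding the zeros of the determinant\<close>
      \<forall>g. valid_path g \<and> pathstart g = 0 \<and> pathfinish g = 1 \<and>
          (\<forall>\<xi>\<in>path_image g. d\<xi> \<xi> \<noteq> 0) \<longrightarrow>
        ((\<lambda>\<xi>. op_trace (f z0 o\<^sub>L D\<xi> \<xi>)) has_contour_integral (d z0 - 1)) g \<and>
        ((\<lambda>t. vector_derivative g (at t within {0..1}) *\<^sub>C
              (1 / d\<xi> (g t)) *\<^sub>C
              (D\<xi> (g t) o\<^sub>L (deriv d\<xi> (g t) *\<^sub>C id_blinfun - (f z0 o\<^sub>L D\<xi> (g t)))))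
          has_integral (D z0 - id_blinfun)) {0..1}) \<and>
     (\<comment> \<open>every solution of the initial value problem along a path from 0 to 1 ends
        at the values at \<open>z0\<close>\<close>
      \<forall>g \<delta> \<Delta> S. valid_path g \<and> pathstart g = 0 \<and> pathfinish g = 1 \<and> finite S \<and>
          continuous_on {0..1} \<delta> \<and> continuous_on {0..1} \<Delta> \<and>
          (\<forall>t\<in>{0..1}. \<delta> t \<noteq> 0 \<and> \<Delta> t \<in> bounded_ops) \<and>
          \<delta> 0 = 1 \<and> \<Delta> 0 = id_blinfun \<and>
          (\<forall>t\<in>{0..1} - S.
            (\<delta> has_vector_derivative
               vector_derivative g (at t within {0..1}) * op_trace (f z0 o\<^sub>L \<Delta> t))
              (at t within {0..1}) \<and>
            (\<Delta> has_vector_derivative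
               vector_derivative g (at t within {0..1}) *\<^sub>C
               (1 / \<delta> t) *\<^sub>C
               (\<Delta> t o\<^sub>L (op_trace (f z0 o\<^sub>L \<Delta> t) *\<^sub>C id_blinfun - (f z0 o\<^sub>L \<Delta> t))))
              (at t within {0..1})) \<longrightarrow>
        \<delta> 1 = d z0 \<and> \<Delta> 1 = D z0) \<and>
     (\<comment> \<open>the imbedding equations in \<open>\<lambda>\<close>\<close>
      (\<forall>z\<in>\<Omega>. d field_differentiable (at z)) \<and>
      (\<forall>z\<in>\<Omega>.
        ((\<lambda>w. trace_norm ((1 / (w - z)) *\<^sub>C (f w - f z) - f' z)) \<longlongrightarrow> 0) (at z) \<longrightarrow>
        deriv d z = op_trace (f' z o\<^sub>L D z)) \<and>
      (\<forall>z\<in>\<Omega>. d z \<noteq> 0 \<longrightarrow>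
        has_op_derivative D
          ((1 / d z) *\<^sub>C (D z o\<^sub>L (deriv d z *\<^sub>C id_blinfun - (f' z o\<^sub>L D z)))) z)) \<and>
     (f z0 = 0 \<longrightarrow> d z0 = 1 \<and> D z0 = id_blinfun)"
proof -

  \<comment> \<open>The family in the parameter \<xi>\<close>
  define A where "A = f z0"
  have tcA: "trace_class A"
    unfolding A_def by (rule f_trace_class[OF z0(1)])
  have Ab: "A \<in> bounded_ops"
    using tcA by (rule trace_class_bounded_ops)
  have d\<xi>': "d\<xi> = (\<lambda>\<xi>. fredholm_det (\<xi> *\<^sub>C A))"
    using d\<xi> by (auto simp: A_def)
  have tc\<xi>: "trace_class (\<xi> *\<^sub>C A)" for \<xi>
    by (rule trace_class_scaleC[OF tcA])
  have det_nz: "fredholm_det (\<xi> *\<^sub>C A) \<noteq> 0" if "op_invertible (id_blinfun + \<xi> *\<^sub>C A)" for \<xi>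
    by (rule fredholm_det_nonzero_if_inverse[OF that, of "D\<xi> \<xi>"]) (use D\<xi>[of \<xi>] that in \<open>simp add: A_def d\<xi>\<close>)
  have d\<xi>_deriv: "(d\<xi> has_field_derivative op_trace (A o\<^sub>L fredholm_adj (\<xi> *\<^sub>C A))) (at \<xi>)" for \<xi>
    unfolding d\<xi>' by (rule fredholm_det_scaleC_has_derivative[OF tcA])
  have d\<xi>_hol: "d\<xi> holomorphic_on UNIV"
    using d\<xi>_deriv by (auto simp: holomorphic_on_open)
  have d\<xi>0: "d\<xi> 0 = 1"
    by (simp add: d\<xi>' fredholm_det_0)
  have D\<xi>_eq': "D\<xi> \<xi> = fredholm_adj (\<xi> *\<^sub>C A)" if "d\<xi> \<xi> \<noteq> 0" for \<xi>
    using that D\<xi>[of \<xi>] by (intro adjugate_eq_if_inverse tc\<xi>) (auto simp: A_def d\<xi>)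
  \<comment> \<open>At zeros of \<open>d\<xi>\<close> only analyticity of \<open>D\<xi>\<close> is
    given. The value 1 at the origin makes the zeros isolated, so the identity extends by
    continuity.\<close>
  have D\<xi>_eq: "D\<xi> \<xi> = fredholm_adj (\<xi> *\<^sub>C A)" for \<xi>
  proof (rule adjugate_eq_at_limit[OF _ fredholm_adj_param_tendsto[OF tcA]])
    show "isCont D\<xi> \<xi>"
      using op_analytic_onD(2)[OF D\<xi>_analytic] has_op_derivative_isCont by blast
    have "\<forall>\<^sub>F w in at \<xi>. w \<in> UNIV \<and> d\<xi> w \<noteq> 0"
      by (rule eventually_nonzero_at[OF d\<xi>_hol, of 0]) (auto simp: d\<xi>0)
    then show "\<forall>\<^sub>F w in at \<xi>. D\<xi> w = fredholm_adj (w *\<^sub>C A)"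
      by (rule eventually_mono) (simp add: D\<xi>_eq')
  qed
  have d\<xi>_D: "(d\<xi> has_field_derivative op_trace (A o\<^sub>L D\<xi> \<xi>)) (at \<xi>)" for \<xi>
    using d\<xi>_deriv by (simp add: D\<xi>_eq)
  have D\<xi>_deriv: "has_op_derivative D\<xi>
      ((1 / d\<xi> \<xi>) *\<^sub>C (D\<xi> \<xi> o\<^sub>L (deriv d\<xi> \<xi> *\<^sub>C id_blinfun - (A o\<^sub>L D\<xi> \<xi>)))) \<xi>" if nz: "d\<xi> \<xi> \<noteq> 0" for \<xi>
  proof -
    obtain D' where D': "has_op_derivative D\<xi> D' \<xi>"
      using op_analytic_onD(2)[OF D\<xi>_analytic, of \<xi>] by auto
    show ?thesis
    proof (rule has_op_derivative_adjugate[where f = "\<lambda>\<xi>. \<xi> *\<^sub>C A" and d = d\<xi> and D = D\<xi>, OF open_UNIV UNIV_I _ _ nz _ _ has_op_derivative_param D'])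
      show "(id_blinfun + w *\<^sub>C A) o\<^sub>L D\<xi> w = d\<xi> w *\<^sub>C id_blinfun" for w
        unfolding D\<xi>_eq d\<xi>' by (rule fredholm_adj_right[OF tc\<xi>])
      show "D\<xi> \<xi> o\<^sub>L (id_blinfun + \<xi> *\<^sub>C A) = d\<xi> \<xi> *\<^sub>C id_blinfun"
        unfolding D\<xi>_eq d\<xi>' by (rule fredholm_adj_left[OF tc\<xi>])
      show "(d\<xi> has_field_derivative deriv d\<xi> \<xi>) (at \<xi>)"
        using d\<xi>_D DERIV_imp_deriv by metis
    qed (use op_analytic_onD(1)[OF D\<xi>_analytic] trace_class_bounded_ops[OF tc\<xi>] in auto)
  qed
  have d1: "d\<xi> 1 = d z0"
    by (simp add: d\<xi>' d[OF z0(1)] A_def)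
  have D_adj: "D z = fredholm_adj (f z)" if "z \<in> \<Omega>" "d z \<noteq> 0" for z
    using that D by (intro adjugate_eq_if_inverse f_trace_class) (auto simp: d)
  have D1: "D\<xi> 1 = D z0"
    using D_adj[OF z0] by (simp add: D\<xi>_eq A_def)
  have D\<xi>0: "D\<xi> 0 = id_blinfun"
    by (simp add: D\<xi>_eq fredholm_adj_0)

  \<comment> \<open>The family in \<lambda>\<close>
  have fam: "(\<lambda>z. fredholm_det (f z)) holomorphic_on \<Omega>"
    "\<And>z. z \<in> \<Omega> \<Longrightarrow> (id_blinfun + f z) o\<^sub>L D z = fredholm_det (f z) *\<^sub>C id_blinfun"
    "\<And>z. z \<in> \<Omega> \<Longrightarrow> D z o\<^sub>L (id_blinfun + f z) = fredholm_det (f z) *\<^sub>C id_blinfun"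
    by (rule fredholm_det_analytic[OF \<Omega> f_analytic f_trace_class D_analytic _ z0(1)]; use D d z0 in simp)+
  have d_hol: "d holomorphic_on \<Omega>"
    using fam(1) by (rule holomorphic_transform) (simp add: d)
  have d_diff: "d field_differentiable (at z)" if "z \<in> \<Omega>" for z
    using d_hol \<Omega>(1) that by (rule holomorphic_on_imp_differentiable_at)
  have D_cont: "isCont D z" if "z \<in> \<Omega>" for z
    using op_analytic_onD(2)[OF D_analytic that] has_op_derivative_isCont by blast
  \<comment> \<open>Trace-norm convergence is used twice: for the derivative of the determinant, and
    for continuity of the adjugate at \<open>z\<close>, which identifies \<open>D z\<close> even
    when \<open>d z = 0\<close>.\<close>
  have d_trace: "deriv d z = op_trace (f' z o\<^sub>L D z)"
    if z: "z \<in> \<Omega>" and lim: "((\<lambda>w. trace_norm ((1 / (w - z)) *\<^sub>C (f w - f z) - f' z)) \<longlongrightarrow> 0) (at z)" for z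
  proof -
    have "\<forall>\<^sub>F w in at z. w \<in> \<Omega>"
      using \<Omega>(1) z by (intro eventually_at_in_open') auto
    then have "\<forall>\<^sub>F w in at z. trace_class (f w)"
      by (rule eventually_mono) (rule f_trace_class)
    note derivs = fredholm_has_derivative_trace_norm[OF this f_trace_class[OF z] f'_trace_class[OF z] lim]
    have "(d has_field_derivative op_trace (f' z o\<^sub>L fredholm_adj (f z))) (at z)"
      by (rule has_field_derivative_transform_within_open[OF derivs(1) \<Omega>(1) z]) (simp add: d)
    moreover have "D z = fredholm_adj (f z)"
    proof (rule adjugate_eq_at_limit[OF D_cont[OF z] derivs(2)])
      show "\<forall>\<^sub>F w in at z. D w = fredholm_adj (f w)"
        using eventually_nonzero_at[OF d_hol \<Omega> z0 z] by (rule eventually_mono) (simp add: D_adj)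
    qed
    ultimately show ?thesis
      by (simp add: DERIV_imp_deriv)
  qed
  \<comment> \<open>This equation belongs to the operator norm: the product identity from
    \<open>fam\<close> is differentiated, and \<open>deriv d z\<close> is left as it stands.\<close>
  have D_deriv: "has_op_derivative D
      ((1 / d z) *\<^sub>C (D z o\<^sub>L (deriv d z *\<^sub>C id_blinfun - (f' z o\<^sub>L D z)))) z" if z: "z \<in> \<Omega>" and nz: "d z \<noteq> 0" for z
  proof -
    obtain D' where D': "has_op_derivative D D' z"
      using op_analytic_onD(2)[OF D_analytic z] by auto
    show ?thesis
      by (rule has_op_derivative_adjugate[where f = f and d = d and D = D, OF \<Omega>(1) z _ _ nz _ _ f_deriv[OF z] D'])
        (use fam z d op_analytic_onD(1)[OF D_analytic z] op_analytic_onD(1)[OF f_analytic z]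
          d_diff[OF z] field_differentiable_derivI in auto)
  qed
  \<comment> \<open>Both integrands are derivatives along the path, of \<open>d\<xi>\<close> and of
    \<open>D\<xi>\<close>, so the integrals are differences of end values.\<close>
  have path_int: "((\<lambda>\<xi>. op_trace (A o\<^sub>L D\<xi> \<xi>)) has_contour_integral (d z0 - 1)) g"
    "((\<lambda>t. vector_derivative g (at t within {0..1}) *\<^sub>C (1 / d\<xi> (g t)) *\<^sub>C
          (D\<xi> (g t) o\<^sub>L (deriv d\<xi> (g t) *\<^sub>C id_blinfun - (A o\<^sub>L D\<xi> (g t)))))
      has_integral (D z0 - id_blinfun)) {0..1}"
    if g: "valid_path g" "pathstart g = 0" "pathfinish g = 1" "\<forall>\<xi>\<in>path_image g. d\<xi> \<xi> \<noteq> 0" for g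
  proof -
    have g01: "g 0 = 0" "g 1 = 1"
      using g by (auto simp: pathstart_def pathfinish_def)
    have "((\<lambda>\<xi>. op_trace (A o\<^sub>L D\<xi> \<xi>)) has_contour_integral (d\<xi> (pathfinish g) - d\<xi> (pathstart g))) g"
      by (rule contour_integral_primitive[of UNIV d\<xi>]) (use d\<xi>_D g in auto)
    then show "((\<lambda>\<xi>. op_trace (A o\<^sub>L D\<xi> \<xi>)) has_contour_integral (d z0 - 1)) g"
      by (simp add: g d1 d\<xi>0)
    obtain S where S: "finite S" "\<And>t. t \<in> {0..1} - S \<Longrightarrow>
        (g has_vector_derivative vector_derivative g (at t within {0..1})) (at t)"
      using valid_path_derivative[OF g(1)] by blast
    have "((\<lambda>t. vector_derivative g (at t within {0..1}) *\<^sub>C (1 / d\<xi> (g t)) *\<^sub>C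
          (D\<xi> (g t) o\<^sub>L (deriv d\<xi> (g t) *\<^sub>C id_blinfun - (A o\<^sub>L D\<xi> (g t)))))
        has_integral (D\<xi> (g 1) - D\<xi> (g 0))) {0..1}"
    proof (rule fundamental_theorem_of_calculus_interior_strong[OF S(1)])
      fix t :: real assume t: "t \<in> {0<..<1} - S"
      then have "d\<xi> (g t) \<noteq> 0"
        using g(4) by (auto simp: path_image_def)
      then show "((\<lambda>t. D\<xi> (g t)) has_vector_derivative
          vector_derivative g (at t within {0..1}) *\<^sub>C (1 / d\<xi> (g t)) *\<^sub>C
          (D\<xi> (g t) o\<^sub>L (deriv d\<xi> (g t) *\<^sub>C id_blinfun - (A o\<^sub>L D\<xi> (g t))))) (at t)"
        using t by (intro has_op_derivative_path D\<xi>_deriv S(2)) auto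
    next
      have "continuous_on UNIV D\<xi>"
        using op_analytic_onD(2)[OF D\<xi>_analytic] has_op_derivative_isCont
        by (intro continuous_at_imp_continuous_on) blast
      then show "continuous_on {0..1} (\<lambda>t. D\<xi> (g t))"
        using valid_path_imp_path[OF g(1)] by (auto simp: path_def intro: continuous_on_compose2)
    qed auto
    then show "((\<lambda>t. vector_derivative g (at t within {0..1}) *\<^sub>C (1 / d\<xi> (g t)) *\<^sub>C
          (D\<xi> (g t) o\<^sub>L (deriv d\<xi> (g t) *\<^sub>C id_blinfun - (A o\<^sub>L D\<xi> (g t)))))
      has_integral (D z0 - id_blinfun)) {0..1}"
      by (simp add: g01 D1 D\<xi>0)
  qed
  have ivp: "\<delta> 1 = d z0 \<and> \<Delta> 1 = D z0"
    if g: "valid_path g" "pathstart g = 0" "pathfinish g = 1" and S: "finite S"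
      and cont: "continuous_on {0..1} \<delta>" "continuous_on {0..1} \<Delta>"
      and nz: "\<forall>t\<in>{0..1}. \<delta> t \<noteq> 0 \<and> \<Delta> t \<in> bounded_ops" and init: "\<delta> 0 = 1" "\<Delta> 0 = id_blinfun"
      and deriv: "\<forall>t\<in>{0..1} - S.
            (\<delta> has_vector_derivative
               vector_derivative g (at t within {0..1}) * op_trace (A o\<^sub>L \<Delta> t))
              (at t within {0..1}) \<and>
            (\<Delta> has_vector_derivative
               vector_derivative g (at t within {0..1}) *\<^sub>C
               (1 / \<delta> t) *\<^sub>C
               (\<Delta> t o\<^sub>L (op_trace (A o\<^sub>L \<Delta> t) *\<^sub>C id_blinfun - (A o\<^sub>L \<Delta> t))))
              (at t within {0..1})" for g \<delta> \<Delta> S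
  proof -
    obtain S' where S': "finite S'" "\<And>t. t \<in> {0..1} - S' \<Longrightarrow>
        (g has_vector_derivative vector_derivative g (at t within {0..1})) (at t)"
      using valid_path_derivative[OF g(1)] by blast
    \<comment> \<open>The corners of the path join the exceptional set, so that off the union the
      path is differentiable and the equations hold.\<close>
    have fin: "finite (S \<union> S')"
      using S S'(1) by simp
    have "g 0 = 0" "g 1 = 1" "continuous_on {0..1} g"
      using g valid_path_imp_path[OF g(1)] by (auto simp: pathstart_def pathfinish_def path_def)
    note path = this
    let ?v = "\<lambda>t. vector_derivative g (at t within {0..1})"
    have nz': "\<delta> t \<noteq> 0" and b': "\<Delta> t \<in> bounded_ops" if "t \<in> {0..1}" for t
      using nz that by auto
    have dg: "(g has_vector_derivative ?v t) (at t within {0..1})" if "t \<in> {0..1} - (S \<union> S')" for t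
      using that by (intro has_vector_derivative_at_within[OF S'(2)]) simp
    have d\<delta>: "(\<delta> has_vector_derivative ?v t * op_trace (A o\<^sub>L \<Delta> t)) (at t within {0..1})"
      and d\<Delta>: "(\<Delta> has_vector_derivative ?v t *\<^sub>C (1 / \<delta> t) *\<^sub>C
          (\<Delta> t o\<^sub>L (op_trace (A o\<^sub>L \<Delta> t) *\<^sub>C id_blinfun - (A o\<^sub>L \<Delta> t)))) (at t within {0..1})"
      if "t \<in> {0..1} - (S \<union> S')" for t
      using deriv that by blast+
    note unique = fredholm_ivp_unique[OF tcA fin path(3,1,2) cont nz' b' init dg d\<delta> d\<Delta> det_nz]
    have "\<delta> 1 = fredholm_det A" "\<Delta> 1 = fredholm_adj A"
      by (rule unique; assumption)+
    then show ?thesis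
      using d1 D1 by (simp add: d\<xi>' D\<xi>_eq)
  qed
  have entire: "op_analytic_on F UNIV" if "\<And>w. F w \<in> bounded_ops" "\<And>w. has_op_derivative F (F' w) w"
    for F F' :: "complex \<Rightarrow> 'a \<Rightarrow>\<^sub>L 'a"
    unfolding op_analytic_on_def using that zero_less_one by blast
  have param: "op_analytic_on (\<lambda>\<xi>. \<xi> *\<^sub>C A) UNIV" "op_analytic_on (\<lambda>\<xi>. A) UNIV"
    by (rule entire, rule bounded_ops_scaleC[OF Ab], rule has_op_derivative_param)
      (rule entire, rule Ab, rule has_op_derivative_const)
  have zero: "d z0 = 1 \<and> D z0 = id_blinfun" if "A = 0"
    using that d1 D1 d\<xi>0 D\<xi>0 by (simp add: d\<xi>' D\<xi>_eq)
  show ?thesis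
    unfolding A_def[symmetric]
  proof (intro conjI allI ballI impI)
  qed (use param has_op_derivative_param[of A] tc\<xi> tcA d\<xi>_D D\<xi>_deriv d\<xi>0 D\<xi>0 d1 D1 path_int ivp d_diff d_trace D_deriv zero
    in blast)+
qed

end
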